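(* Let $G$ be a linear algebraic group over $k$. Every regular $G$-connection is Fuchsian. For $G=\mathrm{GL}_n$ or $G=\mathrm{SL}_n$, every Fuchsian $G$-connection is regular.
   Context: $k$ is an algebraically closed field of characteristic zero, $\mathcal{O}=k[[z]]$ and $K=k((z))$. $D=K\partial_z$ is the $K$-vector space of continuous $k$-derivations of $K$, and $D_0=k[[z]]z\partial_z\subset D$. For a linear algebraic group $G$ over $k$ with Lie algebra $\mathfrak{g}$ put $\mathfrak{g}(K)=\mathfrak{g}\otimes_kK$. A $G$-connection is an element $A\in\mathrm{Hom}_K(D,\mathfrak{g}(K))=\mathfrak{g}(K)\,d\log z$, where $A=A(z\partial_z)\,d\log z$ and $d\log z=z^{-1}dz$. The group $G(K)$ acts by $g[A\,d\log z]=(\mathrm{Ad}(g)(A)+\widehat{z\partial_z}(g)g^{-1})\,d\log z$. Here $\widehat{z\partial_z}:G(K)\to G(K[\varepsilon])$ ($\varepsilon^2=0$) is induced by $f\mapsto f+z\frac{\partial f}{\partial z}\varepsilon$, and $\mathfrak{g}(K)=\ker(G(K[\varepsilon])\to G(K))$; for $G\subset\mathrm{GL}_n$ closed, $\widehat{z\partial_z}(g)g^{-1}$ is $z\partial_z(g)g^{-1}$ with $z\partial_z$ applied entrywise. Connections in the same $G(K)$-orbit are gauge equivalent. A connection is regular if it is gauge equivalent to an element of $\mathfrak{g}[[z]]\,d\log z$, where $\mathfrak g[[z]]=\mathfrak g\otimes_k k[[z]]$. A $D$-module is a $K$-vector space $M$ with a map $D\times M\to M$, $(\delta,m)\mapsto\delta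 m$, that is $K$-linear in $\delta$, additive in $m$, and satisfies $\delta(xm)=(\delta x)m+x(\delta m)$ for $x\in K$. For $m\in M$ let $E(m)$ be the smallest $\mathcal{O}$-submodule of $M$ that contains $m$ and is $D_0$-stable. $M$ is Fuchsian if $E(m)$ is a finitely generated $\mathcal{O}$-module for all $m\in M$. For a finite-dimensional (rational) representation $\rho:G\to\mathrm{GL}(V)$ and a $G$-connection $A$, let $\rho(A)\in\mathrm{Hom}_K(D,\mathfrak{gl}(V)(K))$ be the induced $\mathrm{GL}(V)$-connection (composition with the $K$-linear extension of $\mathrm{Lie}(\rho)$). It defines a $D$-module structure $\alpha_{\rho(A)}$ on $K\otimes_kV$ by $\alpha_{\rho(A)}(\delta,x\otimes v)=\delta(x)\otimes v-x\,\rho(A)(\delta)(v)$ for $x\in K$, $v\in V$. The connection $A$ is Fuchsian if for every finite-dimensional representation $\rho:G\to\mathrm{GL}(V)$ the $D$-module $(K\otimes_kV,\alpha_{\rho(A)})$ is Fuchsian. *)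

theory Defs
  imports
    "Jordan_Normal_Form.Determinant"
    "HOL-Library.Poly_Mapping"
    "HOL-Computational_Algebra.Formal_Laurent_Series"
begin

section \<open>Dual numbers\<close>

text \<open>\<open>Dual a b\<close> is \<open>a + b \<epsilon>\<close> with \<open>\<epsilon>\<^sup>2 = 0\<close>.\<close>

datatype 'a dual = Dual (dual_re: 'a) (dual_eps: 'a)

lemma dual_eqI: "dual_re x = dual_re y \<Longrightarrow> dual_eps x = dual_eps y \<Longrightarrow> x = y"
  by (cases x; cases y) simp

instantiation dual :: (comm_ring_1) comm_ring_1
begin

definition "0 = Dual 0 0"
definition "1 = Dual 1 0"
definition "x + y = Dual (dual_re x + dual_re y) (dual_eps x + dual_eps y)"
definition "x - y = Dual (dual_re x - dual_re y) (dual_eps x - dual_eps y)"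
definition "- x = Dual (- dual_re x) (- dual_eps x)"
definition "x * y = Dual (dual_re x * dual_re y) (dual_re x * dual_eps y + dual_eps x * dual_re y)"

instance
  by standard
    (auto simp: zero_dual_def one_dual_def plus_dual_def minus_dual_def uminus_dual_def
      times_dual_def algebra_simps)

end

abbreviation dual_const :: "'a::zero \<Rightarrow> 'a dual"
  where "dual_const c \<equiv> Dual c 0"

section \<open>Linear algebraic groups\<close>

text \<open>Polynomials in the matrix entries \<open>x\<^sub>i\<^sub>j\<close>; the variable \<open>x\<^sub>i\<^sub>j\<close> is the pair \<open>(i, j)\<close>.\<close>

type_synonym 'k entry_poly = "(nat \<times> nat \<Rightarrow>\<^sub>0 nat) \<Rightarrow>\<^sub>0 'k"

definition entry_polys :: "nat \<Rightarrow> 'k::zero entry_poly set" where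
  "entry_polys n = {p. \<forall>m \<in> Poly_Mapping.keys p. Poly_Mapping.keys m \<subseteq> {..<n} \<times> {..<n}}"

text \<open>The value at a matrix over a \<open>k\<close>-algebra \<open>R\<close> with structure map \<open>\<phi> : k \<rightarrow> R\<close>.\<close>

definition entry_eval :: "('k::zero \<Rightarrow> 'r::comm_ring_1) \<Rightarrow> 'k entry_poly \<Rightarrow> 'r mat \<Rightarrow> 'r" where
  "entry_eval \<phi> p g =
     (\<Sum>m \<in> Poly_Mapping.keys p. \<phi> (Poly_Mapping.lookup p m) * (\<Prod>ij \<in> Poly_Mapping.keys m. g $$ ij ^ Poly_Mapping.lookup m ij))"

definition GL :: "nat \<Rightarrow> 'r::comm_ring_1 mat monoid" where
  "GL n = units_of (ring_mat TYPE('r) n ())"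

definition SL :: "nat \<Rightarrow> 'r::comm_ring_1 mat set" where
  "SL n = {g \<in> carrier (GL n). det g = 1}"

text \<open>A linear algebraic group over an algebraically closed field \<open>k\<close> is a Zariski closed
  subgroup of some \<open>GL\<^sub>n(k)\<close>, given by its \<open>k\<close>-points.\<close>

definition linear_algebraic_group :: "nat \<Rightarrow> 'k::field mat set \<Rightarrow> bool" where
  "linear_algebraic_group n G \<longleftrightarrow> subgroup G (GL n) \<and>
     (\<exists>S \<subseteq> entry_polys n. G = {g \<in> carrier (GL n). \<forall>p \<in> S. entry_eval id p g = 0})"

definition vanishing_ideal :: "nat \<Rightarrow> 'k::field mat set \<Rightarrow> 'k entry_poly set" where
  "vanishing_ideal n G = {p \<in> entry_polys n. \<forall>g \<in> G. entry_eval id p g = 0}"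

text \<open>\<open>points \<phi> n G\<close> is \<open>G(R)\<close>, for \<open>R\<close> a \<open>k\<close>-algebra with structure map \<open>\<phi> : k \<rightarrow> R\<close>.\<close>

definition points :: "('k::field \<Rightarrow> 'r::comm_ring_1) \<Rightarrow> nat \<Rightarrow> 'k mat set \<Rightarrow> 'r mat set" where
  "points \<phi> n G = {g \<in> carrier (GL n). \<forall>p \<in> vanishing_ideal n G. entry_eval \<phi> p g = 0}"

text \<open>\<open>1 + \<epsilon> X\<close>\<close>

definition one_plus_eps :: "nat \<Rightarrow> 'r::comm_ring_1 mat \<Rightarrow> 'r dual mat" where
  "one_plus_eps n X = mat n n (\<lambda>(i, j). Dual (if i = j then 1 else 0) (X $$ (i, j)))"

text \<open>The Lie algebra is the kernel of \<open>G(k[\<epsilon>]) \<rightarrow> G(k)\<close>, as a subset of \<open>M\<^sub>n(k)\<close>.\<close>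

definition lie_algebra :: "nat \<Rightarrow> 'k::field mat set \<Rightarrow> 'k mat set" where
  "lie_algebra n G = {X \<in> carrier_mat n n. one_plus_eps n X \<in> points dual_const n G}"

text \<open>For a subring \<open>S\<close> of \<open>K = k((z))\<close> containing \<open>k\<close>, \<open>\<gg> \<otimes>\<^sub>k S\<close> is realised
  as the \<open>S\<close>-span of \<open>\<gg>\<close> in \<open>M\<^sub>n(K)\<close>.\<close>

definition lie_algebra_tensor :: "nat \<Rightarrow> 'k::field mat set \<Rightarrow> 'k fls set \<Rightarrow> 'k fls mat set" where
  "lie_algebra_tensor n G S =
     {mat n n (\<lambda>ij. \<Sum>l<r. c l * fls_const (X l $$ ij)) | (r :: nat) c X.
        \<forall>l<r. c l \<in> S \<and> X l \<in> lie_algebra n G}"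

text \<open>The image of \<open>\<O> = k[[z]]\<close> in \<open>K\<close>.\<close>

definition power_series :: "'k::field fls set" where
  "power_series = range fps_to_fls"

section \<open>Rational representations\<close>

definition unit_inverse :: "'r::comm_ring_1 \<Rightarrow> 'r" where
  "unit_inverse x = (THE y. x * y = 1)"

text \<open>Regular functions on a closed subgroup of \<open>GL\<^sub>n\<close> are restrictions of elements of
  \<open>k[x\<^sub>i\<^sub>j, 1/det]\<close>, so a morphism to \<open>m \<times> m\<close> matrices is given by numerators \<open>P i j\<close> over a
  common denominator \<open>det ^ N\<close>. Here it is evaluated at a matrix over an algebra \<open>\<phi> : k \<rightarrow> R\<close>.\<close>

definition rep_eval ::
  "('k::zero \<Rightarrow> 'r::comm_ring_1) \<Rightarrow> nat \<Rightarrow> (nat \<Rightarrow> nat \<Rightarrow> 'k entry_poly) \<Rightarrow> nat \<Rightarrow> 'r mat \<Rightarrow> 'r mat"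
  where "rep_eval \<phi> m P N g =
    mat m m (\<lambda>(i, j). entry_eval \<phi> (P i j) g * unit_inverse (det g) ^ N)"

definition rational_representation ::
  "nat \<Rightarrow> 'k::field mat set \<Rightarrow> nat \<Rightarrow> (nat \<Rightarrow> nat \<Rightarrow> 'k entry_poly) \<Rightarrow> nat \<Rightarrow> bool" where
  "rational_representation n G m P N \<longleftrightarrow>
     (\<forall>i<m. \<forall>j<m. P i j \<in> entry_polys n) \<and>
     rep_eval id m P N \<in> hom (GL n\<lparr>carrier := G\<rparr>) (GL m)"

text \<open>\<open>Lie(\<rho>)\<close> over a \<open>k\<close>-algebra \<open>\<phi> : k \<rightarrow> R\<close>, from
  \<open>\<rho>(1 + \<epsilon> X) = 1 + \<epsilon> Lie(\<rho>)(X)\<close>. Over \<open>K\<close> this is the \<open>K\<close>-linear extension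
  of \<open>Lie(\<rho>)\<close> over \<open>k\<close>, see \<open>lie_rep_extension\<close> below.\<close>

definition lie_rep ::
  "('k::zero \<Rightarrow> 'r::comm_ring_1) \<Rightarrow> nat \<Rightarrow> nat \<Rightarrow> (nat \<Rightarrow> nat \<Rightarrow> 'k entry_poly) \<Rightarrow> nat \<Rightarrow>
     'r mat \<Rightarrow> 'r mat" where
  "lie_rep \<phi> n m P N X =
     map_mat dual_eps (rep_eval (\<lambda>c. dual_const (\<phi> c)) m P N (one_plus_eps n X))"

text \<open>Joint affine-linearity of a function of \<open>1 + \<epsilon> X\<close> over \<open>k\<close> and its
  base change along \<open>\<phi>\<close>.\<close>

definition eps_affine ::
  "('k::comm_ring_1 \<Rightarrow> 'r::comm_ring_1) \<Rightarrow> nat \<Rightarrow> ('k dual mat \<Rightarrow> 'k dual) \<Rightarrow> ('r dual mat \<Rightarrow> 'r dual) \<Rightarrow> bool"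
  where "eps_affine \<phi> n F F' \<longleftrightarrow> (\<exists>a c.
     (\<forall>X. F (one_plus_eps n X) = Dual a (\<Sum>i<n. \<Sum>j<n. c i j * X $$ (i, j))) \<and>
     (\<forall>Y. F' (one_plus_eps n Y) = Dual (\<phi> a) (\<Sum>i<n. \<Sum>j<n. \<phi> (c i j) * Y $$ (i, j))))"

context comm_ring_hom
begin

lemma eps_affine_const: "eps_affine hom n (\<lambda>_. dual_const a) (\<lambda>_. dual_const (hom a))"
  unfolding eps_affine_def by (rule exI[of _ a], rule exI[of _ "\<lambda>_ _. 0"]) simp

lemma eps_affine_add:
  assumes "eps_affine hom n F F'" "eps_affine hom n H H'"
  shows "eps_affine hom n (\<lambda>g. F g + H g) (\<lambda>g. F' g + H' g)"
proof -
  from assms(1) obtain a c where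
    F: "\<And>X. F (one_plus_eps n X) = Dual a (\<Sum>i<n. \<Sum>j<n. c i j * X $$ (i, j))"
    "\<And>Y. F' (one_plus_eps n Y) = Dual (hom a) (\<Sum>i<n. \<Sum>j<n. hom (c i j) * Y $$ (i, j))"
    unfolding eps_affine_def by blast
  from assms(2) obtain b d where
    H: "\<And>X. H (one_plus_eps n X) = Dual b (\<Sum>i<n. \<Sum>j<n. d i j * X $$ (i, j))"
    "\<And>Y. H' (one_plus_eps n Y) = Dual (hom b) (\<Sum>i<n. \<Sum>j<n. hom (d i j) * Y $$ (i, j))"
    unfolding eps_affine_def by blast
  show ?thesis unfolding eps_affine_def
    by (rule exI[of _ "a + b"], rule exI[of _ "\<lambda>i j. c i j + d i j"])
      (simp add: F H plus_dual_def hom_add distrib_right sum.distrib)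
qed

lemma eps_affine_mult:
  assumes "eps_affine hom n F F'" "eps_affine hom n H H'"
  shows "eps_affine hom n (\<lambda>g. F g * H g) (\<lambda>g. F' g * H' g)"
proof -
  from assms(1) obtain a c where
    F: "\<And>X. F (one_plus_eps n X) = Dual a (\<Sum>i<n. \<Sum>j<n. c i j * X $$ (i, j))"
    "\<And>Y. F' (one_plus_eps n Y) = Dual (hom a) (\<Sum>i<n. \<Sum>j<n. hom (c i j) * Y $$ (i, j))"
    unfolding eps_affine_def by blast
  from assms(2) obtain b d where
    H: "\<And>X. H (one_plus_eps n X) = Dual b (\<Sum>i<n. \<Sum>j<n. d i j * X $$ (i, j))"
    "\<And>Y. H' (one_plus_eps n Y) = Dual (hom b) (\<Sum>i<n. \<Sum>j<n. hom (d i j) * Y $$ (i, j))"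
    unfolding eps_affine_def by blast
  show ?thesis unfolding eps_affine_def
    by (rule exI[of _ "a * b"], rule exI[of _ "\<lambda>i j. a * d i j + b * c i j"])
      (simp add: F H times_dual_def hom_add hom_mult sum.distrib sum_distrib_left
        sum_distrib_right algebra_simps)
qed

lemma eps_affine_sum:
  "(\<And>x. x \<in> A \<Longrightarrow> eps_affine hom n (F x) (F' x)) \<Longrightarrow>
   eps_affine hom n (\<lambda>g. \<Sum>x\<in>A. F x g) (\<lambda>g. \<Sum>x\<in>A. F' x g)"
  using eps_affine_const[of n 0]
  by (induction A rule: infinite_finite_induct) (auto simp: zero_dual_def intro: eps_affine_add)

lemma eps_affine_prod:
  "(\<And>x. x \<in> A \<Longrightarrow> eps_affine hom n (F x) (F' x)) \<Longrightarrow>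
   eps_affine hom n (\<lambda>g. \<Prod>x\<in>A. F x g) (\<lambda>g. \<Prod>x\<in>A. F' x g)"
  using eps_affine_const[of n 1]
  by (induction A rule: infinite_finite_induct) (auto simp: one_dual_def intro: eps_affine_mult)

lemma eps_affine_power:
  "eps_affine hom n F F' \<Longrightarrow> eps_affine hom n (\<lambda>g. F g ^ r) (\<lambda>g. F' g ^ r)"
  using eps_affine_const[of n 1] by (induction r) (auto simp: one_dual_def intro: eps_affine_mult)

lemma eps_affine_entry:
  assumes "i < n" "j < n"
  shows "eps_affine hom n (\<lambda>g. g $$ (i, j)) (\<lambda>g. g $$ (i, j))"
proof -
  have *: "(\<Sum>i'<n. \<Sum>j'<n. (if i' = i \<and> j' = j then 1 else 0) * X $$ (i', j')) = X $$ (i, j)"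
    for X :: "'z::comm_ring_1 mat"
  proof -
    have "(\<Sum>i'<n. \<Sum>j'<n. (if i' = i \<and> j' = j then 1 else 0) * X $$ (i', j'))
        = (\<Sum>i'<n. if i' = i then X $$ (i, j) else 0)"
    proof (rule sum.cong[OF refl])
      fix i' show "(\<Sum>j'<n. (if i' = i \<and> j' = j then 1 else 0) * X $$ (i', j'))
          = (if i' = i then X $$ (i, j) else 0)"
        using assms by (cases "i' = i") (simp_all add: if_distrib[of "\<lambda>x. x * _"] cong: if_cong)
    qed
    also have "\<dots> = X $$ (i, j)" using assms by simp
    finally show ?thesis .
  qed
  have h: "hom (if P then 1 else 0) = (if P then 1 else 0)" for P by simp
  show ?thesis unfolding eps_affine_def
    apply (rule exI[of _ "if i = j then 1 else 0"],
        rule exI[of _ "\<lambda>i' j'. if i' = i \<and> j' = j then 1 else 0"])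
    unfolding h * using assms by (simp add: one_plus_eps_def)
qed

lemma eps_affine_entry_eval:
  assumes "p \<in> entry_polys n"
  shows "eps_affine hom n (entry_eval (\<lambda>c. dual_const c) p) (entry_eval (\<lambda>c. dual_const (hom c)) p)"
proof -
  have "eps_affine hom n
      (\<lambda>g. \<Sum>m \<in> Poly_Mapping.keys p. dual_const (Poly_Mapping.lookup p m) *
        (\<Prod>ij \<in> Poly_Mapping.keys m. g $$ ij ^ Poly_Mapping.lookup m ij))
      (\<lambda>g. \<Sum>m \<in> Poly_Mapping.keys p. dual_const (hom (Poly_Mapping.lookup p m)) *
        (\<Prod>ij \<in> Poly_Mapping.keys m. g $$ ij ^ Poly_Mapping.lookup m ij))"
    by (intro eps_affine_sum eps_affine_mult eps_affine_const eps_affine_prod eps_affine_power)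
      (use assms in \<open>auto simp: entry_polys_def intro!: eps_affine_entry\<close>)
  then show ?thesis unfolding entry_eval_def[abs_def] .
qed

end

lemma dual_of_int_sign: "(signof p :: 'a::comm_ring_1 dual) = dual_const (signof p)"
  by (auto simp: sign_def one_dual_def uminus_dual_def)

lemma det_one_plus_eps_re: "dual_re (det (one_plus_eps n X)) = (1 :: 'a::comm_ring_1)"
proof -
  interpret re: comm_ring_hom "dual_re :: 'a dual \<Rightarrow> 'a"
    by standard (auto simp: zero_dual_def one_dual_def plus_dual_def times_dual_def)
  have "map_mat dual_re (one_plus_eps n X) = 1\<^sub>m n"
    by (rule eq_matI) (auto simp: one_plus_eps_def)
  then show ?thesis using re.hom_det[of "one_plus_eps n X"] by simp
qed

lemma unit_inverse_eps: "unit_inverse (Dual 1 b) = Dual 1 (- b)"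
  unfolding unit_inverse_def
proof (rule the_equality)
  show "Dual 1 b * Dual 1 (- b) = 1" by (simp add: times_dual_def one_dual_def)
  show "Dual 1 b * y = 1 \<Longrightarrow> y = Dual 1 (- b)" for y
    by (cases y) (auto simp: times_dual_def one_dual_def eq_neg_iff_add_eq_0)
qed

context comm_ring_hom
begin

lemma eps_affine_unit_inverse_det:
  "eps_affine hom n (\<lambda>g. unit_inverse (det g)) (\<lambda>g. unit_inverse (det g))"
proof -
  have *: "det (one_plus_eps n X) = (\<Sum>p \<in> {p. p permutes {0..<n}}. dual_const (signof p) *
      (\<Prod>i = 0..<n. one_plus_eps n X $$ (i, p i)))" for X :: "'z::comm_ring_1 mat"
    using det_def'[of "one_plus_eps n X" n] by (simp add: one_plus_eps_def dual_of_int_sign)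
  have "eps_affine hom n
      (\<lambda>g. \<Sum>p \<in> {p. p permutes {0..<n}}. dual_const (signof p) * (\<Prod>i = 0..<n. g $$ (i, p i)))
      (\<lambda>g. \<Sum>p \<in> {p. p permutes {0..<n}}. dual_const (hom (signof p)) * (\<Prod>i = 0..<n. g $$ (i, p i)))"
    by (intro eps_affine_sum eps_affine_mult eps_affine_const eps_affine_prod eps_affine_entry)
      (auto dest: permutes_in_image)
  then obtain a c where
    d: "\<And>X. det (one_plus_eps n X) = Dual a (\<Sum>i<n. \<Sum>j<n. c i j * X $$ (i, j))"
    "\<And>Y. det (one_plus_eps n Y) = Dual (hom a) (\<Sum>i<n. \<Sum>j<n. hom (c i j) * Y $$ (i, j))"
    unfolding eps_affine_def hom_signof *[symmetric] by blast
  have a: "a = 1" using det_one_plus_eps_re[of n "0\<^sub>m n n :: 'a mat"] unfolding d(1) by simp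
  show ?thesis unfolding eps_affine_def
    by (rule exI[of _ 1], rule exI[of _ "\<lambda>i j. - c i j"])
      (simp add: d a unit_inverse_eps sum_negf hom_uminus)
qed

lemma lie_rep_coefficients:
  assumes "\<forall>i<m. \<forall>j<m. P i j \<in> entry_polys n"
  obtains C where
    "\<And>X. lie_rep (\<lambda>c. c) n m P N X =
       mat m m (\<lambda>(i, j). \<Sum>a<n. \<Sum>b<n. C i j a b * X $$ (a, b))"
    "\<And>Y. lie_rep hom n m P N Y =
       mat m m (\<lambda>(i, j). \<Sum>a<n. \<Sum>b<n. hom (C i j a b) * Y $$ (a, b))"
proof -
  have "\<exists>c. i < m \<longrightarrow> j < m \<longrightarrow>
      (\<forall>X. lie_rep (\<lambda>c. c) n m P N X $$ (i, j) = (\<Sum>a<n. \<Sum>b<n. c a b * X $$ (a, b))) \<and>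
      (\<forall>Y. lie_rep hom n m P N Y $$ (i, j) = (\<Sum>a<n. \<Sum>b<n. hom (c a b) * Y $$ (a, b)))" for i j
  proof (cases "i < m \<and> j < m")
    case True
    have "eps_affine hom n
        (\<lambda>g. entry_eval (\<lambda>c. dual_const c) (P i j) g * unit_inverse (det g) ^ N)
        (\<lambda>g. entry_eval (\<lambda>c. dual_const (hom c)) (P i j) g * unit_inverse (det g) ^ N)"
      using assms True
      by (intro eps_affine_mult eps_affine_power eps_affine_unit_inverse_det eps_affine_entry_eval) auto
    then obtain a c where
      "\<And>X. entry_eval (\<lambda>c. dual_const c) (P i j) (one_plus_eps n X) *
         unit_inverse (det (one_plus_eps n X)) ^ N = Dual a (\<Sum>i<n. \<Sum>j<n. c i j * X $$ (i, j))"
      "\<And>Y. entry_eval (\<lambda>c. dual_const (hom c)) (P i j) (one_plus_eps n Y) *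
         unit_inverse (det (one_plus_eps n Y)) ^ N =
         Dual (hom a) (\<Sum>i<n. \<Sum>j<n. hom (c i j) * Y $$ (i, j))"
      unfolding eps_affine_def by blast
    with True show ?thesis
      by (intro exI[of _ c]) (simp add: lie_rep_def rep_eval_def)
  qed auto
  then have "\<forall>i. \<exists>C. \<forall>j. i < m \<longrightarrow> j < m \<longrightarrow>
      (\<forall>X. lie_rep (\<lambda>c. c) n m P N X $$ (i, j) = (\<Sum>a<n. \<Sum>b<n. C j a b * X $$ (a, b))) \<and>
      (\<forall>Y. lie_rep hom n m P N Y $$ (i, j) = (\<Sum>a<n. \<Sum>b<n. hom (C j a b) * Y $$ (a, b)))"
    by (intro allI choice)
  from choice[OF this] obtain C where C: "\<And>i j. i < m \<Longrightarrow> j < m \<Longrightarrow>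
      (\<forall>X. lie_rep (\<lambda>c. c) n m P N X $$ (i, j) = (\<Sum>a<n. \<Sum>b<n. C i j a b * X $$ (a, b))) \<and>
      (\<forall>Y. lie_rep hom n m P N Y $$ (i, j) = (\<Sum>a<n. \<Sum>b<n. hom (C i j a b) * Y $$ (a, b)))"
    by blast
  have dim: "dim_row (lie_rep \<psi> n m P N X) = m" "dim_col (lie_rep \<psi> n m P N X) = m"
    for \<psi> :: "'a \<Rightarrow> 'z::comm_ring_1" and X
    by (simp_all add: lie_rep_def rep_eval_def)
  show ?thesis
    by (rule that[of C]; rule eq_matI) (simp_all add: C dim)
qed

text \<open>\<open>lie_rep hom\<close> is linear and restricts to \<open>lie_rep id\<close> on constant matrices.\<close>

lemma lie_rep_extension:
  assumes P: "\<forall>i<m. \<forall>j<m. P i j \<in> entry_polys n"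
    and X: "X \<in> carrier_mat n n" "Y \<in> carrier_mat n n" "Z \<in> carrier_mat n n"
  shows "lie_rep hom n m P N (X + Y) = lie_rep hom n m P N X + lie_rep hom n m P N Y"
    and "lie_rep hom n m P N (c \<cdot>\<^sub>m X) = c \<cdot>\<^sub>m lie_rep hom n m P N X"
    and "lie_rep hom n m P N (map_mat hom Z) = map_mat hom (lie_rep id n m P N Z)"
proof -
  obtain C where C: "\<And>X. lie_rep (\<lambda>c. c) n m P N X =
       mat m m (\<lambda>(i, j). \<Sum>a<n. \<Sum>b<n. C i j a b * X $$ (a, b))"
    "\<And>Y. lie_rep hom n m P N Y =
       mat m m (\<lambda>(i, j). \<Sum>a<n. \<Sum>b<n. hom (C i j a b) * Y $$ (a, b))"
    by (rule lie_rep_coefficients[OF P, where N = N]) blast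
  show "lie_rep hom n m P N (X + Y) = lie_rep hom n m P N X + lie_rep hom n m P N Y"
    unfolding C using X by (intro eq_matI) (auto simp: distrib_left sum.distrib)
  show "lie_rep hom n m P N (c \<cdot>\<^sub>m X) = c \<cdot>\<^sub>m lie_rep hom n m P N X"
    unfolding C using X
    by (intro eq_matI) (auto simp: sum_distrib_left mult.left_commute intro!: sum.cong)
  show "lie_rep hom n m P N (map_mat hom Z) = map_mat hom (lie_rep id n m P N Z)"
    unfolding C id_def using X
    by (intro eq_matI) (auto simp: hom_sum hom_mult intro!: sum.cong)
qed

end

section \<open>\<open>D\<close>-modules\<close>

text \<open>\<open>K\<close>, and its subring \<open>\<O>\<close>, as rings with explicit carrier.\<close>

definition Laurent_ring :: "'k::field fls ring" where
  "Laurent_ring = \<lparr>carrier = UNIV, mult = (*), one = 1, zero = 0, add = (+)\<rparr>"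

definition power_series_ring :: "'k::field fls ring" where
  "power_series_ring = Laurent_ring\<lparr>carrier := power_series\<rparr>"

text \<open>Elements of \<open>D = K \<partial>\<^sub>z\<close> are represented by their coefficient:
  \<open>f\<close> stands for the derivation \<open>f \<partial>\<^sub>z\<close>.\<close>

definition derivation :: "'k::field fls \<Rightarrow> 'k fls \<Rightarrow> 'k fls" where
  "derivation f x = f * fls_deriv x"

text \<open>\<open>D\<^sub>0 = k[[z]] z \<partial>\<^sub>z\<close>\<close>

definition D0 :: "'k::field fls set" where
  "D0 = {h * fls_X | h. h \<in> power_series}"

definition D_module ::
  "('k::field fls, 'v) module \<Rightarrow> ('k fls \<Rightarrow> 'v \<Rightarrow> 'v) \<Rightarrow> bool" where
  "D_module M act \<longleftrightarrow> module Laurent_ring M \<and>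
     (\<forall>d. \<forall>v \<in> carrier M. act d v \<in> carrier M) \<and>
     (\<forall>d e. \<forall>v \<in> carrier M. act (d + e) v = act d v \<oplus>\<^bsub>M\<^esub> act e v) \<and>
     (\<forall>x d. \<forall>v \<in> carrier M. act (x * d) v = x \<odot>\<^bsub>M\<^esub> act d v) \<and>
     (\<forall>d. \<forall>v \<in> carrier M. \<forall>w \<in> carrier M. act d (v \<oplus>\<^bsub>M\<^esub> w) = act d v \<oplus>\<^bsub>M\<^esub> act d w) \<and>
     (\<forall>d x. \<forall>v \<in> carrier M.
        act d (x \<odot>\<^bsub>M\<^esub> v) = (derivation d x \<odot>\<^bsub>M\<^esub> v) \<oplus>\<^bsub>M\<^esub> (x \<odot>\<^bsub>M\<^esub> act d v))"

text \<open>The module \<open>E(v)\<close>.\<close>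

definition E_hull ::
  "('k::field fls, 'v) module \<Rightarrow> ('k fls \<Rightarrow> 'v \<Rightarrow> 'v) \<Rightarrow> 'v \<Rightarrow> 'v set" where
  "E_hull M act v = \<Inter>{N. submodule N power_series_ring M \<and> v \<in> N \<and>
     (\<forall>d \<in> D0. \<forall>w \<in> N. act d w \<in> N)}"

definition finitely_generated_power_series ::
  "('k::field fls, 'v) module \<Rightarrow> 'v set \<Rightarrow> bool" where
  "finitely_generated_power_series M E \<longleftrightarrow>
     (\<exists>S \<subseteq> carrier M. finite S \<and> E = \<Inter>{N. submodule N power_series_ring M \<and> S \<subseteq> N})"

definition Fuchsian_D_module ::
  "('k::field fls, 'v) module \<Rightarrow> ('k fls \<Rightarrow> 'v \<Rightarrow> 'v) \<Rightarrow> bool" where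
  "Fuchsian_D_module M act \<longleftrightarrow> D_module M act \<and>
     (\<forall>v \<in> carrier M. finitely_generated_power_series M (E_hull M act v))"

section \<open>Connections\<close>

text \<open>The \<open>G\<close>-connection \<open>A dlog z\<close> is represented by its value
  \<open>A \<in> \<gg>(K)\<close> at \<open>z \<partial>\<^sub>z\<close>.\<close>

definition connections :: "nat \<Rightarrow> 'k::field mat set \<Rightarrow> 'k fls mat set" where
  "connections n G = lie_algebra_tensor n G UNIV"

text \<open>The value of \<open>A dlog z\<close> at the derivation \<open>f \<partial>\<^sub>z\<close>.\<close>

definition connection_at :: "'k::field fls mat \<Rightarrow> 'k fls \<Rightarrow> 'k fls mat" where
  "connection_at A f = (f * fls_X_inv) \<cdot>\<^sub>m A"

definition gauge :: "nat \<Rightarrow> 'k::field fls mat \<Rightarrow> 'k fls mat \<Rightarrow> 'k fls mat" where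
  "gauge n g A = g * A * (inv\<^bsub>GL n\<^esub> g) + map_mat (derivation fls_X) g * (inv\<^bsub>GL n\<^esub> g)"

definition gauge_equivalent :: "nat \<Rightarrow> 'k::field mat set \<Rightarrow> 'k fls mat \<Rightarrow> 'k fls mat \<Rightarrow> bool" where
  "gauge_equivalent n G A B \<longleftrightarrow> (\<exists>g \<in> points fls_const n G. B = gauge n g A)"

definition regular_connection :: "nat \<Rightarrow> 'k::field mat set \<Rightarrow> 'k fls mat \<Rightarrow> bool" where
  "regular_connection n G A \<longleftrightarrow> A \<in> connections n G \<and>
     (\<exists>B \<in> lie_algebra_tensor n G power_series. gauge_equivalent n G A B)"

text \<open>The action \<open>\<alpha>\<close> on \<open>K \<otimes>\<^sub>k k\<^sup>m = K\<^sup>m\<close> of the \<open>GL\<^sub>m\<close>-connection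
  \<open>B : D \<rightarrow> \<gg>\<ll>\<^sub>m(K)\<close>.\<close>

definition connection_action ::
  "('k::field fls \<Rightarrow> 'k fls mat) \<Rightarrow> 'k fls \<Rightarrow> 'k fls vec \<Rightarrow> 'k fls vec" where
  "connection_action B d v = map_vec (derivation d) v - B d *\<^sub>v v"

text \<open>Every finite-dimensional representation is isomorphic to one on \<open>k\<^sup>m\<close>, so the spaces
  \<open>V\<close> are taken to be \<open>k\<^sup>m\<close>, with \<open>m\<close> arbitrary.\<close>

definition Fuchsian_connection :: "nat \<Rightarrow> 'k::field mat set \<Rightarrow> 'k fls mat \<Rightarrow> bool" where
  "Fuchsian_connection n G A \<longleftrightarrow> A \<in> connections n G \<and>
     (\<forall>m P N. rational_representation n G m P N \<longrightarrow>
        Fuchsian_D_module (module_vec TYPE('k fls) m)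
          (connection_action (\<lambda>d. lie_rep fls_const n m P N (connection_at A d))))"

lemma cring_Laurent_ring: "cring (Laurent_ring :: 'k::field fls ring)"
proof (rule cringI)
  show "abelian_group (Laurent_ring :: 'k fls ring)"
    by (rule abelian_groupI)
      (auto simp: Laurent_ring_def algebra_simps intro: exI[of _ "- _"])
  show "comm_monoid (Laurent_ring :: 'k fls ring)"
    by (rule comm_monoidI) (auto simp: Laurent_ring_def)
qed (auto simp: Laurent_ring_def algebra_simps)

text \<open>The action attached to a \<open>K\<close>-linear \<open>B\<close> is a \<open>D\<close>-module structure.\<close>

lemma D_module_connection_action:
  fixes B :: "'k::field fls \<Rightarrow> 'k fls mat"
  assumes B: "\<And>d. B d \<in> carrier_mat m m"
    and B_add: "\<And>d e. B (d + e) = B d + B e"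
    and B_smult: "\<And>x d. B (x * d) = x \<cdot>\<^sub>m B d"
  shows "D_module (module_vec TYPE('k fls) m) (connection_action B)"
proof -
  have "abelian_group (module_vec TYPE('k fls) m)"
  proof (rule abelian_groupI, goal_cases)
    case (6 x)
    then show ?case
      by (intro bexI[of _ "- x"]) (auto simp: module_vec_simps)
  qed (auto simp: module_vec_simps intro: comm_add_vec)
  then have "module Laurent_ring (module_vec TYPE('k fls) m)"
    by (intro moduleI cring_Laurent_ring)
      (auto simp: module_vec_simps Laurent_ring_def add_smult_distrib_vec smult_add_distrib_vec
        smult_smult_assoc)
  moreover have Bd: "dim_row (B d) = m" "dim_col (B d) = m" for d
    using B[of d] by auto
  ultimately show ?thesis
    unfolding D_module_def
    by (auto simp: module_vec_simps connection_action_def derivation_def Bd B_add B_smult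
        scalar_prod_def algebra_simps sum.distrib sum_distrib_left sum_negf
        intro!: eq_vecI carrier_vecI)
qed

lemma connection_action_lie_rep_D_module:
  assumes A: "A \<in> connections n G" and r: "rational_representation n G m P N"
  shows "D_module (module_vec TYPE('k::field fls) m)
    (connection_action (\<lambda>d. lie_rep fls_const n m P N (connection_at A d)))"
proof -
  interpret c: comm_ring_hom "fls_const :: 'k \<Rightarrow> 'k fls"
    by standard (auto simp: fls_plus_const fls_const_mult_const)
  have A': "A \<in> carrier_mat n n"
    using A by (auto simp: connections_def lie_algebra_tensor_def)
  have P: "\<forall>i<m. \<forall>j<m. P i j \<in> entry_polys n"
    using r by (simp add: rational_representation_def)
  note l = c.lie_rep_extension(1,2)[OF P, where Z = "0\<^sub>m n n" and N = N]
  show ?thesis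
  proof (rule D_module_connection_action)
    fix d e x :: "'k fls"
    let ?B = "\<lambda>d. lie_rep fls_const n m P N (connection_at A d)"
    show "?B d \<in> carrier_mat m m" by (simp add: lie_rep_def rep_eval_def)
    have "connection_at A (d + e) = connection_at A d + connection_at A e"
      using A' by (auto simp: connection_at_def algebra_simps intro!: eq_matI)
    then show "?B (d + e) = ?B d + ?B e"
      using A' by (simp add: l connection_at_def)
    have "connection_at A (x * d) = x \<cdot>\<^sub>m connection_at A d"
      using A' by (auto simp: connection_at_def algebra_simps intro!: eq_matI)
    then show "?B (x * d) = x \<cdot>\<^sub>m ?B d"
      using A' l(2)[of "connection_at A d" "0\<^sub>m n n"] by (simp add: connection_at_def)
  qed
qed

end

theory Submission
  imports Defs "Jordan_Normal_Form.Char_Poly"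
begin

text \<open>
  Put \<open>\<theta> = z d/dz\<close>. Through a representation \<open>\<rho>\<close> on \<open>k\<^sup>m\<close> a connection \<open>A\<close> acts on \<open>K\<^sup>m\<close> by
  \<open>\<nabla> v = \<theta> v - \<rho>(A) v\<close>. An \<open>\<O>\<close>-submodule of \<open>K\<^sup>m\<close> is finitely generated iff the pole orders of its
  vectors are bounded (\<open>bounded_imp_finitely_generated\<close>, \<open>finitely_generated_imp_bounded\<close>), so being
  Fuchsian means that every vector lies in a \<open>\<nabla>\<close>-stable \<open>\<O>\<close>-submodule with bounded poles.

  Regular connections are Fuchsian. Let \<open>B = g[A]\<close> have entries in \<open>\<O>\<close>. Then
  \<open>(1 + \<epsilon>B) g = (g + \<epsilon> \<theta>g) (1 + \<epsilon>A)\<close> in \<open>G(K[\<epsilon>])\<close>, and applying \<open>\<rho>\<close> gives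
  \<open>\<rho>(B) R = R \<rho>(A) + \<theta>R\<close> for \<open>R = \<rho>(g)\<close> (\<open>lie_rep_gauge\<close>). So \<open>R\<close> carries \<open>\<nabla>\<close> to
  \<open>\<theta> - \<rho>(B)\<close>, which preserves every \<open>z\<^sup>j \<O>\<^sup>m\<close>, and the modules \<open>R\<^sup>-\<^sup>1 z\<^sup>j \<O>\<^sup>m\<close> are
  \<open>\<nabla>\<close>-stable, have bounded poles and exhaust \<open>K\<^sup>m\<close>. This needs \<open>\<rho>\<close> to be multiplicative on points over
  \<open>K[\<epsilon>]\<close>, whereas it is only given to be so on points over \<open>k\<close>; the bridge is
  \<open>regular_function_vanishing\<close>: a regular function with coefficients in a \<open>k\<close>-algebra \<open>R\<close> that vanishes on
  \<open>G(k)\<close> vanishes on \<open>G(R)\<close>.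

  Fuchsian connections are regular for \<open>GL\<^sub>n\<close>. In the standard representation the sum of the modules
  \<open>E(e\<^sub>i)\<close> is a \<open>\<nabla>\<close>-stable lattice. If the columns of \<open>Q\<close> are a basis of it, then
  \<open>\<theta>Q = A Q + Q C\<close> with \<open>C\<close> over \<open>\<O>\<close>, and \<open>Q\<^sup>-\<^sup>1\<close> transforms \<open>A\<close> into \<open>-C\<close>.

  For \<open>SL\<^sub>n\<close> the lattice has to be changed until its basis can be chosen with \<open>det Q = 1\<close>. Multiplying
  the lattice by \<open>z\<close> raises the order of \<open>det Q\<close> by \<open>n\<close>. An eigenvector of the residue \<open>C(0)\<close>,
  which exists because \<open>k\<close> is algebraically closed, spans a \<open>\<nabla>\<close>-stable line of the lattice modulo
  \<open>z\<close>, and adjoining \<open>1/z\<close> times a lift of it gives a stable lattice for which the order is smaller by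
  \<open>1\<close>. Once the order is \<open>0\<close>, one basis vector is divided by the unit \<open>det Q\<close>. Finally
  \<open>\<theta>(det Q) = (tr A + tr C) det Q\<close> and \<open>tr A = 0\<close> give \<open>tr C = 0\<close>.
\<close>

no_notation fps_nth (infixl \<open>$\<close> 75)

section \<open>Polynomial functions of the matrix entries\<close>

definition monomial_eval :: "(nat \<times> nat \<Rightarrow>\<^sub>0 nat) \<Rightarrow> 'r::comm_ring_1 mat \<Rightarrow> 'r" where
  "monomial_eval m g = (\<Prod>ij \<in> Poly_Mapping.keys m. g $$ ij ^ Poly_Mapping.lookup m ij)"

lemma monomial_eval_superset:
  assumes "finite A" "Poly_Mapping.keys m \<subseteq> A"
  shows "monomial_eval m g = (\<Prod>ij \<in> A. g $$ ij ^ Poly_Mapping.lookup m ij)"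
  unfolding monomial_eval_def
  by (rule prod.mono_neutral_left) (use assms in \<open>auto simp: in_keys_iff\<close>)

lemma monomial_eval_add: "monomial_eval (m + m') g = monomial_eval m g * monomial_eval m' g"
proof -
  let ?A = "Poly_Mapping.keys m \<union> Poly_Mapping.keys m'"
  have "Poly_Mapping.keys (m + m') \<subseteq> ?A" by (rule keys_add)
  then show ?thesis
    by (simp add: monomial_eval_superset[of ?A] lookup_add power_add prod.distrib)
qed

lemma entry_eval_alt:
  "entry_eval \<phi> p g =
    (\<Sum>m \<in> Poly_Mapping.keys p. \<phi> (Poly_Mapping.lookup p m) * monomial_eval m g)"
  unfolding entry_eval_def monomial_eval_def ..

lemma entry_eval_superset:
  assumes "finite A" "Poly_Mapping.keys p \<subseteq> A" "\<phi> 0 = 0"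
  shows "entry_eval \<phi> p g = (\<Sum>m \<in> A. \<phi> (Poly_Mapping.lookup p m) * monomial_eval m g)"
  unfolding entry_eval_alt
  by (rule sum.mono_neutral_left) (use assms in \<open>auto simp: in_keys_iff\<close>)

text \<open>Multiplicativity of evaluation is needed only for polynomials over the ring in which the matrix
  entries lie.\<close>

definition entry_value :: "'r::comm_ring_1 entry_poly \<Rightarrow> 'r mat \<Rightarrow> 'r" where
  "entry_value = entry_eval id"

lemma entry_value_superset:
  assumes "finite A" "Poly_Mapping.keys p \<subseteq> A"
  shows "entry_value p g = (\<Sum>m \<in> A. Poly_Mapping.lookup p m * monomial_eval m g)"
  unfolding entry_value_def by (simp add: entry_eval_superset[OF assms])

lemmas entry_value_alt = entry_value_superset[OF finite_keys order_refl]

lemma entry_value_zero [simp]: "entry_value 0 g = 0"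
  by (simp add: entry_value_alt)

lemma entry_value_single:
  "entry_value (Poly_Mapping.single m c) g = c * monomial_eval m g"
  by (simp add: entry_value_alt)

lemma entry_value_add: "entry_value (p + q) g = entry_value p g + entry_value q g"
proof -
  let ?A = "Poly_Mapping.keys p \<union> Poly_Mapping.keys q"
  have "Poly_Mapping.keys (p + q) \<subseteq> ?A" by (rule keys_add)
  then show ?thesis
    by (simp add: entry_value_superset[of ?A] lookup_add distrib_right sum.distrib)
qed

lemma entry_value_sum: "entry_value (\<Sum>x\<in>A. p x) g = (\<Sum>x\<in>A. entry_value (p x) g)"
  by (induction A rule: infinite_finite_induct) (simp_all add: entry_value_add)

lemma sum_single_lookup:
  "p = (\<Sum>m \<in> Poly_Mapping.keys p. Poly_Mapping.single m (Poly_Mapping.lookup p m))"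
  by (rule poly_mapping_eqI)
    (auto simp: lookup_sum lookup_single when_def in_keys_iff)

lemma entry_value_mult: "entry_value (p * q) g = entry_value p g * entry_value q g"
proof -
  have "p * q = (\<Sum>m \<in> Poly_Mapping.keys p. \<Sum>m' \<in> Poly_Mapping.keys q.
      Poly_Mapping.single (m + m') (Poly_Mapping.lookup p m * Poly_Mapping.lookup q m'))"
    by (subst sum_single_lookup[of p], subst sum_single_lookup[of q])
      (simp add: sum_product mult_single)
  then have "entry_value (p * q) g = (\<Sum>m \<in> Poly_Mapping.keys p. \<Sum>m' \<in> Poly_Mapping.keys q.
      (Poly_Mapping.lookup p m * Poly_Mapping.lookup q m') * monomial_eval (m + m') g)"
    by (simp only: entry_value_sum entry_value_single)
  then show ?thesis
    by (simp add: entry_value_alt sum_product monomial_eval_add mult_ac)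
qed

lemma entry_polys_single:
  "Poly_Mapping.keys m \<subseteq> {..<n} \<times> {..<n} \<Longrightarrow> Poly_Mapping.single m c \<in> entry_polys n"
  by (auto simp: entry_polys_def)

lemma entry_value_one [simp]: "entry_value 1 g = 1"
  using entry_value_single[of 0 1 g] by (simp add: monomial_eval_def)

lemma one_in_entry_polys [simp]: "1 \<in> entry_polys n"
  by (simp add: entry_polys_def)

lemma zero_in_entry_polys [simp]: "0 \<in> entry_polys n"
  by (simp add: entry_polys_def)

lemma entry_polys_add: "p \<in> entry_polys n \<Longrightarrow> q \<in> entry_polys n \<Longrightarrow> p + q \<in> entry_polys n"
  using keys_add[of p q] unfolding entry_polys_def by blast

lemma entry_polys_sum: "(\<And>x. x \<in> A \<Longrightarrow> p x \<in> entry_polys n) \<Longrightarrow> (\<Sum>x\<in>A. p x) \<in> entry_polys n"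
  by (induction A rule: infinite_finite_induct)
    (simp_all add: entry_polys_add)

lemma entry_polys_mult:
  assumes "p \<in> entry_polys n" "q \<in> entry_polys n"
  shows "p * q \<in> entry_polys n"
  unfolding entry_polys_def
proof clarify
  fix m i j assume "m \<in> Poly_Mapping.keys (p * q)" and ij: "(i, j) \<in> Poly_Mapping.keys m"
  then obtain a b where "m = a + b" "a \<in> Poly_Mapping.keys p" "b \<in> Poly_Mapping.keys q"
    using keys_mult[of p q] by blast
  with assms ij keys_add[of a b] show "i \<in> {..<n} \<and> j \<in> {..<n}"
    unfolding entry_polys_def by blast
qed

lemma (in comm_ring_hom) entry_eval_hom:
  assumes "p \<in> entry_polys n" "g \<in> carrier_mat n n"
  shows "entry_eval (\<lambda>c. hom (\<phi> c)) p (map_mat hom g) = hom (entry_eval \<phi> p g)"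
proof -
  have "map_mat hom g $$ ij = hom (g $$ ij)"
    if "m \<in> Poly_Mapping.keys p" "ij \<in> Poly_Mapping.keys m" for m ij
  proof -
    have "ij \<in> {..<n} \<times> {..<n}" using that assms(1) unfolding entry_polys_def by blast
    then show ?thesis using assms(2) by auto
  qed
  then have "(\<Prod>ij \<in> Poly_Mapping.keys m. map_mat hom g $$ ij ^ Poly_Mapping.lookup m ij) =
      hom (\<Prod>ij \<in> Poly_Mapping.keys m. g $$ ij ^ Poly_Mapping.lookup m ij)"
    if "m \<in> Poly_Mapping.keys p" for m
    using that by (simp add: hom_prod hom_power)
  then show ?thesis by (simp add: entry_eval_def hom_sum hom_mult)
qed

section \<open>Invertible matrices\<close>

lemma unit_inverse_unique:
  assumes "x * y = (1::'r::comm_ring_1)"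
  shows "unit_inverse x = y"
  unfolding unit_inverse_def
proof (rule the_equality)
  show "x * y = 1" by fact
  show "z = y" if "x * z = 1" for z
  proof -
    have "z = (x * y) * z" using assms by simp
    also have "\<dots> = (x * z) * y" by (simp add: mult_ac)
    finally show ?thesis using that by simp
  qed
qed

lemma unit_inverse_one [simp]: "unit_inverse (1::'r::comm_ring_1) = 1"
  by (rule unit_inverse_unique) simp

lemma GL_carrier_iff:
  "g \<in> carrier (GL n) \<longleftrightarrow> g \<in> carrier_mat n n \<and> (\<exists>h \<in> carrier_mat n n. h * g = 1\<^sub>m n \<and> g * h = 1\<^sub>m n)"
  by (auto simp: GL_def units_of_carrier Units_def ring_mat_simps)

lemma GL_simps [simp]:
  "mult (GL n) = (*)" "one (GL n) = 1\<^sub>m n"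
  by (simp_all add: GL_def units_of_mult units_of_one ring_mat_simps)

lemma group_GL: "Group.group (GL n :: 'r::comm_ring_1 mat monoid)"
proof -
  interpret r: Ring.ring "ring_mat TYPE('r) n ()" by (rule ring_mat)
  show ?thesis unfolding GL_def by (rule r.units_group)
qed

lemma GL_carrier_mat: "g \<in> carrier (GL n) \<Longrightarrow> g \<in> carrier_mat n n"
  by (simp add: GL_carrier_iff)

lemma GL_det_unit:
  assumes "g \<in> carrier (GL n)"
  shows "det g * unit_inverse (det g) = 1"
proof -
  obtain h where h: "h \<in> carrier_mat n n" "g * h = 1\<^sub>m n" "g \<in> carrier_mat n n"
    using assms by (auto simp: GL_carrier_iff)
  then have "det g * det h = 1" using det_mult[of g n h] by simp
  then show ?thesis using unit_inverse_unique by metis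
qed

text \<open>Cramer's rule.\<close>

lemma GL_inv_adj_mat:
  assumes g: "g \<in> carrier (GL n)"
  shows "inv\<^bsub>GL n\<^esub> g = unit_inverse (det g) \<cdot>\<^sub>m adj_mat g"
proof -
  interpret G: Group.group "GL n :: 'a mat monoid" by (rule group_GL)
  let ?h = "unit_inverse (det g) \<cdot>\<^sub>m adj_mat g"
  have gm: "g \<in> carrier_mat n n" using g by (rule GL_carrier_mat)
  note a = adj_mat[OF gm]
  have 1: "g * ?h = 1\<^sub>m n" "?h * g = 1\<^sub>m n"
    using gm a GL_det_unit[OF g]
    by (simp_all add: mult_smult_distrib[of _ n n] mult_smult_assoc_mat[of _ n n] mult.commute)
      (auto simp: mult.commute intro!: eq_matI)
  have h: "?h \<in> carrier (GL n)" using 1 a gm by (auto simp: GL_carrier_iff)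
  show ?thesis using G.inv_equality[of ?h g] 1 g h by simp
qed

lemma GL_I_det:
  assumes "g \<in> carrier_mat n n" "det g * u = 1"
  shows "g \<in> carrier (GL n)"
proof -
  note a = adj_mat[OF assms(1)]
  have "g * (u \<cdot>\<^sub>m adj_mat g) = 1\<^sub>m n" "(u \<cdot>\<^sub>m adj_mat g) * g = 1\<^sub>m n"
    using assms a
    by (simp_all add: mult_smult_distrib[of _ n n] mult_smult_assoc_mat[of _ n n])
      (auto simp: mult.commute intro!: eq_matI)
  then show ?thesis using a assms by (auto simp: GL_carrier_iff)
qed

lemma GL_I_right:
  assumes "g \<in> carrier_mat n n" "h \<in> carrier_mat n n" "g * h = 1\<^sub>m n"
  shows "g \<in> carrier (GL n)"
  using GL_I_det[of g n "det h"] det_mult[of g n h] assms by simp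

lemma GL_inv_closed: "g \<in> carrier (GL n) \<Longrightarrow> inv\<^bsub>GL n\<^esub> g \<in> carrier (GL n)"
  by (rule group.inv_closed[OF group_GL])

lemma GL_inv_mat:
  assumes "g \<in> carrier (GL n)"
  shows "inv\<^bsub>GL n\<^esub> g \<in> carrier_mat n n" "inv\<^bsub>GL n\<^esub> g * g = 1\<^sub>m n" "g * inv\<^bsub>GL n\<^esub> g = 1\<^sub>m n"
  using GL_carrier_mat[OF GL_inv_closed[OF assms]]
    group.l_inv[OF group_GL assms] group.r_inv[OF group_GL assms] by simp_all

lemma GL_mult_closed:
  assumes "g \<in> carrier (GL n)" "h \<in> carrier (GL n)"
  shows "g * h \<in> carrier (GL n)"
  using monoid.m_closed[OF group.is_monoid[OF group_GL] assms] by simp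

lemma (in comm_ring_hom) GL_map:
  assumes "g \<in> carrier (GL n)"
  shows "map_mat hom g \<in> carrier (GL n)"
  by (rule GL_I_det[where u = "hom (unit_inverse (det g))"])
    (use GL_carrier_mat[OF assms] GL_det_unit[OF assms] in \<open>simp_all add: hom_mult[symmetric]\<close>)

lemma (in comm_ring_hom) unit_inverse_det_hom:
  assumes "g \<in> carrier (GL n)"
  shows "unit_inverse (det (map_mat hom g)) = hom (unit_inverse (det g))"
  by (rule unit_inverse_unique) (use GL_det_unit[OF assms] in \<open>simp add: hom_mult[symmetric]\<close>)

section \<open>Regular functions\<close>

text \<open>Elements of \<open>R[x\<^sub>i\<^sub>j, 1/det]\<close>, as functions on \<open>GL\<^sub>n(R)\<close>. The coefficients are in \<open>R\<close>
  and not only in \<open>k\<close>, so that translates by an element of \<open>GL\<^sub>n(R)\<close> and matrix entries of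
  \<open>\<rho>(g x)\<close> with \<open>g\<close> fixed are again regular.\<close>

definition regular_function :: "nat \<Rightarrow> ('r::comm_ring_1 mat \<Rightarrow> 'r) \<Rightarrow> bool" where
  "regular_function n F \<longleftrightarrow> (\<exists>p \<in> entry_polys n. \<exists>N. \<forall>g \<in> carrier (GL n).
     F g = entry_value p g * unit_inverse (det g) ^ N)"

lemma regular_function_cong:
  assumes "\<And>g. g \<in> carrier (GL n) \<Longrightarrow> F g = H g"
  shows "regular_function n F \<longleftrightarrow> regular_function n H"
  using assms by (simp add: regular_function_def)

lemma regular_function_const: "regular_function n (\<lambda>_. c)"
  unfolding regular_function_def
  by (rule bexI[of _ "Poly_Mapping.single 0 c"], rule exI[of _ 0])
    (simp_all add: entry_value_single monomial_eval_def entry_polys_single)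

lemma regular_function_entry:
  assumes "i < n" "j < n"
  shows "regular_function n (\<lambda>g. g $$ (i, j))"
  unfolding regular_function_def
  by (rule bexI[of _ "Poly_Mapping.single (Poly_Mapping.single (i, j) 1) 1"], rule exI[of _ 0])
    (use assms in \<open>simp_all add: entry_value_single monomial_eval_def entry_polys_single\<close>)

lemma regular_function_mult:
  assumes "regular_function n F" "regular_function n H"
  shows "regular_function n (\<lambda>g. F g * H g)"
proof -
  from assms(1) obtain p N where p: "p \<in> entry_polys n"
    "\<And>g. g \<in> carrier (GL n) \<Longrightarrow> F g = entry_value p g * unit_inverse (det g) ^ N"
    unfolding regular_function_def by blast
  from assms(2) obtain q M where q: "q \<in> entry_polys n"
    "\<And>g. g \<in> carrier (GL n) \<Longrightarrow> H g = entry_value q g * unit_inverse (det g) ^ M"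
    unfolding regular_function_def by blast
  show ?thesis unfolding regular_function_def
    by (rule bexI[of _ "p * q"], rule exI[of _ "N + M"])
      (auto simp: p q entry_value_mult power_add mult_ac intro: entry_polys_mult)
qed

text \<open>Bringing two fractions to the common denominator \<open>det\<^sup>N\<^sup>+\<^sup>M\<close> requires \<open>det\<close> as a
  polynomial in the entries.\<close>

lemma det_entry_poly:
  "\<exists>p \<in> entry_polys n. \<forall>g \<in> carrier_mat n n. entry_value p g = (det g :: 'r::comm_ring_1)"
proof -
  define M :: "nat \<times> nat \<Rightarrow> 'r entry_poly"
    where "M = (\<lambda>ij. Poly_Mapping.single (Poly_Mapping.single ij 1) 1)"
  define p :: "(nat \<Rightarrow> nat) \<Rightarrow> 'r entry_poly"
    where "p = (\<lambda>s. Poly_Mapping.single 0 (signof s) * (\<Prod>i = 0..<n. M (i, s i)))"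
  have ev: "entry_value (\<Prod>i\<in>A. M (i, s i)) g = (\<Prod>i\<in>A. g $$ (i, s i))" for A s g
    by (induction A rule: infinite_finite_induct)
      (simp_all add: entry_value_mult entry_value_single monomial_eval_def M_def)
  have cl: "(\<Prod>i\<in>A. M (i, s i)) \<in> entry_polys n"
    if "\<And>i. i \<in> A \<Longrightarrow> i < n \<and> s i < n" for A s
    using that
    by (induction A rule: infinite_finite_induct)
      (auto intro!: entry_polys_mult entry_polys_single simp: M_def)
  have p: "p s \<in> entry_polys n" if "s permutes {0..<n}" for s
    unfolding p_def using that
    by (intro entry_polys_mult entry_polys_single cl) (auto dest: permutes_in_image)
  have fin: "finite {s. s permutes {0..<n}}" by (rule finite_permutations) simp
  have "(\<Sum>s | s permutes {0..<n}. p s) \<in> entry_polys n"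
    by (rule entry_polys_sum) (simp add: p)
  moreover have "entry_value (\<Sum>s | s permutes {0..<n}. p s) g = det g"
    if "g \<in> carrier_mat n n" for g
    unfolding entry_value_sum det_def'[OF that] p_def entry_value_mult ev
    by (simp add: entry_value_single monomial_eval_def del: single_of_int)
  ultimately show ?thesis by blast
qed

lemma regular_function_add:
  assumes "regular_function n F" "regular_function n H"
  shows "regular_function n (\<lambda>g. F g + H g)"
proof -
  from assms(1) obtain p N where p: "p \<in> entry_polys n"
    "\<And>g. g \<in> carrier (GL n) \<Longrightarrow> F g = entry_value p g * unit_inverse (det g) ^ N"
    unfolding regular_function_def by blast
  from assms(2) obtain q M where q: "q \<in> entry_polys n"
    "\<And>g. g \<in> carrier (GL n) \<Longrightarrow> H g = entry_value q g * unit_inverse (det g) ^ M"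
    unfolding regular_function_def by blast
  obtain d :: "'a entry_poly" where d: "d \<in> entry_polys n"
    "\<And>g. g \<in> carrier_mat n n \<Longrightarrow> entry_value d g = det g"
    using det_entry_poly by blast
  have dp: "d ^ r \<in> entry_polys n"
    "g \<in> carrier_mat n n \<Longrightarrow> entry_value (d ^ r) g = det g ^ r" for r g
    by (induction r) (auto simp: d entry_value_mult intro: entry_polys_mult)
  have cancel: "det g ^ r * unit_inverse (det g) ^ (r + s) = unit_inverse (det g) ^ s"
    if "g \<in> carrier (GL n)" for g :: "'a mat" and r s
    using GL_det_unit[OF that]
    by (simp add: power_add mult.assoc[symmetric] power_mult_distrib[symmetric])
  show ?thesis unfolding regular_function_def
  proof (rule bexI[of _ "p * d ^ M + q * d ^ N"], rule exI[of _ "N + M"], rule ballI)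
    show "p * d ^ M + q * d ^ N \<in> entry_polys n"
      by (intro entry_polys_add entry_polys_mult p q dp)
    fix g :: "'a mat" assume g: "g \<in> carrier (GL n)"
    have "(entry_value p g * det g ^ M + entry_value q g * det g ^ N) * unit_inverse (det g) ^ (N + M)
      = entry_value p g * (det g ^ M * unit_inverse (det g) ^ (M + N)) +
        entry_value q g * (det g ^ N * unit_inverse (det g) ^ (N + M))"
      by (simp add: algebra_simps)
    then show "F g + H g = entry_value (p * d ^ M + q * d ^ N) g * unit_inverse (det g) ^ (N + M)"
      by (simp add: g p q dp GL_carrier_mat entry_value_add entry_value_mult cancel)
  qed
qed

lemma regular_function_sum:
  "(\<And>x. x \<in> A \<Longrightarrow> regular_function n (F x)) \<Longrightarrow> regular_function n (\<lambda>g. \<Sum>x\<in>A. F x g)"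
  by (induction A rule: infinite_finite_induct)
    (auto intro: regular_function_add regular_function_const)

lemma regular_function_prod:
  "(\<And>x. x \<in> A \<Longrightarrow> regular_function n (F x)) \<Longrightarrow> regular_function n (\<lambda>g. \<Prod>x\<in>A. F x g)"
  by (induction A rule: infinite_finite_induct)
    (auto intro: regular_function_mult regular_function_const)

lemma regular_function_power:
  "regular_function n F \<Longrightarrow> regular_function n (\<lambda>g. F g ^ r)"
  by (induction r) (auto intro: regular_function_mult regular_function_const)

lemma regular_function_diff:
  assumes "regular_function n F" "regular_function n H"
  shows "regular_function n (\<lambda>g. F g - H g)"
  using regular_function_add[OF assms(1) regular_function_mult[OF regular_function_const[of n "-1"] assms(2)]]
  by simp

lemma regular_function_unit_inverse_det: "regular_function n (\<lambda>g. unit_inverse (det g))"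
  unfolding regular_function_def
  by (rule bexI[of _ "Poly_Mapping.single 0 1"], rule exI[of _ 1])
    (simp_all add: entry_value_single monomial_eval_def entry_polys_single del: single_one)

lemma regular_function_det:
  assumes "\<And>g. g \<in> carrier (GL n) \<Longrightarrow> f g \<in> carrier_mat m m"
    and "\<And>i j. i < m \<Longrightarrow> j < m \<Longrightarrow> regular_function n (\<lambda>g. f g $$ (i, j))"
  shows "regular_function n (\<lambda>g. det (f g))"
proof -
  have "regular_function n (\<lambda>g. \<Sum>p | p permutes {0..<m}. signof p * (\<Prod>i = 0..<m. f g $$ (i, p i)))"
    by (intro regular_function_sum regular_function_mult regular_function_const
        regular_function_prod assms) (auto dest: permutes_in_image)
  then show ?thesis
    by (subst regular_function_cong[of n]) (auto simp: det_def'[OF assms(1)])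
qed

lemma regular_function_inv:
  assumes "i < n" "j < n"
  shows "regular_function n (\<lambda>g. (inv\<^bsub>GL n\<^esub> g) $$ (i, j))"
proof -
  have "regular_function n (\<lambda>g. unit_inverse (det g) * ((-1) ^ (j + i) * det (mat_delete g j i)))"
  proof (intro regular_function_mult regular_function_unit_inverse_det regular_function_const
      regular_function_det)
    fix a b assume "a < n - 1" "b < n - 1"
    then have "regular_function n (\<lambda>g. g $$ (if a < j then a else Suc a, if b < i then b else Suc b))"
      by (intro regular_function_entry) auto
    then show "regular_function n (\<lambda>g. mat_delete g j i $$ (a, b))"
      by (subst regular_function_cong[of n])
        (use \<open>a < n - 1\<close> \<open>b < n - 1\<close> in \<open>auto simp: mat_delete_def dest!: GL_carrier_mat\<close>)
  qed (auto simp: mat_delete_def dest!: GL_carrier_mat)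
  then show ?thesis
    by (subst regular_function_cong[of n])
      (use assms in \<open>auto simp: GL_inv_adj_mat adj_mat_def cofactor_def dest!: GL_carrier_mat\<close>)
qed

lemma regular_function_entry_eval:
  assumes "p \<in> entry_polys m"
    and "\<And>i j. i < m \<Longrightarrow> j < m \<Longrightarrow> regular_function n (\<lambda>g. f g $$ (i, j))"
  shows "regular_function n (\<lambda>g. entry_eval \<phi> p (f g))"
  unfolding entry_eval_def
  by (intro regular_function_sum regular_function_mult regular_function_const
      regular_function_prod regular_function_power)
    (use assms in \<open>auto simp: entry_polys_def\<close>)

text \<open>A \<open>k\<close>-algebra has a basis \<open>B\<close> over \<open>k\<close>; \<open>r x b\<close> is the coefficient of \<open>x\<close> at
  \<open>b \<in> B\<close>, and \<open>0\<close> for \<open>b \<notin> B\<close>.\<close>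

lemma coefficients_over_field:
  fixes \<phi> :: "'k::field \<Rightarrow> 'r::comm_ring_1"
  assumes \<phi>: "comm_ring_hom \<phi>"
  obtains r :: "'r \<Rightarrow> 'r \<Rightarrow> 'k" where
    "\<And>b. r 0 b = 0" "\<And>x y b. r (x + y) b = r x b + r y b" "\<And>c x b. r (\<phi> c * x) b = c * r x b"
    "\<And>x. finite {b. r x b \<noteq> 0}" "\<And>x. (\<Sum>b | r x b \<noteq> 0. \<phi> (r x b) * b) = x"
proof -
  interpret \<phi>: comm_ring_hom \<phi> by fact
  interpret V: vector_space "\<lambda>c x. \<phi> c * x"
    by standard (simp_all add: algebra_simps \<phi>.hom_add \<phi>.hom_mult)
  define B where "B = V.extend_basis {}"
  have ind: "V.independent B"
    unfolding B_def by (intro V.independent_extend_basis V.independent_empty)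
  have sp: "x \<in> V.span B" for x
    unfolding B_def by (simp add: V.span_extend_basis V.independent_empty)
  show ?thesis
  proof (rule that[of "V.representation B"])
    show "V.representation B 0 b = 0" for b by (simp add: V.representation_zero)
    show "V.representation B (x + y) b = V.representation B x b + V.representation B y b" for x y b
      by (simp only: V.representation_add[OF ind sp sp])
    show "V.representation B (\<phi> c * x) b = c * V.representation B x b" for c x b
      by (simp only: V.representation_scale[OF ind sp])
    show "finite {b. V.representation B x b \<noteq> 0}" for x
      by (rule V.finite_representation)
    show "(\<Sum>b | V.representation B x b \<noteq> 0. \<phi> (V.representation B x b) * b) = x" for x
      by (rule V.sum_nonzero_representation_eq[OF ind sp])
  qed
qed

text \<open>Let \<open>p = \<Sum>\<^sub>m c\<^sub>m x\<^sup>m\<close> be the numerator of \<open>F\<close>. Expanding its coefficients in a basis of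
  \<open>R\<close> over \<open>k\<close> gives \<open>p = \<Sum>\<^sub>b b q\<^sub>b\<close> with \<open>q\<^sub>b\<close> over \<open>k\<close>. For \<open>y \<in> G\<close> the values
  \<open>q\<^sub>b(y)\<close> are the coefficients of \<open>p(y) = 0\<close>, so every \<open>q\<^sub>b\<close> is in the vanishing ideal of \<open>G\<close>
  and vanishes on \<open>G(R)\<close> by definition.\<close>

lemma regular_function_vanishing:
  fixes \<phi> :: "'k::field \<Rightarrow> 'r::comm_ring_1"
  assumes \<phi>: "comm_ring_hom \<phi>" and F: "regular_function n F" and G: "G \<subseteq> carrier (GL n)"
    and van: "\<And>y. y \<in> G \<Longrightarrow> F (map_mat \<phi> y) = 0"
    and h: "h \<in> points \<phi> n G"
  shows "F h = 0"
proof -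
  interpret \<phi>: comm_ring_hom \<phi> by fact
  obtain r :: "'r \<Rightarrow> 'r \<Rightarrow> 'k" where r0: "\<And>b. r 0 b = 0"
    and r_add: "\<And>x y b. r (x + y) b = r x b + r y b"
    and r_scale: "\<And>c x b. r (\<phi> c * x) b = c * r x b"
    and r_fin: "\<And>x. finite {b. r x b \<noteq> 0}"
    and r_expand: "\<And>x. (\<Sum>b | r x b \<noteq> 0. \<phi> (r x b) * b) = x"
    by (rule coefficients_over_field[OF \<phi>], rule that)
  have r_sum: "r (sum f A) b = (\<Sum>a\<in>A. r (f a) b)" for f :: "_ \<Rightarrow> 'r" and A b
    by (induction A rule: infinite_finite_induct) (simp_all add: r0 r_add)
  from F obtain p N where p: "p \<in> entry_polys n"
    and F: "\<And>g. g \<in> carrier (GL n) \<Longrightarrow> F g = entry_value p g * unit_inverse (det g) ^ N"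
    unfolding regular_function_def by blast
  have h': "h \<in> carrier (GL n)" using h by (simp add: points_def)
  have p0: "entry_value p (map_mat \<phi> y) = 0" if "y \<in> G" for y
  proof -
    have y: "map_mat \<phi> y \<in> carrier (GL n)" using that G \<phi>.GL_map by blast
    have "entry_value p (map_mat \<phi> y) * unit_inverse (det (map_mat \<phi> y)) ^ N = 0"
      using F[OF y] van[OF that] by simp
    then have "det (map_mat \<phi> y) ^ N *
        (entry_value p (map_mat \<phi> y) * unit_inverse (det (map_mat \<phi> y)) ^ N) = 0"
      by (simp only: mult_zero_right)
    then have "entry_value p (map_mat \<phi> y) *
      (det (map_mat \<phi> y) * unit_inverse (det (map_mat \<phi> y))) ^ N = 0"
      by (simp only: power_mult_distrib mult_ac)
    then show ?thesis by (simp only: GL_det_unit[OF y] power_one mult_1_right)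
  qed
  define q where "q b = Poly_Mapping.map (\<lambda>c. r c b) p" for b
  have lq: "Poly_Mapping.lookup (q b) m = r (Poly_Mapping.lookup p m) b" for b m
    by (simp add: q_def Poly_Mapping.map.rep_eq when_def r0)
  have kq: "Poly_Mapping.keys (q b) \<subseteq> Poly_Mapping.keys p" for b
    by (auto simp: in_keys_iff lq r0)
  have q: "q b \<in> vanishing_ideal n G" for b
    unfolding vanishing_ideal_def
    proof (intro CollectI conjI ballI, fold entry_value_def)
    show "q b \<in> entry_polys n" using p kq[of b] by (auto simp: entry_polys_def)
    fix y assume y: "y \<in> G"
    have mon: "monomial_eval m (map_mat \<phi> y) = \<phi> (monomial_eval m y)"
      if "m \<in> Poly_Mapping.keys p" for m
    proof -
      have "Poly_Mapping.single m (1::'k) \<in> entry_polys n"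
        using p that by (auto simp: entry_polys_def)
      from \<phi>.entry_eval_hom[OF this, of y id] show ?thesis
        using y G GL_carrier_mat by (auto simp: entry_eval_alt)
    qed
    have "0 = r (entry_value p (map_mat \<phi> y)) b" by (simp add: p0[OF y] r0)
    also have "entry_value p (map_mat \<phi> y) =
        (\<Sum>m \<in> Poly_Mapping.keys p. \<phi> (monomial_eval m y) * Poly_Mapping.lookup p m)"
      by (simp add: entry_value_alt mon mult.commute)
    also have "r \<dots> b = (\<Sum>m \<in> Poly_Mapping.keys p. Poly_Mapping.lookup (q b) m * monomial_eval m y)"
      by (simp only: r_sum r_scale lq mult.commute[of "monomial_eval _ _"])
    also have "\<dots> = entry_value (q b) y"
      using kq[of b] by (simp add: entry_value_superset[of "Poly_Mapping.keys p"])
    finally show "entry_value (q b) y = 0" ..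
  qed
  define C where "C = (\<Union>m \<in> Poly_Mapping.keys p. {b. r (Poly_Mapping.lookup p m) b \<noteq> 0})"
  have finC: "finite C" unfolding C_def by (auto intro: r_fin)
  have coeff: "Poly_Mapping.lookup p m = (\<Sum>b\<in>C. \<phi> (r (Poly_Mapping.lookup p m) b) * b)"
    if m: "m \<in> Poly_Mapping.keys p" for m
  proof -
    have "Poly_Mapping.lookup p m =
        (\<Sum>b | r (Poly_Mapping.lookup p m) b \<noteq> 0. \<phi> (r (Poly_Mapping.lookup p m) b) * b)"
      by (rule r_expand[symmetric])
    also have "\<dots> = (\<Sum>b\<in>C. \<phi> (r (Poly_Mapping.lookup p m) b) * b)"
      by (rule sum.mono_neutral_left) (use finC m in \<open>auto simp: C_def\<close>)
    finally show ?thesis .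
  qed
  have "entry_value p h = (\<Sum>m \<in> Poly_Mapping.keys p. Poly_Mapping.lookup p m * monomial_eval m h)"
    by (simp add: entry_value_alt)
  also have "\<dots> = (\<Sum>m \<in> Poly_Mapping.keys p.
      (\<Sum>b\<in>C. \<phi> (r (Poly_Mapping.lookup p m) b) * b) * monomial_eval m h)"
    by (rule sum.cong[OF refl]) (simp only: coeff[symmetric])
  also have "\<dots> = (\<Sum>m \<in> Poly_Mapping.keys p. \<Sum>b\<in>C.
      b * (\<phi> (Poly_Mapping.lookup (q b) m) * monomial_eval m h))"
    by (simp only: sum_distrib_right lq) (simp add: mult_ac)
  also have "\<dots> = (\<Sum>b\<in>C. b * entry_eval \<phi> (q b) h)"
    using kq by (subst sum.swap)
      (simp add: entry_eval_superset[of "Poly_Mapping.keys p"] sum_distrib_left)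
  also have "\<dots> = 0" using q h by (simp add: points_def)
  finally show ?thesis by (simp add: F[OF h'])
qed

lemma mult_mat_entry:
  assumes "A \<in> carrier_mat nr m" "B \<in> carrier_mat m nc" "i < nr" "j < nc"
  shows "(A * B) $$ (i, j) = (\<Sum>l<m. A $$ (i, l) * B $$ (l, j))"
  using assms by (auto simp: scalar_prod_def atLeast0LessThan intro!: sum.cong)

lemma mult_mat_assoc_middle:
  assumes "x \<in> carrier_mat n n" "y \<in> carrier_mat n n" "y' \<in> carrier_mat n n"
    "x' \<in> carrier_mat n n" "y * y' = 1\<^sub>m n"
  shows "x * y * (y' * x') = x * (x' :: 'r::comm_ring_1 mat)"
proof -
  have "x * y * (y' * x') = x * ((y * y') * x')"
    using assms(1-4) by (simp add: assoc_mult_mat[of _ n n _ n _ n])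
  then show ?thesis using assms by simp
qed

section \<open>Matrices of regular functions\<close>

definition regular_matrix :: "nat \<Rightarrow> nat \<Rightarrow> ('r::comm_ring_1 mat \<Rightarrow> 'r mat) \<Rightarrow> bool" where
  "regular_matrix n m L \<longleftrightarrow> (\<forall>x \<in> carrier (GL n). L x \<in> carrier_mat m m) \<and>
     (\<forall>i<m. \<forall>j<m. regular_function n (\<lambda>x. L x $$ (i, j)))"

lemma regular_matrix_const: "C \<in> carrier_mat m m \<Longrightarrow> regular_matrix n m (\<lambda>_. C)"
  by (simp add: regular_matrix_def regular_function_const)

lemma regular_matrix_ident: "regular_matrix n n (\<lambda>x. x)"
  by (simp add: regular_matrix_def GL_carrier_mat regular_function_entry)

lemma regular_matrix_inv: "regular_matrix n n (\<lambda>x. inv\<^bsub>GL n\<^esub> x)"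
  by (simp add: regular_matrix_def GL_inv_mat regular_function_inv)

lemma regular_matrix_mult:
  assumes "regular_matrix n m L" "regular_matrix n m R"
  shows "regular_matrix n m (\<lambda>x. L x * R x)"
  unfolding regular_matrix_def
proof (intro conjI ballI allI impI)
  fix i j assume "i < m" "j < m"
  have "regular_function n (\<lambda>x. \<Sum>l<m. L x $$ (i, l) * R x $$ (l, j))"
    using assms \<open>i < m\<close> \<open>j < m\<close>
    by (intro regular_function_sum regular_function_mult) (auto simp: regular_matrix_def)
  then show "regular_function n (\<lambda>x. (L x * R x) $$ (i, j))"
    by (rule regular_function_cong[THEN iffD1, rotated])
      (use assms \<open>i < m\<close> \<open>j < m\<close> in \<open>auto simp: regular_matrix_def mult_mat_entry[of _ m m _ m]\<close>)
qed (use assms in \<open>auto simp: regular_matrix_def\<close>)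

lemma rep_eval_carrier [simp]: "rep_eval \<phi> m P N g \<in> carrier_mat m m"
  by (simp add: rep_eval_def)

text \<open>The factor \<open>1/det(f x)\<close> in \<open>\<rho>(f x)\<close> is regular because it is \<open>det (f' x)\<close>.\<close>

lemma regular_matrix_rep_eval:
  assumes P: "\<And>i j. i < m \<Longrightarrow> j < m \<Longrightarrow> P i j \<in> entry_polys n"
    and f: "regular_matrix n n f" "regular_matrix n n f'"
    and inv: "\<And>x. x \<in> carrier (GL n) \<Longrightarrow> f x * f' x = 1\<^sub>m n"
  shows "regular_matrix n m (\<lambda>x. rep_eval \<phi> m P N (f x))"
  unfolding regular_matrix_def
proof (intro conjI ballI allI impI)
  fix i j assume ij: "i < m" "j < m"
  have "regular_function n (\<lambda>x. entry_eval \<phi> (P i j) (f x) * det (f' x) ^ N)"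
    by (intro regular_function_mult regular_function_power regular_function_entry_eval[OF P]
        regular_function_det[where m = n]) (use f ij in \<open>auto simp: regular_matrix_def\<close>)
  moreover have "unit_inverse (det (f x)) = det (f' x)" if "x \<in> carrier (GL n)" for x
    by (rule unit_inverse_unique)
      (use f inv[OF that] that det_mult[of "f x" n "f' x"] in \<open>auto simp: regular_matrix_def\<close>)
  ultimately show "regular_function n (\<lambda>x. rep_eval \<phi> m P N (f x) $$ (i, j))"
    by (subst regular_function_cong[of n]) (use ij in \<open>auto simp: rep_eval_def\<close>)
qed simp

lemma regular_matrix_agree:
  fixes \<phi> :: "'k::field \<Rightarrow> 'r::comm_ring_1"
  assumes \<phi>: "comm_ring_hom \<phi>" and G: "G \<subseteq> carrier (GL n)"
    and L: "regular_matrix n m L" and R: "regular_matrix n m R"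
    and agree: "\<And>y. y \<in> G \<Longrightarrow> L (map_mat \<phi> y) = R (map_mat \<phi> y)"
    and h: "h \<in> points \<phi> n G"
  shows "L h = R h"
proof -
  have h': "h \<in> carrier (GL n)" using h by (simp add: points_def)
  show ?thesis
  proof (rule eq_matI)
    fix i j assume "i < dim_row (R h)" "j < dim_col (R h)"
    then have ij: "i < m" "j < m" using R h' by (auto simp: regular_matrix_def)
    have "L h $$ (i, j) - R h $$ (i, j) = 0"
      by (rule regular_function_vanishing[OF \<phi> regular_function_diff G _ h])
        (use L R ij agree in \<open>auto simp: regular_matrix_def\<close>)
    then show "L h $$ (i, j) = R h $$ (i, j)" by simp
  qed (use L R h' in \<open>force simp: regular_matrix_def\<close>)+
qed

section \<open>Representations on points over a ring\<close>

lemma points_GL: "g \<in> points \<phi> n G \<Longrightarrow> g \<in> carrier (GL n)"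
  by (simp add: points_def)

lemma (in comm_ring_hom) points_map:
  assumes "g \<in> points \<phi> n G"
  shows "map_mat hom g \<in> points (\<lambda>c. hom (\<phi> c)) n G"
proof -
  have "entry_eval (\<lambda>c. hom (\<phi> c)) p (map_mat hom g) = 0" if "p \<in> vanishing_ideal n G" for p
    using assms that entry_eval_hom[of p n g \<phi>]
    by (auto simp: points_def vanishing_ideal_def GL_carrier_mat)
  then show ?thesis using assms GL_map by (auto simp: points_def)
qed

lemma (in comm_ring_hom) rep_eval_hom:
  assumes P: "\<And>i j. i < m \<Longrightarrow> j < m \<Longrightarrow> P i j \<in> entry_polys n" and g: "g \<in> carrier (GL n)"
  shows "rep_eval (\<lambda>c. hom (\<phi> c)) m P N (map_mat hom g) = map_mat hom (rep_eval \<phi> m P N g)"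
  by (rule eq_matI)
    (auto simp: rep_eval_def hom_mult hom_power unit_inverse_det_hom[OF g]
      entry_eval_hom[OF P GL_carrier_mat[OF g]] simp del: hom_det)

locale group_representation =
  fixes n :: nat and G :: "'k::field mat set" and m P N
  assumes G: "subgroup G (GL n)" and rep: "rational_representation n G m P N"
begin

lemma P: "i < m \<Longrightarrow> j < m \<Longrightarrow> P i j \<in> entry_polys n"
  using rep by (simp add: rational_representation_def)

lemma G_sub: "G \<subseteq> carrier (GL n)"
  using G by (rule subgroup.subset)

lemma one_G: "1\<^sub>m n \<in> G"
  using subgroup.one_closed[OF G] by simp

lemma rep_mult_G: "x \<in> G \<Longrightarrow> y \<in> G \<Longrightarrow> rep_eval id m P N (x * y) = rep_eval id m P N x * rep_eval id m P N y"
  using rep by (auto simp: rational_representation_def hom_def)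

lemma rep_GL: "x \<in> G \<Longrightarrow> rep_eval id m P N x \<in> carrier (GL m)"
  using rep by (auto simp: rational_representation_def hom_def)

lemma rep_one_G: "rep_eval id m P N (1\<^sub>m n) = 1\<^sub>m m"
proof -
  let ?r = "rep_eval id m P N (1\<^sub>m n)"
  have r: "?r \<in> carrier (GL m)" by (rule rep_GL[OF one_G])
  note i = GL_inv_mat[OF r]
  have "?r * ?r = ?r" using rep_mult_G[OF one_G one_G] by simp
  then have "inv\<^bsub>GL m\<^esub> ?r * (?r * ?r) = inv\<^bsub>GL m\<^esub> ?r * ?r" by simp
  then have "(inv\<^bsub>GL m\<^esub> ?r * ?r) * ?r = 1\<^sub>m m"
    using i by (subst assoc_mult_mat[of _ m m _ m _ m]) auto
  then show ?thesis unfolding i(2) by (simp add: left_mult_one_mat[of _ m m])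
qed

context
  fixes \<phi> :: "'k \<Rightarrow> 'r::comm_ring_1"
  assumes \<phi>: "comm_ring_hom \<phi>"
begin

interpretation \<phi>: comm_ring_hom \<phi> by (rule \<phi>)

lemma rep_eval_base_change:
  "y \<in> G \<Longrightarrow> rep_eval \<phi> m P N (map_mat \<phi> y) = map_mat \<phi> (rep_eval id m P N y)"
  using \<phi>.rep_eval_hom[where \<phi> = id and g = y and N = N and n = n, OF P] G_sub by auto

lemma rep_eval_one: "rep_eval \<phi> m P N (1\<^sub>m n) = 1\<^sub>m m"
  using rep_eval_base_change[OF one_G] by (simp add: rep_one_G \<phi>.mat_hom_one)

text \<open>The relation \<open>\<rho>(x y) = \<rho>(x) \<rho>(y)\<close> holds on \<open>G \<times> G\<close>. It is extended to \<open>G(R)\<close> one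
  factor at a time: in \<open>x\<close> for fixed \<open>y \<in> G\<close>, then in \<open>y\<close> for fixed \<open>x \<in> G(R)\<close>.\<close>

lemma rep_eval_mult:
  assumes g: "g \<in> points \<phi> n G" and h: "h \<in> points \<phi> n G"
  shows "rep_eval \<phi> m P N (g * h) = rep_eval \<phi> m P N g * rep_eval \<phi> m P N h"
proof -
  have phi_G: "map_mat \<phi> y \<in> carrier (GL n)" if "y \<in> G" for y
    using that G_sub \<phi>.GL_map by blast
  have reg: "regular_matrix n m (\<lambda>x. rep_eval \<phi> m P N x)"
    by (rule regular_matrix_rep_eval[OF P regular_matrix_ident regular_matrix_inv])
      (simp_all add: GL_inv_mat)
  have 1: "rep_eval \<phi> m P N (x * map_mat \<phi> y) = rep_eval \<phi> m P N x * rep_eval \<phi> m P N (map_mat \<phi> y)"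
    if y: "y \<in> G" and x: "x \<in> points \<phi> n G" for x y
  proof (rule regular_matrix_agree[OF \<phi> G_sub _ _ _ x])
    let ?y = "map_mat \<phi> y"
    have Y: "?y \<in> carrier (GL n)" by (rule phi_G[OF y])
    show "regular_matrix n m (\<lambda>x. rep_eval \<phi> m P N (x * ?y))"
    proof (rule regular_matrix_rep_eval[OF P])
      show "regular_matrix n n (\<lambda>x. x * ?y)" "regular_matrix n n (\<lambda>x. inv\<^bsub>GL n\<^esub> ?y * inv\<^bsub>GL n\<^esub> x)"
        by (intro regular_matrix_mult regular_matrix_const regular_matrix_ident regular_matrix_inv
            GL_carrier_mat GL_inv_mat Y)+
      fix x :: "'r mat" assume "x \<in> carrier (GL n)"
      then show "x * ?y * (inv\<^bsub>GL n\<^esub> ?y * inv\<^bsub>GL n\<^esub> x) = 1\<^sub>m n"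
        using GL_inv_mat[of x n] GL_inv_mat[OF Y] GL_carrier_mat[OF Y] GL_carrier_mat[of x n]
        by (simp add: mult_mat_assoc_middle)
    qed
    show "regular_matrix n m (\<lambda>x. rep_eval \<phi> m P N x * rep_eval \<phi> m P N ?y)"
      by (intro regular_matrix_mult reg regular_matrix_const) simp
    fix z assume z: "z \<in> G"
    have "map_mat \<phi> z * ?y = map_mat \<phi> (z * y)"
      using z y G_sub GL_carrier_mat by (intro \<phi>.mat_hom_mult[symmetric, of _ n n _ n]) auto
    then show "rep_eval \<phi> m P N (map_mat \<phi> z * ?y) = rep_eval \<phi> m P N (map_mat \<phi> z) * rep_eval \<phi> m P N ?y"
      using z y subgroup.m_closed[OF G z y]
      by (simp add: rep_eval_base_change rep_mult_G \<phi>.mat_hom_mult[of _ m m _ m])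
  qed
  show ?thesis
  proof (rule regular_matrix_agree[OF \<phi> G_sub _ _ _ h])
    have g': "g \<in> carrier (GL n)" using g by (rule points_GL)
    show "regular_matrix n m (\<lambda>x. rep_eval \<phi> m P N (g * x))"
    proof (rule regular_matrix_rep_eval[OF P])
      show "regular_matrix n n (\<lambda>x. g * x)" "regular_matrix n n (\<lambda>x. inv\<^bsub>GL n\<^esub> x * inv\<^bsub>GL n\<^esub> g)"
        by (intro regular_matrix_mult regular_matrix_const regular_matrix_ident regular_matrix_inv
            GL_carrier_mat GL_inv_mat g')+
      fix x :: "'r mat" assume "x \<in> carrier (GL n)"
      then show "g * x * (inv\<^bsub>GL n\<^esub> x * inv\<^bsub>GL n\<^esub> g) = 1\<^sub>m n"
        using GL_inv_mat[of x n] GL_inv_mat[OF g'] GL_carrier_mat[OF g'] GL_carrier_mat[of x n]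
        by (simp add: mult_mat_assoc_middle)
    qed
    show "regular_matrix n m (\<lambda>x. rep_eval \<phi> m P N g * rep_eval \<phi> m P N x)"
      by (intro regular_matrix_mult reg regular_matrix_const) simp
  qed (rule 1[OF _ g])
qed

text \<open>Invertibility of \<open>\<rho>(g)\<close>, obtained from the regular function \<open>x \<mapsto> \<rho>(x) \<rho>(x\<^sup>-\<^sup>1)\<close> without
  showing that \<open>G(R)\<close> is closed under inverses.\<close>

lemma rep_eval_inv:
  assumes g: "g \<in> points \<phi> n G"
  shows "rep_eval \<phi> m P N g * rep_eval \<phi> m P N (inv\<^bsub>GL n\<^esub> g) = 1\<^sub>m m"
proof (rule regular_matrix_agree[OF \<phi> G_sub _ _ _ g])
  show "regular_matrix n m (\<lambda>x. rep_eval \<phi> m P N x * rep_eval \<phi> m P N (inv\<^bsub>GL n\<^esub> x))"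
    by (intro regular_matrix_mult
        regular_matrix_rep_eval[OF P regular_matrix_ident regular_matrix_inv]
        regular_matrix_rep_eval[OF P regular_matrix_inv regular_matrix_ident])
      (simp_all add: GL_inv_mat)
  show "regular_matrix n m (\<lambda>_. 1\<^sub>m m)" by (rule regular_matrix_const) simp
  fix y assume y: "y \<in> G"
  have y': "y \<in> carrier (GL n)" using y G_sub by blast
  have i: "inv\<^bsub>GL n\<^esub> y \<in> G" using subgroup.m_inv_closed[OF G y] .
  have "map_mat \<phi> (inv\<^bsub>GL n\<^esub> y) * map_mat \<phi> y = 1\<^sub>m n"
    using GL_inv_mat[OF y'] GL_carrier_mat[OF y'] \<phi>.mat_hom_mult[of "inv\<^bsub>GL n\<^esub> y" n n y n]
    by (simp add: \<phi>.mat_hom_one)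
  then have "inv\<^bsub>GL n\<^esub> (map_mat \<phi> y) = map_mat \<phi> (inv\<^bsub>GL n\<^esub> y)"
    using \<phi>.GL_map[OF y'] \<phi>.GL_map[OF GL_inv_closed[OF y']]
    by (intro group.inv_equality[OF group_GL]) simp_all
  moreover have "rep_eval id m P N y * rep_eval id m P N (inv\<^bsub>GL n\<^esub> y) = 1\<^sub>m m"
    using rep_mult_G[OF y i] GL_inv_mat[OF y'] by (simp add: rep_one_G)
  ultimately show "rep_eval \<phi> m P N (map_mat \<phi> y) * rep_eval \<phi> m P N (inv\<^bsub>GL n\<^esub> map_mat \<phi> y) = 1\<^sub>m m"
    using y i by (simp add: rep_eval_base_change \<phi>.mat_hom_one
        \<phi>.mat_hom_mult[of _ m m _ m, symmetric])
qed

lemma rep_eval_GL: "g \<in> points \<phi> n G \<Longrightarrow> rep_eval \<phi> m P N g \<in> carrier (GL m)"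
  by (rule GL_I_right[OF _ _ rep_eval_inv]) simp_all

end

end

section \<open>Dual numbers\<close>

lemma comm_ring_hom_dual_re: "comm_ring_hom (dual_re :: 'r::comm_ring_1 dual \<Rightarrow> 'r)"
  by standard (simp_all add: zero_dual_def one_dual_def plus_dual_def times_dual_def)

lemma comm_ring_hom_dual_const: "comm_ring_hom (\<lambda>c::'r::comm_ring_1. dual_const c)"
  by standard (simp_all add: zero_dual_def one_dual_def plus_dual_def times_dual_def)

lemma Dual_eq_0_iff: "Dual a b = 0 \<longleftrightarrow> a = 0 \<and> b = 0"
  by (simp add: zero_dual_def)

lemma comm_ring_hom_fls_const: "comm_ring_hom (fls_const :: 'k::field \<Rightarrow> 'k fls)"
  by standard (auto simp: fls_plus_const fls_const_mult_const)

lemma comm_ring_hom_comp: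
  assumes "comm_ring_hom f" "comm_ring_hom g"
  shows "comm_ring_hom (\<lambda>x. f (g x))"
proof -
  interpret f: comm_ring_hom f by fact
  interpret g: comm_ring_hom g by fact
  show ?thesis by standard (simp_all add: f.hom_add g.hom_add f.hom_mult g.hom_mult)
qed

lemma dual_re_sum: "dual_re (\<Sum>x\<in>A. f x) = (\<Sum>x\<in>A. dual_re (f x))"
  by (induction A rule: infinite_finite_induct) (simp_all add: zero_dual_def plus_dual_def)

lemma dual_eps_sum: "dual_eps (\<Sum>x\<in>A. f x) = (\<Sum>x\<in>A. dual_eps (f x))"
  by (induction A rule: infinite_finite_induct) (simp_all add: zero_dual_def plus_dual_def)

lemma mult_mat_dual:
  fixes A B :: "'r::comm_ring_1 dual mat"
  assumes "A \<in> carrier_mat n n" "B \<in> carrier_mat n n"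
  shows "map_mat dual_re (A * B) = map_mat dual_re A * map_mat dual_re B"
    and "map_mat dual_eps (A * B) =
      map_mat dual_re A * map_mat dual_eps B + map_mat dual_eps A * map_mat dual_re B"
proof -
  have AB: "(A * B) $$ (i, j) = (\<Sum>l<n. A $$ (i, l) * B $$ (l, j))" if "i < n" "j < n" for i j
    by (rule mult_mat_entry) (use assms that in auto)
  have maps: "(map_mat f A * map_mat h B) $$ (i, j) = (\<Sum>l<n. f (A $$ (i, l)) * h (B $$ (l, j)))"
    if "i < n" "j < n" for f h :: "'r dual \<Rightarrow> 'r" and i j
    using assms that
    by (subst mult_mat_entry[of _ n n _ n]) (auto intro!: sum.cong)
  show "map_mat dual_re (A * B) = map_mat dual_re A * map_mat dual_re B"
    using assms by (intro eq_matI)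
      (simp_all add: AB maps dual_re_sum times_dual_def del: index_mult_mat(1))
  show "map_mat dual_eps (A * B) =
      map_mat dual_re A * map_mat dual_eps B + map_mat dual_eps A * map_mat dual_re B"
    using assms by (intro eq_matI)
      (simp_all add: AB maps dual_eps_sum times_dual_def sum.distrib del: index_mult_mat(1))
qed

lemma mat_dual_eqI:
  fixes A B :: "'r::comm_ring_1 dual mat"
  assumes "map_mat dual_re A = map_mat dual_re B" "map_mat dual_eps A = map_mat dual_eps B"
  shows "A = B"
proof (rule eq_matI)
  have dims: "dim_row A = dim_row B" "dim_col A = dim_col B"
    using arg_cong[OF assms(1), of dim_row] arg_cong[OF assms(1), of dim_col] by simp_all
  then show "dim_row A = dim_row B" "dim_col A = dim_col B" .
  fix i j assume "i < dim_row B" "j < dim_col B"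
  then show "A $$ (i, j) = B $$ (i, j)"
    using arg_cong[OF assms(1), of "\<lambda>M. M $$ (i, j)"] arg_cong[OF assms(2), of "\<lambda>M. M $$ (i, j)"] dims
    by (simp add: dual_eqI)
qed

lemma one_plus_eps_parts:
  assumes "X \<in> carrier_mat n n"
  shows "one_plus_eps n X \<in> carrier_mat n n"
    "map_mat dual_re (one_plus_eps n X) = 1\<^sub>m n"
    "map_mat dual_eps (one_plus_eps n X) = (X :: 'r::comm_ring_1 mat)"
  using assms by (auto intro!: eq_matI simp: one_plus_eps_def)

lemma one_plus_eps_GL:
  assumes "X \<in> carrier_mat n n"
  shows "one_plus_eps n X \<in> carrier (GL n)"
proof (rule GL_I_right)
  show "one_plus_eps n X * one_plus_eps n (- X) = 1\<^sub>m n"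
  proof (rule mat_dual_eqI)
    have "map_mat dual_eps (one_plus_eps n X * one_plus_eps n (- X)) = - X + X"
      using assms by (subst mult_mat_dual[of _ n]) (simp_all add: one_plus_eps_parts)
    also have "\<dots> = map_mat dual_eps (1\<^sub>m n)"
      using assms by (auto intro!: eq_matI simp: one_dual_def zero_dual_def)
    finally show "map_mat dual_eps (one_plus_eps n X * one_plus_eps n (- X)) = map_mat dual_eps (1\<^sub>m n)" .
    show "map_mat dual_re (one_plus_eps n X * one_plus_eps n (- X)) = map_mat dual_re (1\<^sub>m n)"
      using assms by (subst mult_mat_dual[of _ n])
        (auto intro!: eq_matI simp: one_plus_eps_parts one_dual_def zero_dual_def)
  qed
qed (use assms in \<open>auto simp: one_plus_eps_def\<close>)

text \<open>In the Leibniz formula a permutation other than the identity moves at least two points, so its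
  term contains \<open>\<epsilon>\<^sup>2\<close>.\<close>

lemma det_one_plus_eps:
  assumes X: "X \<in> carrier_mat n n"
  shows "det (one_plus_eps n X) = Dual 1 (\<Sum>i<n. X $$ (i, i) :: 'r::comm_ring_1)"
proof -
  let ?h = "one_plus_eps n X"
  let ?t = "\<lambda>p. signof p * (\<Prod>i = 0..<n. ?h $$ (i, p i))"
  have h: "?h $$ (i, j) = Dual (if i = j then 1 else 0) (X $$ (i, j))" if "i < n" "j < n" for i j
    using that by (simp add: one_plus_eps_def)
  have zero: "?t p = 0" if p: "p permutes {0..<n}" "p \<noteq> id" for p
  proof -
    obtain i where i: "p i \<noteq> i" using p(2) by fastforce
    have i': "i < n" using p(1) i by (meson atLeastLessThan_iff permutes_not_in zero_le)
    have pi: "p i < n" using permutes_in_image[OF p(1), of i] i' by simp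
    have ppi: "p (p i) \<noteq> p i" using permutes_inj[OF p(1)] i by (auto dest: injD)
    have ppi': "p (p i) < n" using permutes_in_image[OF p(1), of "p i"] pi by simp
    have "(\<Prod>i = 0..<n. ?h $$ (i, p i)) =
        ?h $$ (i, p i) * (?h $$ (p i, p (p i)) * (\<Prod>i \<in> {0..<n} - {i} - {p i}. ?h $$ (i, p i)))"
      using i i' pi by (subst prod.remove[of _ i], simp, simp, subst prod.remove[of _ "p i"]) auto
    also have "\<dots> = (?h $$ (i, p i) * ?h $$ (p i, p (p i))) * (\<Prod>i \<in> {0..<n} - {i} - {p i}. ?h $$ (i, p i))"
      by (simp only: mult.assoc)
    also have "?h $$ (i, p i) * ?h $$ (p i, p (p i)) = 0"
      using i i' pi ppi ppi' by (simp add: h times_dual_def zero_dual_def)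
    finally show ?thesis by simp
  qed
  have "det ?h = (\<Sum>p | p permutes {0..<n}. ?t p)"
    by (rule det_def') (use X in \<open>simp add: one_plus_eps_parts\<close>)
  also have "\<dots> = (\<Sum>p \<in> {id}. ?t p)"
    by (rule sum.mono_neutral_right)
      (use zero in \<open>auto simp: finite_permutations permutes_id\<close>)
  also have "\<dots> = (\<Prod>i<n. Dual 1 (X $$ (i, i)))"
    by (simp add: sign_id h atLeast0LessThan)
  also have "\<dots> = Dual 1 (\<Sum>i<n. X $$ (i, i))"
    by (induction n) (simp_all add: one_dual_def times_dual_def add.commute)
  finally show ?thesis .
qed

section \<open>The Lie algebra\<close>

text \<open>On \<open>1 + \<epsilon>X\<close> a polynomial over \<open>k\<close> takes the value \<open>a + \<epsilon> \<Sum> e\<^sub>i\<^sub>j X\<^sub>i\<^sub>j\<close> with \<open>a\<close> and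
  \<open>e\<^sub>i\<^sub>j\<close> in \<open>k\<close>. Here \<open>a\<close> is its value at \<open>1\<close>, which is \<open>0\<close> for a polynomial in the
  vanishing ideal. So the condition on \<open>X\<close> to be in the Lie algebra is linear over \<open>k\<close> and is inherited
  by linear combinations with coefficients in \<open>K\<close>.\<close>

lemma lie_algebra_tensor_points:
  fixes G :: "'k::field mat set"
  assumes one: "1\<^sub>m n \<in> G" and A: "A \<in> lie_algebra_tensor n G S"
  shows "A \<in> carrier_mat n n" "one_plus_eps n A \<in> points (\<lambda>c. dual_const (fls_const c)) n G"
proof -
  interpret c: comm_ring_hom "fls_const :: 'k \<Rightarrow> 'k fls" by (rule comm_ring_hom_fls_const)
  interpret d: comm_ring_hom "\<lambda>c::'k. dual_const c" by (rule comm_ring_hom_dual_const)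
  obtain r :: nat and c X where A: "A = mat n n (\<lambda>ij. \<Sum>l<r. c l * fls_const (X l $$ ij))"
    and X: "\<And>l. l < r \<Longrightarrow> X l \<in> lie_algebra n G"
    using A unfolding lie_algebra_tensor_def by blast
  show car: "A \<in> carrier_mat n n" by (simp add: A)
  show "one_plus_eps n A \<in> points (\<lambda>c. dual_const (fls_const c)) n G"
    unfolding points_def
  proof (intro CollectI conjI ballI)
    show "one_plus_eps n A \<in> carrier (GL n)" by (rule one_plus_eps_GL[OF car])
    fix p assume p: "p \<in> vanishing_ideal n G"
    then have p': "p \<in> entry_polys n" by (simp add: vanishing_ideal_def)
    from c.eps_affine_entry_eval[OF p'] obtain a e where
      F: "\<And>X. entry_eval (\<lambda>c. dual_const c) p (one_plus_eps n X) =
        Dual a (\<Sum>i<n. \<Sum>j<n. e i j * X $$ (i, j))"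
      "\<And>Y. entry_eval (\<lambda>c. dual_const (fls_const c)) p (one_plus_eps n Y) =
        Dual (fls_const a) (\<Sum>i<n. \<Sum>j<n. fls_const (e i j) * Y $$ (i, j))"
      unfolding eps_affine_def by blast
    have "one_plus_eps n (0\<^sub>m n n) = map_mat (\<lambda>c. dual_const c) (1\<^sub>m n :: 'k mat)"
      by (rule eq_matI) (auto simp: one_plus_eps_def)
    then have "Dual a 0 = entry_eval (\<lambda>c. dual_const c) p (map_mat (\<lambda>c. dual_const c) (1\<^sub>m n))"
      using F(1)[of "0\<^sub>m n n"] by simp
    also have "\<dots> = dual_const (entry_eval id p (1\<^sub>m n))"
      using d.entry_eval_hom[OF p', of "1\<^sub>m n" id] by simp
    also have "entry_eval id p (1\<^sub>m n) = 0" using p one by (simp add: vanishing_ideal_def)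
    finally have a: "a = 0" by (simp add: Dual_eq_0_iff)
    have X0: "(\<Sum>i<n. \<Sum>j<n. e i j * X l $$ (i, j)) = 0" if "l < r" for l
      using X[OF that] p F(1)[of "X l"] by (simp add: lie_algebra_def points_def Dual_eq_0_iff)
    have "(\<Sum>i<n. \<Sum>j<n. fls_const (e i j) * A $$ (i, j)) =
        (\<Sum>i<n. \<Sum>j<n. \<Sum>l<r. c l * fls_const (e i j * X l $$ (i, j)))"
    proof (intro sum.cong refl)
      fix i j assume "i \<in> {..<n}" "j \<in> {..<n}"
      then have "A $$ (i, j) = (\<Sum>l<r. c l * fls_const (X l $$ (i, j)))" by (simp add: A)
      then show "fls_const (e i j) * A $$ (i, j) = (\<Sum>l<r. c l * fls_const (e i j * X l $$ (i, j)))"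
        by (simp only: sum_distrib_left c.hom_mult mult.left_commute)
    qed
    also have "\<dots> = (\<Sum>l<r. c l * fls_const (\<Sum>i<n. \<Sum>j<n. e i j * X l $$ (i, j)))"
      by (simp only: c.hom_sum sum_distrib_left sum.swap[of _ "{..<n}" "{..<r}"])
    also have "\<dots> = 0" by (simp add: X0)
    finally show "entry_eval (\<lambda>c. dual_const (fls_const c)) p (one_plus_eps n A) = 0"
      unfolding F a by (simp add: Dual_eq_0_iff)
  qed
qed

section \<open>Representations and gauge transformations\<close>

text \<open>The derivation \<open>\<theta> = z d/dz\<close>.\<close>

abbreviation zd :: "'k::field fls \<Rightarrow> 'k fls" where
  "zd \<equiv> derivation fls_X"

lemma zd_add: "zd (x + y) = zd x + zd y"
  and zd_mult: "zd (x * y) = x * zd y + zd x * y"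
  and zd_const: "zd (fls_const c) = 0"
  and zd_0: "zd 0 = 0"
  and zd_1: "zd 1 = 0"
  by (simp_all add: derivation_def algebra_simps)

lemma zd_sum: "zd (\<Sum>x\<in>A. f x) = (\<Sum>x\<in>A. zd (f x))"
  by (induction A rule: infinite_finite_induct) (simp_all add: zd_add zd_0)

lemma derivation_eq_zd: "derivation f x = f * fls_X_inv * zd x"
proof -
  have "fls_X_inv * (fls_X :: 'a fls) = 1" by (metis fls_X_nonzero fls_inverse_X left_inverse)
  then have "f * (fls_X_inv * fls_X) * fls_deriv x = derivation f x" by (simp add: derivation_def)
  then show ?thesis by (simp only: derivation_def mult.assoc)
qed

lemma zd_mat_mult:
  assumes "A \<in> carrier_mat n m" "B \<in> carrier_mat m r"
  shows "map_mat zd (A * B) = map_mat zd A * B + A * map_mat zd B"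
  using assms
  by (intro eq_matI)
    (auto simp: mult_mat_entry[of _ n m _ r] zd_sum zd_mult sum.distrib add.commute
      simp del: index_mult_mat(1))

text \<open>A derivation is the same as a ring homomorphism to the dual numbers that lifts the identity. This
  one induces \<open>g \<mapsto> g + \<epsilon> \<theta>g\<close> from \<open>G(K)\<close> to \<open>G(K[\<epsilon>])\<close>.\<close>

definition taylor :: "'k::field fls \<Rightarrow> 'k fls dual" where
  "taylor f = Dual f (zd f)"

lemma comm_ring_hom_taylor: "comm_ring_hom (taylor :: 'k::field fls \<Rightarrow> 'k fls dual)"
  by standard
    (simp_all add: taylor_def zero_dual_def one_dual_def plus_dual_def times_dual_def
      zd_add zd_mult zd_0 zd_1)

context group_representation
begin

lemma rep_eval_one_plus_eps:
  fixes \<phi> :: "'k \<Rightarrow> 'r::comm_ring_1"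
  assumes \<phi>: "comm_ring_hom \<phi>" and X: "X \<in> carrier_mat n n"
  shows "rep_eval (\<lambda>c. dual_const (\<phi> c)) m P N (one_plus_eps n X) =
    one_plus_eps m (lie_rep \<phi> n m P N X)"
proof (rule mat_dual_eqI)
  interpret re: comm_ring_hom "dual_re :: 'r dual \<Rightarrow> 'r" by (rule comm_ring_hom_dual_re)
  let ?r = "rep_eval (\<lambda>c. dual_const (\<phi> c)) m P N (one_plus_eps n X)"
  have L: "lie_rep \<phi> n m P N X \<in> carrier_mat m m" by (simp add: lie_rep_def)
  have "map_mat dual_re ?r = rep_eval \<phi> m P N (1\<^sub>m n)"
    using re.rep_eval_hom[OF P one_plus_eps_GL[OF X], where \<phi> = "\<lambda>c. dual_const (\<phi> c)" and N = N]
    by (simp add: one_plus_eps_parts[OF X])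
  then show "map_mat dual_re ?r = map_mat dual_re (one_plus_eps m (lie_rep \<phi> n m P N X))"
    by (simp add: one_plus_eps_parts[OF L] rep_eval_one[OF \<phi>])
  show "map_mat dual_eps ?r = map_mat dual_eps (one_plus_eps m (lie_rep \<phi> n m P N X))"
    by (simp add: one_plus_eps_parts[OF L]) (simp add: lie_rep_def)
qed

text \<open>The hypothesis says that \<open>B\<close> is the gauge transform of \<open>A\<close> by \<open>g\<close>, in a form without inverses.
  It is equivalent to \<open>(1 + \<epsilon>B) g = (g + \<epsilon> \<theta>g) (1 + \<epsilon>A)\<close>, where all four factors are in
  \<open>G(K[\<epsilon>])\<close>, and the conclusion is the coefficient of \<open>\<epsilon>\<close> after \<open>\<rho>\<close> is applied.\<close>

lemma lie_rep_gauge: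
  assumes A: "A \<in> carrier_mat n n" "one_plus_eps n A \<in> points (\<lambda>c. dual_const (fls_const c)) n G"
    and B: "B \<in> carrier_mat n n" "one_plus_eps n B \<in> points (\<lambda>c. dual_const (fls_const c)) n G"
    and g: "g \<in> points fls_const n G"
    and eq: "B * g = g * A + map_mat zd g"
  defines "R \<equiv> rep_eval fls_const m P N g"
  shows "lie_rep fls_const n m P N B * R = R * lie_rep fls_const n m P N A + map_mat zd R"
proof -
  let ?\<phi> = "\<lambda>c::'k. dual_const (fls_const c)"
  let ?\<rho> = "rep_eval ?\<phi> m P N"
  have \<phi>: "comm_ring_hom ?\<phi>"
    by (rule comm_ring_hom_comp[OF comm_ring_hom_dual_const comm_ring_hom_fls_const])
  interpret d: comm_ring_hom "\<lambda>c::'k fls. dual_const c" by (rule comm_ring_hom_dual_const)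
  interpret t: comm_ring_hom "taylor :: 'k fls \<Rightarrow> _" by (rule comm_ring_hom_taylor)
  have tc: "(\<lambda>c::'k. taylor (fls_const c)) = ?\<phi>" by (simp add: taylor_def zd_const)
  have g': "g \<in> carrier (GL n)" and gm: "g \<in> carrier_mat n n"
    using g points_GL GL_carrier_mat by blast+
  have Rm: "R \<in> carrier_mat m m" by (simp add: R_def)
  have L: "lie_rep fls_const n m P N X \<in> carrier_mat m m" for X by (simp add: lie_rep_def)
  have parts: "map_mat dual_re (map_mat taylor M) = M" "map_mat dual_eps (map_mat taylor M) = map_mat zd M"
    "map_mat dual_re (map_mat (\<lambda>c. dual_const c) M) = M"
    "map_mat dual_eps (map_mat (\<lambda>c. dual_const c) M) = 0\<^sub>m (dim_row M) (dim_col M)"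
    for M :: "'k fls mat"
    by (auto intro!: eq_matI simp: taylor_def)
  have "one_plus_eps n B * map_mat (\<lambda>c. dual_const c) g = map_mat taylor g * one_plus_eps n A"
    by (rule mat_dual_eqI; subst (1 2) mult_mat_dual[of _ n])
      (use A B gm eq in \<open>simp_all add: one_plus_eps_parts parts\<close>)
  then have "?\<rho> (one_plus_eps n B * map_mat (\<lambda>c. dual_const c) g) = ?\<rho> (map_mat taylor g * one_plus_eps n A)"
    by simp
  then have "?\<rho> (one_plus_eps n B) * ?\<rho> (map_mat (\<lambda>c. dual_const c) g) =
      ?\<rho> (map_mat taylor g) * ?\<rho> (one_plus_eps n A)"
    using rep_eval_mult[OF \<phi> B(2) d.points_map[OF g]] t.points_map[OF g]
      rep_eval_mult[OF \<phi> _ A(2), of "map_mat taylor g"] by (simp add: tc)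
  then have "one_plus_eps m (lie_rep fls_const n m P N B) * map_mat (\<lambda>c. dual_const c) R =
      map_mat taylor R * one_plus_eps m (lie_rep fls_const n m P N A)"
    using d.rep_eval_hom[OF P g', where \<phi> = fls_const and N = N]
      t.rep_eval_hom[OF P g', where \<phi> = fls_const and N = N]
    by (simp add: rep_eval_one_plus_eps[OF comm_ring_hom_fls_const] A B R_def tc)
  from arg_cong[OF this, of "map_mat dual_eps"] show ?thesis
    using Rm L left_add_zero_mat[OF mult_carrier_mat[OF L[of B] Rm]]
    by (subst (asm) (1 2) mult_mat_dual[of _ m]) (simp_all add: one_plus_eps_parts parts)
qed

end

section \<open>Points of the general and the special linear group\<close>

definition polynomial_function :: "('r::comm_ring_1 \<Rightarrow> 'r) \<Rightarrow> bool" where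
  "polynomial_function f \<longleftrightarrow> (\<exists>q. \<forall>t. f t = poly q t)"

lemma polynomial_function_const: "polynomial_function (\<lambda>_. c)"
  unfolding polynomial_function_def by (rule exI[of _ "[:c:]"]) simp

lemma polynomial_function_ident: "polynomial_function (\<lambda>t. t)"
  unfolding polynomial_function_def by (rule exI[of _ "[:0, 1:]"]) simp

lemma polynomial_function_add:
  "polynomial_function f \<Longrightarrow> polynomial_function h \<Longrightarrow> polynomial_function (\<lambda>t. f t + h t)"
  unfolding polynomial_function_def by (metis poly_add)

lemma polynomial_function_mult:
  "polynomial_function f \<Longrightarrow> polynomial_function h \<Longrightarrow> polynomial_function (\<lambda>t. f t * h t)"
  unfolding polynomial_function_def by (metis poly_mult)

lemma polynomial_function_sum:
  "(\<And>x. x \<in> A \<Longrightarrow> polynomial_function (f x)) \<Longrightarrow> polynomial_function (\<lambda>t. \<Sum>x\<in>A. f x t)"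
  by (induction A rule: infinite_finite_induct)
    (auto intro: polynomial_function_add polynomial_function_const)

lemma polynomial_function_prod:
  "(\<And>x. x \<in> A \<Longrightarrow> polynomial_function (f x)) \<Longrightarrow> polynomial_function (\<lambda>t. \<Prod>x\<in>A. f x t)"
  by (induction A rule: infinite_finite_induct)
    (auto intro: polynomial_function_mult polynomial_function_const)

lemma polynomial_function_power:
  "polynomial_function f \<Longrightarrow> polynomial_function (\<lambda>t. f t ^ r)"
  by (induction r) (auto intro: polynomial_function_mult polynomial_function_const)

lemma polynomial_function_entry_eval:
  assumes "p \<in> entry_polys n" "\<And>i j. i < n \<Longrightarrow> j < n \<Longrightarrow> polynomial_function (\<lambda>t. M t $$ (i, j))"
  shows "polynomial_function (\<lambda>t. entry_eval \<phi> p (M t))"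
  unfolding entry_eval_def
  by (intro polynomial_function_sum polynomial_function_mult polynomial_function_const
      polynomial_function_prod polynomial_function_power)
    (use assms in \<open>auto simp: entry_polys_def\<close>)

lemma polynomial_function_det:
  assumes "\<And>t. M t \<in> carrier_mat n n"
    "\<And>i j. i < n \<Longrightarrow> j < n \<Longrightarrow> polynomial_function (\<lambda>t. M t $$ (i, j))"
  shows "polynomial_function (\<lambda>t. det (M t))"
  unfolding det_def'[OF assms(1)]
  by (intro polynomial_function_sum polynomial_function_mult polynomial_function_const
      polynomial_function_prod) (auto intro!: assms(2) dest: permutes_in_image)

text \<open>A nonzero polynomial over the ring \<open>R\<close> may have infinitely many zeros, but not all of \<open>k\<close>: its
  coefficients can be taken apart in a basis of \<open>R\<close> over \<open>k\<close>.\<close>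

lemma polynomial_vanishing_on_field:
  fixes \<phi> :: "'k::field_char_0 \<Rightarrow> 'r::comm_ring_1"
  assumes \<phi>: "comm_ring_hom \<phi>" and f: "polynomial_function f" and van: "\<And>t. f (\<phi> t) = 0"
  shows "f x = 0"
proof -
  interpret \<phi>: comm_ring_hom \<phi> by fact
  obtain r :: "'r \<Rightarrow> 'r \<Rightarrow> 'k" where r0: "\<And>b. r 0 b = 0"
    and r_add: "\<And>x y b. r (x + y) b = r x b + r y b"
    and r_scale: "\<And>c x b. r (\<phi> c * x) b = c * r x b"
    and "\<And>x. finite {b. r x b \<noteq> 0}"
    and r_expand: "\<And>x. (\<Sum>b | r x b \<noteq> 0. \<phi> (r x b) * b) = x"
    by (rule coefficients_over_field[OF \<phi>], rule that)
  have r_sum: "r (sum h A) b = (\<Sum>a\<in>A. r (h a) b)" for h :: "nat \<Rightarrow> 'r" and A b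
    by (induction A rule: infinite_finite_induct) (simp_all add: r0 r_add)
  obtain q where q: "\<And>t. f t = poly q t" using f unfolding polynomial_function_def by blast
  have "r (coeff q i) b = 0" for i b
  proof -
    define qb where "qb = map_poly (\<lambda>x. r x b) q"
    have cq: "coeff qb i = r (coeff q i) b" for i
      by (simp add: qb_def coeff_map_poly r0)
    have "poly qb t = 0" for t
    proof -
      have deg: "degree qb \<le> degree q" unfolding qb_def by (rule degree_map_poly_le)
      have "poly qb t = (\<Sum>i\<le>degree q. r (coeff q i) b * t ^ i)"
        unfolding poly_altdef cq[symmetric]
        by (rule sum.mono_neutral_left) (use deg in \<open>auto intro: coeff_eq_0\<close>)
      also have "\<dots> = (\<Sum>i\<le>degree q. r (\<phi> (t ^ i) * coeff q i) b)"
        by (rule sum.cong[OF refl], subst r_scale, rule mult.commute)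
      also have "\<dots> = r (\<Sum>i\<le>degree q. \<phi> (t ^ i) * coeff q i) b"
        by (rule r_sum[symmetric])
      also have "(\<Sum>i\<le>degree q. \<phi> (t ^ i) * coeff q i) = poly q (\<phi> t)"
        by (simp add: poly_altdef \<phi>.hom_power mult.commute)
      also have "\<dots> = 0" using van[of t] by (simp add: q)
      finally show ?thesis by (simp add: r0)
    qed
    then have "qb = 0" using poly_all_0_iff_0 by blast
    then show ?thesis using cq[of i] by simp
  qed
  then have "coeff q i = 0" for i
    using r_expand[of "coeff q i"] by simp
  then have "q = 0" by (simp add: poly_eq_iff)
  then show ?thesis by (simp add: q)
qed

text \<open>The line \<open>1 + t (x - 1)\<close> joins \<open>1\<close> to \<open>x\<close>, and \<open>det\<close> is not identically zero on it. So \<open>p\<close>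
  vanishes at all but finitely many of its points, hence at all of them.\<close>

lemma vanishing_ideal_GL_mat:
  fixes x :: "'k::field_char_0 mat"
  assumes p: "p \<in> vanishing_ideal n (carrier (GL n))" and x: "x \<in> carrier_mat n n"
  shows "entry_eval id p x = 0"
proof -
  have p': "p \<in> entry_polys n" using p by (simp add: vanishing_ideal_def)
  define M where "M t = mat n n (\<lambda>(i, j). (if i = j then 1 else 0) + t * (x $$ (i, j) - (if i = j then 1 else 0)))" for t
  have M: "M t \<in> carrier_mat n n" for t by (simp add: M_def)
  have ent: "polynomial_function (\<lambda>t. M t $$ (i, j))" if "i < n" "j < n" for i j
    using that
    by (auto simp: M_def intro!: polynomial_function_add polynomial_function_mult
        polynomial_function_const polynomial_function_ident)
  obtain q where q: "\<And>t. entry_eval id p (M t) = poly q t"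
    using polynomial_function_entry_eval[OF p', of M] ent unfolding polynomial_function_def by blast
  obtain d where d: "\<And>t. det (M t) = poly d t"
    using polynomial_function_det[OF M ent] unfolding polynomial_function_def by blast
  have "M 0 = 1\<^sub>m n" by (rule eq_matI) (auto simp: M_def)
  then have "poly d 0 = 1" using d[of 0] by simp
  then have d0: "d \<noteq> 0" by auto
  have "poly (q * d) t = 0" for t
  proof (cases "det (M t) = 0")
    case False
    then have "M t \<in> carrier (GL n)"
      using GL_I_det[OF M, of t "inverse (det (M t))"] by simp
    then have "entry_eval id p (M t) = 0" using p by (simp add: vanishing_ideal_def)
    then show ?thesis by (simp add: q)
  qed (simp add: d)
  then have "q = 0" using d0 poly_all_0_iff_0 by (metis mult_eq_0_iff)
  moreover have "M 1 = x" by (rule eq_matI) (use x in \<open>auto simp: M_def\<close>)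
  ultimately show ?thesis using q[of 1] by simp
qed

text \<open>A polynomial that vanishes on all matrices over \<open>k\<close> vanishes on all matrices over \<open>R\<close>: the
  entries are allowed to leave \<open>k\<close> one at a time, and \<open>T\<close> is the set of positions that have done so.\<close>

theorem points_general_linear:
  fixes \<phi> :: "'k::field_char_0 \<Rightarrow> 'r::comm_ring_1"
  assumes \<phi>: "comm_ring_hom \<phi>"
  shows "points \<phi> n (carrier (GL n)) = carrier (GL n)"
proof -
  interpret \<phi>: comm_ring_hom \<phi> by fact
  have "entry_eval \<phi> p g = 0"
    if p: "p \<in> vanishing_ideal n (carrier (GL n))" and g: "g \<in> carrier_mat n n" for p g
  proof -
    have p': "p \<in> entry_polys n" using p by (simp add: vanishing_ideal_def)
    have "\<forall>g \<in> carrier_mat n n. (\<forall>i<n. \<forall>j<n. (i, j) \<notin> T \<longrightarrow> g $$ (i, j) \<in> range \<phi>) \<longrightarrow>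
        entry_eval \<phi> p g = 0" if "finite T" for T
      using that
    proof (induction T rule: finite_induct)
      case empty
      show ?case
      proof (intro ballI impI)
        fix g assume g: "g \<in> carrier_mat n n"
          and "\<forall>i<n. \<forall>j<n. (i, j) \<notin> {} \<longrightarrow> g $$ (i, j) \<in> range \<phi>"
        then have "\<forall>i j. \<exists>y. i < n \<longrightarrow> j < n \<longrightarrow> g $$ (i, j) = \<phi> y" by auto
        then obtain Y where "\<And>i j. i < n \<Longrightarrow> j < n \<Longrightarrow> g $$ (i, j) = \<phi> (Y i j)" by metis
        then have "g = map_mat \<phi> (mat n n (\<lambda>(i, j). Y i j))"
          by (intro eq_matI) (use g in auto)
        then show "entry_eval \<phi> p g = 0"
          using \<phi>.entry_eval_hom[OF p', of "mat n n (\<lambda>(i, j). Y i j)" id]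
            vanishing_ideal_GL_mat[OF p, of "mat n n (\<lambda>(i, j). Y i j)"] by simp
      qed
    next
      case (insert ab T)
      obtain a b where ab: "ab = (a, b)" by (cases ab)
      show ?case
      proof (intro ballI impI)
        fix g assume g: "g \<in> carrier_mat n n"
          and r: "\<forall>i<n. \<forall>j<n. (i, j) \<notin> insert ab T \<longrightarrow> g $$ (i, j) \<in> range \<phi>"
        define M where "M t = mat n n (\<lambda>ij. if ij = ab then t else g $$ ij)" for t
        have "polynomial_function (\<lambda>t. M t $$ (i, j))" if "i < n" "j < n" for i j
        proof -
          have "M t $$ (i, j) = (if (i, j) = ab then t else g $$ (i, j))" for t
            using that by (simp add: M_def)
          then show ?thesis
            by (cases "(i, j) = ab")
              (simp_all add: polynomial_function_const polynomial_function_ident)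
        qed
        then have "polynomial_function (\<lambda>t. entry_eval \<phi> p (M t))"
          by (rule polynomial_function_entry_eval[OF p'])
        moreover have "entry_eval \<phi> p (M (\<phi> t)) = 0" for t
          using insert.IH[rule_format, of "M (\<phi> t)"] r by (auto simp: M_def)
        ultimately have "entry_eval \<phi> p (M (g $$ ab)) = 0"
          by (rule polynomial_vanishing_on_field[OF \<phi>])
        moreover have "M (g $$ ab) = g" by (rule eq_matI) (use g in \<open>auto simp: M_def\<close>)
        ultimately show "entry_eval \<phi> p g = 0" by simp
      qed
    qed
    from this[of "{..<n} \<times> {..<n}"] g show ?thesis by simp
  qed
  then show ?thesis by (auto simp: points_def GL_carrier_mat)
qed

lemma SL_subset_GL: "SL n \<subseteq> carrier (GL n)"
  by (auto simp: SL_def)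

text \<open>Dividing the first row by the determinant is a retraction \<open>s\<close> of \<open>GL\<^sub>n\<close> onto \<open>SL\<^sub>n\<close>. If
  \<open>p\<close> vanishes on \<open>SL\<^sub>n(k)\<close>, then \<open>p \<circ> s\<close> is regular and vanishes on \<open>GL\<^sub>n(k)\<close>, hence on
  \<open>GL\<^sub>n(R)\<close>.\<close>

theorem points_special_linear:
  fixes \<phi> :: "'k::field_char_0 \<Rightarrow> 'r::comm_ring_1"
  assumes \<phi>: "comm_ring_hom \<phi>"
  shows "points \<phi> n (SL n) = SL n"
proof (intro equalityI subsetI)
  interpret \<phi>: comm_ring_hom \<phi> by fact
  fix g assume g: "g \<in> points \<phi> n (SL n)"
  have "regular_function n (\<lambda>x::'r mat. det x - 1)"
    by (intro regular_function_diff regular_function_const regular_function_det[where m = n])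
      (auto simp: GL_carrier_mat regular_function_entry)
  from regular_function_vanishing[OF \<phi> this SL_subset_GL _ g] have "det g = 1"
    by (simp add: SL_def)
  then show "g \<in> SL n" using points_GL[OF g] by (simp add: SL_def)
next
  interpret \<phi>: comm_ring_hom \<phi> by fact
  fix g :: "'r mat" assume g: "g \<in> SL n"
  \<comment> \<open>The same formula over \<open>R\<close> and over \<open>k\<close>; a local definition cannot serve both.\<close>
  define s :: "'r mat \<Rightarrow> 'r mat"
    where "s x = mat n n (\<lambda>(i, j). if i = 0 then unit_inverse (det x) * x $$ (i, j) else x $$ (i, j))" for x
  define s' :: "'k mat \<Rightarrow> 'k mat"
    where "s' x = mat n n (\<lambda>(i, j). if i = 0 then unit_inverse (det x) * x $$ (i, j) else x $$ (i, j))" for x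
  have s'_SL: "s' x \<in> SL n" if x: "x \<in> carrier (GL n)" for x
  proof -
    have xm: "x \<in> carrier_mat n n" using x by (rule GL_carrier_mat)
    have "det (s' x) = 1"
    proof (cases "n = 0")
      case True
      then show ?thesis using det_dim_zero[of "s' x"] by (simp add: s'_def)
    next
      case False
      have "s' x = multrow 0 (unit_inverse (det x)) x"
        by (rule eq_matI) (use xm in \<open>auto simp: s'_def\<close>)
      then show ?thesis using det_multrow[of 0 n x "unit_inverse (det x)"] False xm GL_det_unit[OF x]
        by (simp add: mult.commute)
    qed
    then show ?thesis using GL_I_det[of "s' x" n 1] by (simp add: SL_def s'_def)
  qed
  show "g \<in> points \<phi> n (SL n)"
    unfolding points_def
  proof (intro CollectI conjI ballI)
    show gGL: "g \<in> carrier (GL n)" using g SL_subset_GL by blast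
    fix p :: "'k entry_poly" assume p: "p \<in> vanishing_ideal n (SL n)"
    then have p': "p \<in> entry_polys n" by (simp add: vanishing_ideal_def)
    have "entry_eval \<phi> p (s g) = 0"
    proof (rule regular_function_vanishing[OF \<phi> _ order_refl,
          where F = "\<lambda>x. entry_eval \<phi> p (s x)" and n = n and h = g])
      show "g \<in> points \<phi> n (carrier (GL n))" using gGL points_general_linear[OF \<phi>] by blast
      show "regular_function n (\<lambda>x. entry_eval \<phi> p (s x))"
      proof (rule regular_function_entry_eval[OF p'])
        show "regular_function n (\<lambda>x. s x $$ (i, j))" if "i < n" "j < n" for i j
          using that by (cases "i = 0")
            (simp_all add: s_def regular_function_mult regular_function_unit_inverse_det
              regular_function_entry)
      qed
      fix y :: "'k mat" assume y: "y \<in> carrier (GL n)"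
      have "s (map_mat \<phi> y) = map_mat \<phi> (s' y)"
        using GL_carrier_mat[OF y]
        by (intro eq_matI)
          (auto simp: s_def s'_def \<phi>.hom_mult \<phi>.unit_inverse_det_hom[OF y] simp del: \<phi>.hom_det)
      then show "entry_eval \<phi> p (s (map_mat \<phi> y)) = 0"
        using \<phi>.entry_eval_hom[OF p', of "s' y" id] s'_SL[OF y] p
        by (simp add: vanishing_ideal_def s'_def)
    qed
    moreover have "s g = g"
      by (rule eq_matI) (use g GL_carrier_mat[OF gGL] in \<open>auto simp: s_def SL_def\<close>)
    ultimately show "entry_eval \<phi> p g = 0" by simp
  qed
qed

lemma lie_algebra_general_linear:
  "lie_algebra n (carrier (GL n)) = (carrier_mat n n :: 'k::field_char_0 mat set)"
  using one_plus_eps_GL unfolding lie_algebra_def points_general_linear[OF comm_ring_hom_dual_const]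
  by blast

lemma lie_algebra_special_linear:
  "lie_algebra n (SL n) = {X :: 'k::field_char_0 mat. X \<in> carrier_mat n n \<and> (\<Sum>i<n. X $$ (i, i)) = 0}"
  unfolding lie_algebra_def points_special_linear[OF comm_ring_hom_dual_const]
  by (auto simp: SL_def one_plus_eps_GL det_one_plus_eps one_dual_def)

section \<open>Modules over the power series ring\<close>

text \<open>Membership in \<open>z\<^sup>j \<O>\<close>, zero included.\<close>

definition vanishes_below :: "int \<Rightarrow> 'k::field fls \<Rightarrow> bool" where
  "vanishes_below j x \<longleftrightarrow> (\<forall>k<j. fls_nth x k = 0)"

lemma vanishes_below_iff: "vanishes_below j x \<longleftrightarrow> x = 0 \<or> j \<le> fls_subdegree x"
  unfolding vanishes_below_def by (auto intro: fls_subdegree_geI)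

lemma power_series_iff: "x \<in> power_series \<longleftrightarrow> vanishes_below 0 x"
proof
  assume "x \<in> power_series"
  then show "vanishes_below 0 x" by (auto simp: power_series_def vanishes_below_def)
next
  assume "vanishes_below 0 x"
  then have "fps_to_fls (fls_regpart x) = x"
    by (intro fls_regpart_to_fls_trivial) (auto simp: vanishes_below_iff)
  then show "x \<in> power_series" unfolding power_series_def by (metis rangeI)
qed

lemma vanishes_below_0 [simp]: "vanishes_below j 0"
  by (simp add: vanishes_below_def)

lemma vanishes_below_1 [simp]: "vanishes_below 0 1"
  by (simp add: vanishes_below_def)

lemma vanishes_below_const [simp]: "vanishes_below 0 (fls_const c)"
  by (simp add: vanishes_below_def)

lemma vanishes_below_X [simp]: "vanishes_below 0 fls_X"
  by (simp add: vanishes_below_def)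

lemma vanishes_below_add: "vanishes_below j x \<Longrightarrow> vanishes_below j y \<Longrightarrow> vanishes_below j (x + y)"
  by (simp add: vanishes_below_def)

lemma vanishes_below_uminus: "vanishes_below j x \<Longrightarrow> vanishes_below j (- x)"
  by (simp add: vanishes_below_def)

lemma vanishes_below_diff: "vanishes_below j x \<Longrightarrow> vanishes_below j y \<Longrightarrow> vanishes_below j (x - y)"
  by (simp add: vanishes_below_def)

lemma vanishes_below_sum:
  "(\<And>a. a \<in> A \<Longrightarrow> vanishes_below j (f a)) \<Longrightarrow> vanishes_below j (\<Sum>a\<in>A. f a)"
  by (induction A rule: infinite_finite_induct) (auto intro: vanishes_below_add)

lemma vanishes_below_mult:
  "vanishes_below i x \<Longrightarrow> vanishes_below j y \<Longrightarrow> vanishes_below (i + j) (x * y)"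
  by (cases "x = 0 \<or> y = 0") (auto simp: vanishes_below_iff)

lemma vanishes_below_scale: "vanishes_below 0 x \<Longrightarrow> vanishes_below j y \<Longrightarrow> vanishes_below j (x * y)"
  using vanishes_below_mult[of 0 x j y] by simp

lemma zd_nth: "fls_nth (zd x) k = of_int k * fls_nth x k"
  by (simp add: derivation_def fls_X_times_conv_shift)

lemma vanishes_below_zd: "vanishes_below j x \<Longrightarrow> vanishes_below j (zd x)"
  by (simp add: vanishes_below_def zd_nth)

lemma vanishes_below_mono: "vanishes_below j x \<Longrightarrow> i \<le> j \<Longrightarrow> vanishes_below i x"
  by (simp add: vanishes_below_def)

lemma common_pole_bound:
  assumes "finite A"
  obtains j where "\<And>x. x \<in> A \<Longrightarrow> vanishes_below j x"
proof -
  have "\<exists>j. \<forall>x\<in>A. vanishes_below j x" using assms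
  proof (induction A rule: finite_induct)
    case (insert a A)
    then obtain j where "\<forall>x\<in>A. vanishes_below j x" by blast
    then have "\<forall>x\<in>insert a A. vanishes_below (min j (fls_subdegree a)) x"
      by (auto intro: vanishes_below_mono simp: vanishes_below_iff)
    then show ?case by blast
  qed simp
  then show ?thesis using that by blast
qed

lemma mult_mat_vec_entry:
  assumes "M \<in> carrier_mat n m" "v \<in> carrier_vec m" "i < n"
  shows "(M *\<^sub>v v) $ i = (\<Sum>l<m. M $$ (i, l) * v $ l)"
  using assms by (auto simp: scalar_prod_def atLeast0LessThan intro!: sum.cong)

definition power_series_module :: "nat \<Rightarrow> 'k::field fls vec set \<Rightarrow> bool" where
  "power_series_module m N \<longleftrightarrow> N \<subseteq> carrier_vec m \<and> 0\<^sub>v m \<in> N \<and>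
     (\<forall>v \<in> N. \<forall>w \<in> N. v + w \<in> N) \<and> (\<forall>c v. vanishes_below 0 c \<longrightarrow> v \<in> N \<longrightarrow> c \<cdot>\<^sub>v v \<in> N)"

lemma submodule_power_series_iff:
  "submodule N power_series_ring (module_vec TYPE('k::field fls) m) \<longleftrightarrow> power_series_module m N"
proof -
  let ?M = "module_vec TYPE('k fls) m"
  have grp: "Group.group (add_monoid ?M)"
  proof (rule groupI)
    fix x assume "x \<in> carrier (add_monoid ?M)"
    then show "\<exists>y\<in>carrier (add_monoid ?M). y \<otimes>\<^bsub>add_monoid ?M\<^esub> x = \<one>\<^bsub>add_monoid ?M\<^esub>"
      by (intro bexI[of _ "- x"]) (auto simp: module_vec_simps)
  qed (auto simp: module_vec_simps)
  have inv: "inv\<^bsub>add_monoid ?M\<^esub> x = (-1) \<cdot>\<^sub>v x" if "x \<in> carrier_vec m" for x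
    by (rule group.inv_equality[OF grp]) (use that in \<open>auto simp: module_vec_simps\<close>)
  show ?thesis
  proof
    assume "submodule N power_series_ring ?M"
    then show "power_series_module m N"
      unfolding submodule_def submodule_axioms_def subgroup_def power_series_module_def
      by (auto simp: module_vec_simps power_series_ring_def power_series_iff)
  next
    assume N: "power_series_module m N"
    have "inv\<^bsub>add_monoid ?M\<^esub> x \<in> N" if "x \<in> N" for x
    proof -
      have "(-1) \<cdot>\<^sub>v x \<in> N" "x \<in> carrier_vec m"
        using N that vanishes_below_uminus[of 0 1] by (auto simp: power_series_module_def)
      then show ?thesis by (simp only: inv)
    qed
    then have "subgroup N (add_monoid ?M)"
      by (intro subgroup.intro) (use N in \<open>auto simp: power_series_module_def module_vec_simps\<close>)
    then show "submodule N power_series_ring ?M"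
      unfolding submodule_def submodule_axioms_def using N
      by (auto simp: module_vec_simps power_series_ring_def power_series_iff power_series_module_def)
  qed
qed

lemma module_neg_diff:
  assumes "power_series_module m N" "v \<in> N" "w \<in> N" "vanishes_below 0 c"
  shows "v - c \<cdot>\<^sub>v w \<in> N"
proof -
  have "v + (- c) \<cdot>\<^sub>v w \<in> N"
    using assms vanishes_below_uminus unfolding power_series_module_def by blast
  moreover have "v + (- c) \<cdot>\<^sub>v w = v - c \<cdot>\<^sub>v w"
    using assms unfolding power_series_module_def by (intro eq_vecI) auto
  ultimately show ?thesis by simp
qed

lemma module_combination:
  assumes N: "power_series_module m N" and Q: "Q \<in> carrier_mat m r"
    and cols: "\<And>i. i < r \<Longrightarrow> col Q i \<in> N"
    and c: "c \<in> carrier_vec r" "\<And>i. i < r \<Longrightarrow> vanishes_below 0 (c $ i)"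
  shows "Q *\<^sub>v c \<in> N"
proof -
  have "vec m (\<lambda>l. \<Sum>i<k. Q $$ (l, i) * c $ i) \<in> N" if "k \<le> r" for k
    using that
  proof (induction k)
    case 0
    have "vec m (\<lambda>l. \<Sum>i<0. Q $$ (l, i) * c $ i) = 0\<^sub>v m" by (intro eq_vecI) auto
    then show ?case using N by (simp add: power_series_module_def)
  next
    case (Suc k)
    have "vec m (\<lambda>l. \<Sum>i<Suc k. Q $$ (l, i) * c $ i) =
        vec m (\<lambda>l. \<Sum>i<k. Q $$ (l, i) * c $ i) + c $ k \<cdot>\<^sub>v col Q k"
      using Q Suc.prems by (intro eq_vecI) auto
    then show ?case using N Suc cols[of k] c by (simp add: power_series_module_def)
  qed
  from this[of r] have "vec m (\<lambda>l. \<Sum>i<r. Q $$ (l, i) * c $ i) \<in> N" by simp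
  moreover have "Q *\<^sub>v c = vec m (\<lambda>l. \<Sum>i<r. Q $$ (l, i) * c $ i)"
    using Q c by (intro eq_vecI) (auto simp: mult_mat_vec_entry[of _ m r] simp del: index_mult_mat_vec)
  ultimately show ?thesis by simp
qed

text \<open>Among the vectors of \<open>N\<close> whose first \<open>i\<close> coordinates vanish, let \<open>b\<^sub>i\<close> have an \<open>i\<close>-th coordinate
  of smallest order; the bound on the poles makes the minimum exist. Since \<open>\<O>\<close> is a valuation ring, the
  \<open>i\<close>-th coordinate of any other such vector is an \<open>\<O>\<close>-multiple of that of \<open>b\<^sub>i\<close>, and elimination
  shows that the \<open>b\<^sub>i\<close> generate \<open>N\<close>. Some \<open>b\<^sub>i\<close> are \<open>0\<close> when \<open>N\<close> does not span \<open>K\<^sup>m\<close>.\<close>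

lemma triangular_generators:
  fixes N :: "'k::field fls vec set"
  assumes N: "power_series_module m N"
    and bound: "\<And>v i. v \<in> N \<Longrightarrow> i < m \<Longrightarrow> vanishes_below j (v $ i)"
  obtains Q where "Q \<in> carrier_mat m m" "\<And>i. i < m \<Longrightarrow> col Q i \<in> N"
    "\<And>l i. l < i \<Longrightarrow> i < m \<Longrightarrow> Q $$ (l, i) = 0"
    "\<And>v. v \<in> N \<Longrightarrow> \<exists>c \<in> carrier_vec m. (\<forall>i<m. vanishes_below 0 (c $ i)) \<and> v = Q *\<^sub>v c"
proof -
  define F where "F i = {v \<in> N. \<forall>l<i. v $ l = 0}" for i
  have car: "v \<in> carrier_vec m" if "v \<in> N" for v
    using N that by (auto simp: power_series_module_def)
  have "\<exists>b \<in> F i. \<forall>v \<in> F i. \<exists>c. vanishes_below 0 c \<and> v $ i = c * b $ i" if i: "i < m" for i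
  proof (cases "\<exists>v \<in> F i. v $ i \<noteq> 0")
    case False
    moreover have "0\<^sub>v m \<in> F i" using N i by (auto simp: F_def power_series_module_def)
    ultimately show ?thesis by (intro bexI[of _ "0\<^sub>v m"]) (auto intro: exI[of _ 0])
  next
    case True
    then obtain v0 where v0: "v0 \<in> F i" "v0 $ i \<noteq> 0" by blast
    \<comment> \<open>The shift by \<open>j\<close> makes the orders natural numbers.\<close>
    define h where "h v = nat (fls_subdegree (v $ i) - j)" for v :: "'k fls vec"
    obtain b where b: "b \<in> F i" "b $ i \<noteq> 0" and min: "\<And>v. v \<in> F i \<Longrightarrow> v $ i \<noteq> 0 \<Longrightarrow> h b \<le> h v"
      using v0
        ex_has_least_nat[of "\<lambda>v. v \<in> F i \<and> v $ i \<noteq> 0" v0 h] by blast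
    show ?thesis
    proof (intro bexI[of _ b] ballI)
      fix v assume v: "v \<in> F i"
      show "\<exists>c. vanishes_below 0 c \<and> v $ i = c * b $ i"
      proof (cases "v $ i = 0")
        case False
        have "j \<le> fls_subdegree (b $ i)" "j \<le> fls_subdegree (v $ i)"
          using bound[of b i] bound[of v i] b v False i by (auto simp: F_def vanishes_below_iff)
        then have "fls_subdegree (b $ i) \<le> fls_subdegree (v $ i)"
          using min[OF v False] by (simp add: h_def)
        then have "vanishes_below 0 (v $ i * inverse (b $ i))"
          using False b by (auto simp: vanishes_below_iff)
        then show ?thesis using b by (intro exI[of _ "v $ i * inverse (b $ i)"]) simp
      qed (auto intro: exI[of _ 0])
    qed (rule b)
  qed
  then obtain b where b: "\<And>i. i < m \<Longrightarrow> b i \<in> F i"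
    "\<And>i v. i < m \<Longrightarrow> v \<in> F i \<Longrightarrow> \<exists>c. vanishes_below 0 c \<and> v $ i = c * b i $ i"
    by metis
  define Q where "Q = mat m m (\<lambda>(l, i). b i $ l)"
  have Q: "Q \<in> carrier_mat m m" by (simp add: Q_def)
  have bN: "b i \<in> N" "b i \<in> carrier_vec m" if "i < m" for i
    using b(1)[OF that] car by (auto simp: F_def)
  have colQ: "col Q i = b i" if "i < m" for i
    using bN(2)[OF that] that by (intro eq_vecI) (auto simp: Q_def)
  have gen: "\<exists>c \<in> carrier_vec m. (\<forall>i<m. vanishes_below 0 (c $ i)) \<and> v = Q *\<^sub>v c"
    if "k \<le> m" "v \<in> F (m - k)" for k v
    using that
  proof (induction k arbitrary: v)
    case 0
    then have "v = 0\<^sub>v m" using car[of v] by (intro eq_vecI) (auto simp: F_def)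
    then show ?case using Q by (intro bexI[of _ "0\<^sub>v m"]) auto
  next
    case (Suc k)
    define i where "i = m - Suc k"
    have i: "i < m" "m - k = Suc i" using Suc.prems(1) by (auto simp: i_def)
    have v: "v \<in> F i" using Suc.prems by (simp add: i_def)
    obtain a where a: "vanishes_below 0 a" "v $ i = a * b i $ i" using b(2)[OF i(1) v] by blast
    have vm: "v \<in> carrier_vec m" using v car by (auto simp: F_def)
    have "v - a \<cdot>\<^sub>v b i \<in> N"
      by (rule module_neg_diff[OF N _ bN(1)[OF i(1)] a(1)]) (use v in \<open>simp add: F_def\<close>)
    moreover have "(v - a \<cdot>\<^sub>v b i) $ l = 0" if "l < Suc i" for l
      using that v b(1)[OF i(1)] bN(2)[OF i(1)] vm a(2) i by (cases "l = i") (auto simp: F_def)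
    ultimately have "v - a \<cdot>\<^sub>v b i \<in> F (m - k)" by (simp add: F_def i(2))
    then obtain c where c: "c \<in> carrier_vec m" "\<forall>i<m. vanishes_below 0 (c $ i)"
      "v - a \<cdot>\<^sub>v b i = Q *\<^sub>v c" using Suc.IH Suc.prems(1) by (meson Suc_leD)
    show ?case
    proof (intro bexI[of _ "c + a \<cdot>\<^sub>v unit_vec m i"] conjI allI impI)
      have "Q *\<^sub>v (c + a \<cdot>\<^sub>v unit_vec m i) = Q *\<^sub>v c + a \<cdot>\<^sub>v (Q *\<^sub>v unit_vec m i)"
        using c Q by (simp add: mult_add_distrib_mat_vec[of _ m m] mult_mat_vec[of _ m m])
      also have "Q *\<^sub>v unit_vec m i = b i"
        using Q i bN(2)[OF i(1)] by (intro eq_vecI) (auto simp: Q_def)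
      finally show "v = Q *\<^sub>v (c + a \<cdot>\<^sub>v unit_vec m i)"
        using c(3)[symmetric] vm bN(2)[OF i(1)] by (auto intro!: eq_vecI)
      fix l assume "l < m"
      then show "vanishes_below 0 ((c + a \<cdot>\<^sub>v unit_vec m i) $ l)"
        using c a i by (auto intro!: vanishes_below_add simp: unit_vec_def)
    qed (use c in simp)
  qed
  show ?thesis
  proof (rule that[OF Q])
    show "col Q i \<in> N" if "i < m" for i using that by (simp add: colQ bN)
    show "Q $$ (l, i) = 0" if "l < i" "i < m" for l i
      using that b(1)[of i] by (simp add: Q_def F_def)
    show "\<exists>c \<in> carrier_vec m. (\<forall>i<m. vanishes_below 0 (c $ i)) \<and> v = Q *\<^sub>v c" if "v \<in> N" for v
      using gen[of m v] that by (simp add: F_def)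
  qed
qed

lemma power_series_module_Inter:
  assumes "\<A> \<noteq> {}" "\<And>N. N \<in> \<A> \<Longrightarrow> power_series_module m N"
  shows "power_series_module m (\<Inter>\<A>)"
  using assms unfolding power_series_module_def by blast

lemma bounded_imp_finitely_generated:
  fixes N :: "'k::field fls vec set"
  assumes N: "power_series_module m N"
    and bound: "\<And>v i. v \<in> N \<Longrightarrow> i < m \<Longrightarrow> vanishes_below j (v $ i)"
  shows "finitely_generated_power_series (module_vec TYPE('k fls) m) N"
proof -
  obtain Q where Q: "Q \<in> carrier_mat m m" "\<And>i. i < m \<Longrightarrow> col Q i \<in> N"
    "\<And>v. v \<in> N \<Longrightarrow> \<exists>c \<in> carrier_vec m. (\<forall>i<m. vanishes_below 0 (c $ i)) \<and> v = Q *\<^sub>v c"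
    using triangular_generators[OF N bound] by metis
  have "N = \<Inter>{N'. power_series_module m N' \<and> col Q ` {..<m} \<subseteq> N'}"
  proof (intro equalityI subsetI)
    fix v assume "v \<in> N"
    then obtain c where c: "c \<in> carrier_vec m" "\<forall>i<m. vanishes_below 0 (c $ i)" "v = Q *\<^sub>v c"
      using Q(3) by blast
    show "v \<in> \<Inter>{N'. power_series_module m N' \<and> col Q ` {..<m} \<subseteq> N'}"
      unfolding c(3) using module_combination[OF _ Q(1) _ c(1)] c(2) by blast
  next
    fix v assume "v \<in> \<Inter>{N'. power_series_module m N' \<and> col Q ` {..<m} \<subseteq> N'}"
    then show "v \<in> N" using N Q(2) by blast
  qed
  then show ?thesis unfolding finitely_generated_power_series_def submodule_power_series_iff
    using Q(1) by (intro exI[of _ "col Q ` {..<m}"]) (auto simp: module_vec_simps)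
qed

lemma finitely_generated_imp_bounded:
  fixes N :: "'k::field fls vec set"
  assumes "finitely_generated_power_series (module_vec TYPE('k fls) m) N"
  obtains j where "\<And>v i. v \<in> N \<Longrightarrow> i < m \<Longrightarrow> vanishes_below j (v $ i)"
proof -
  obtain S where S: "S \<subseteq> carrier_vec m" "finite S"
    "N = \<Inter>{N'. power_series_module m N' \<and> S \<subseteq> N'}"
    using assms unfolding finitely_generated_power_series_def submodule_power_series_iff
    by (auto simp: module_vec_simps)
  obtain j where j: "\<And>x. x \<in> (\<lambda>(v, i). v $ i) ` (S \<times> {..<m}) \<Longrightarrow> vanishes_below j x"
    using common_pole_bound[of "(\<lambda>(v, i). v $ i) ` (S \<times> {..<m})"] S(2) by auto
  let ?L = "{v \<in> carrier_vec m. \<forall>i<m. vanishes_below j (v $ i)}"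
  have "power_series_module m ?L"
    by (auto simp: power_series_module_def vanishes_below_add vanishes_below_scale)
  moreover have "S \<subseteq> ?L" using S(1) j by force
  ultimately have "N \<subseteq> ?L" unfolding S(3) by blast
  then show ?thesis using that by blast
qed

section \<open>The modules generated by a vector\<close>

text \<open>The action of \<open>z d/dz\<close> on \<open>K\<^sup>m\<close> for the connection \<open>M\<close>.\<close>

definition nabla :: "'k::field fls mat \<Rightarrow> 'k fls vec \<Rightarrow> 'k fls vec" where
  "nabla M w = map_vec zd w - M *\<^sub>v w"

text \<open>The module \<open>E(v)\<close>: as \<open>D\<^sub>0\<close> is generated over \<open>\<O>\<close> by \<open>z d/dz\<close>, stability under
  \<open>nabla M\<close> is enough.\<close>

definition stable_hull :: "nat \<Rightarrow> 'k::field fls mat \<Rightarrow> 'k fls vec \<Rightarrow> 'k fls vec set" where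
  "stable_hull m M v =
    \<Inter>{N. power_series_module m N \<and> v \<in> N \<and> (\<forall>w \<in> N. nabla M w \<in> N)}"

lemma lie_rep_carrier: "lie_rep \<phi> n m P N X \<in> carrier_mat m m"
  by (simp add: lie_rep_def)

lemma nabla_carrier: "M \<in> carrier_mat m m \<Longrightarrow> w \<in> carrier_vec m \<Longrightarrow> nabla M w \<in> carrier_vec m"
  by (auto simp: nabla_def)

lemma power_series_module_carrier: "power_series_module m (carrier_vec m)"
  by (auto simp: power_series_module_def)

lemma stable_hull:
  assumes "M \<in> carrier_mat m m" "v \<in> carrier_vec m"
  shows "power_series_module m (stable_hull m M v)" "v \<in> stable_hull m M v"
    "\<And>w. w \<in> stable_hull m M v \<Longrightarrow> nabla M w \<in> stable_hull m M v"
proof -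
  have "carrier_vec m \<in> {N. power_series_module m N \<and> v \<in> N \<and> (\<forall>w \<in> N. nabla M w \<in> N)}"
    using assms nabla_carrier power_series_module_carrier by blast
  then show "power_series_module m (stable_hull m M v)"
    unfolding stable_hull_def by (intro power_series_module_Inter) auto
qed (auto simp: stable_hull_def)

lemma stable_hull_least:
  "power_series_module m N \<Longrightarrow> v \<in> N \<Longrightarrow> (\<And>w. w \<in> N \<Longrightarrow> nabla M w \<in> N) \<Longrightarrow> stable_hull m M v \<subseteq> N"
  unfolding stable_hull_def by blast

lemma connection_action_nabla:
  assumes A: "A \<in> carrier_mat n n" and P: "\<forall>i<m. \<forall>j<m. P i j \<in> entry_polys n"
    and w: "w \<in> carrier_vec m"
  shows "connection_action (\<lambda>d. lie_rep fls_const n m P N (connection_at A d)) d w =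
    (d * fls_X_inv) \<cdot>\<^sub>v nabla (lie_rep fls_const n m P N A) w"
proof -
  interpret c: comm_ring_hom "fls_const :: 'a \<Rightarrow> 'a fls" by (rule comm_ring_hom_fls_const)
  have L: "lie_rep fls_const n m P N A \<in> carrier_mat m m" by (simp add: lie_rep_def)
  have "lie_rep fls_const n m P N (connection_at A d) = (d * fls_X_inv) \<cdot>\<^sub>m lie_rep fls_const n m P N A"
    unfolding connection_at_def by (rule c.lie_rep_extension(2)[OF P A A zero_carrier_mat])
  then show ?thesis
    using L w unfolding connection_action_def nabla_def
    by (intro eq_vecI) (auto simp: derivation_eq_zd[of d] algebra_simps)
qed

lemma E_hull_stable_hull:
  fixes A :: "'k::field fls mat"
  assumes A: "A \<in> carrier_mat n n" and P: "\<forall>i<m. \<forall>j<m. P i j \<in> entry_polys n"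
  shows "E_hull (module_vec TYPE('k fls) m)
      (connection_action (\<lambda>d. lie_rep fls_const n m P N (connection_at A d))) v =
    stable_hull m (lie_rep fls_const n m P N A) v"
proof -
  let ?act = "connection_action (\<lambda>d. lie_rep fls_const n m P N (connection_at A d))"
  let ?M = "lie_rep fls_const n m P N A"
  have XX: "(fls_X :: 'k fls) * fls_X_inv = 1"
    by (metis fls_X_nonzero fls_inverse_X right_inverse)
  have "(\<forall>d \<in> D0. \<forall>w \<in> N'. ?act d w \<in> N') \<longleftrightarrow> (\<forall>w \<in> N'. nabla ?M w \<in> N')"
    if N': "power_series_module m N'" for N'
  proof
    have sub: "w \<in> carrier_vec m" if "w \<in> N'" for w
      using that N' by (auto simp: power_series_module_def)
    assume L: "\<forall>d \<in> D0. \<forall>w \<in> N'. ?act d w \<in> N'"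
    have X: "fls_X \<in> (D0 :: 'k fls set)"
      unfolding D0_def by (intro CollectI exI[of _ 1]) (simp add: power_series_iff)
    show "\<forall>w \<in> N'. nabla ?M w \<in> N'"
    proof
      fix w assume w: "w \<in> N'"
      then have "?act fls_X w = nabla ?M w"
        using connection_action_nabla[OF A P sub[OF w], of N fls_X] XX by simp
      then show "nabla ?M w \<in> N'" using L X w by metis
    qed
  next
    assume R: "\<forall>w \<in> N'. nabla ?M w \<in> N'"
    show "\<forall>d \<in> D0. \<forall>w \<in> N'. ?act d w \<in> N'"
    proof (intro ballI)
      fix d :: "'k fls" and w assume d: "d \<in> D0" and w: "w \<in> N'"
      obtain h where h: "d = h * fls_X" "vanishes_below 0 h"
        using d by (auto simp: D0_def power_series_iff)
      have "w \<in> carrier_vec m" using w N' by (auto simp: power_series_module_def)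
      then have "?act d w = h \<cdot>\<^sub>v nabla ?M w"
        using connection_action_nabla[OF A P, of w N d] by (simp add: h mult.assoc XX)
      then show "?act d w \<in> N'" using R w h(2) N' by (simp add: power_series_module_def)
    qed
  qed
  then show ?thesis
    unfolding E_hull_def stable_hull_def submodule_power_series_iff by (intro arg_cong[of _ _ Inter]) blast
qed

lemma connection_carrier: "A \<in> connections n G \<Longrightarrow> A \<in> carrier_mat n n"
  by (auto simp: connections_def lie_algebra_tensor_def)

lemma Fuchsian_D_module_iff:
  fixes A :: "'k::field fls mat"
  assumes A: "A \<in> connections n G" and r: "rational_representation n G m P N"
  shows "Fuchsian_D_module (module_vec TYPE('k fls) m)
      (connection_action (\<lambda>d. lie_rep fls_const n m P N (connection_at A d))) \<longleftrightarrow>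
    (\<forall>v \<in> carrier_vec m. finitely_generated_power_series (module_vec TYPE('k fls) m)
      (stable_hull m (lie_rep fls_const n m P N A) v))"
proof -
  have "\<forall>i<m. \<forall>j<m. P i j \<in> entry_polys n" using r by (simp add: rational_representation_def)
  then show ?thesis
    unfolding Fuchsian_D_module_def
    using connection_action_lie_rep_D_module[OF A r] connection_carrier[OF A]
    by (simp add: E_hull_stable_hull module_vec_simps)
qed

definition integral_mat :: "nat \<Rightarrow> 'k::field fls mat \<Rightarrow> bool" where
  "integral_mat n C \<longleftrightarrow> C \<in> carrier_mat n n \<and> (\<forall>i<n. \<forall>j<n. vanishes_below 0 (C $$ (i, j)))"

lemma zd_mat_vec:
  assumes "M \<in> carrier_mat n m" "v \<in> carrier_vec m"
  shows "map_vec zd (M *\<^sub>v v) = map_mat zd M *\<^sub>v v + M *\<^sub>v map_vec zd v"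
  using assms
  by (intro eq_vecI)
    (auto simp: mult_mat_vec_entry[of _ n m] zd_sum zd_mult sum.distrib add.commute
      simp del: index_mult_mat_vec)

text \<open>By the equation, \<open>R\<close> carries \<open>nabla M\<close> to \<open>nabla C\<close>, which preserves \<open>z\<^sup>j \<O>\<^sup>m\<close> because
  \<open>C\<close> has entries in \<open>\<O>\<close>. So the preimage \<open>L\<close> of \<open>z\<^sup>j \<O>\<^sup>m\<close> under \<open>R\<close> is stable, for a
  \<open>j\<close> with \<open>v \<in> L\<close>.\<close>

lemma stable_hull_finitely_generated:
  fixes M :: "'k::field fls mat"
  assumes R: "R \<in> carrier (GL m)" and M: "M \<in> carrier_mat m m" and C: "integral_mat m C"
    and eq: "C * R = R * M + map_mat zd R" and v: "v \<in> carrier_vec m"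
  shows "finitely_generated_power_series (module_vec TYPE('k fls) m) (stable_hull m M v)"
proof -
  have Rm: "R \<in> carrier_mat m m" using R by (rule GL_carrier_mat)
  have Cm: "C \<in> carrier_mat m m" using C by (simp add: integral_mat_def)
  note Ri = GL_inv_mat[OF R]
  have "finite ((\<lambda>i. (R *\<^sub>v v) $ i) ` {..<m})" by simp
  then obtain j where j: "\<And>x. x \<in> (\<lambda>i. (R *\<^sub>v v) $ i) ` {..<m} \<Longrightarrow> vanishes_below j x"
    using common_pole_bound by blast
  define L where "L = {w \<in> carrier_vec m. \<forall>i<m. vanishes_below j ((R *\<^sub>v w) $ i)}"
  have "power_series_module m L"
    unfolding power_series_module_def L_def using Rm
    by (auto simp: mult_add_distrib_mat_vec[of _ m m] mult_mat_vec[of _ m m]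
        intro!: vanishes_below_add vanishes_below_scale simp del: index_mult_mat_vec)
      (auto simp: mult_mat_vec_entry[of _ m m] simp del: index_mult_mat_vec)
  moreover have "v \<in> L" using v j by (auto simp: L_def)
  moreover have "nabla M w \<in> L" if w: "w \<in> L" for w
  proof -
    have wm: "w \<in> carrier_vec m" using w by (simp add: L_def)
    have "C *\<^sub>v (R *\<^sub>v w) = (C * R) *\<^sub>v w"
      using Cm Rm wm by (simp add: assoc_mult_mat_vec[of _ m m _ m])
    also have "\<dots> = R *\<^sub>v (M *\<^sub>v w) + map_mat zd R *\<^sub>v w"
      using Rm M wm
      by (simp add: eq add_mult_distrib_mat_vec[of _ m m] assoc_mult_mat_vec[of _ m m _ m])
    finally have *: "R *\<^sub>v nabla M w = map_vec zd (R *\<^sub>v w) - C *\<^sub>v (R *\<^sub>v w)"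
      unfolding nabla_def using Rm M wm
      by (simp add: mult_minus_distrib_mat_vec[of _ m m] zd_mat_vec[of _ m m])
        (auto intro!: eq_vecI)
    have "vanishes_below j ((C *\<^sub>v (R *\<^sub>v w)) $ i)" if "i < m" for i
      using that Cm Rm wm w C
      by (subst mult_mat_vec_entry[of _ m m])
        (auto simp: L_def integral_mat_def intro!: vanishes_below_sum vanishes_below_scale
          simp del: index_mult_mat_vec)
    then have "vanishes_below j ((R *\<^sub>v nabla M w) $ i)" if "i < m" for i
      using that w Rm Cm unfolding *
      by (auto simp: L_def intro!: vanishes_below_diff vanishes_below_zd simp del: index_mult_mat_vec
          simp: dim_mult_mat_vec)
    then show ?thesis using nabla_carrier[OF M wm] by (simp add: L_def)
  qed
  ultimately have sub: "stable_hull m M v \<subseteq> L" by (rule stable_hull_least)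
  have "finite ((\<lambda>(i, l). (inv\<^bsub>GL m\<^esub> R) $$ (i, l)) ` ({..<m} \<times> {..<m}))" by simp
  then obtain j' where j': "\<And>x. x \<in> (\<lambda>(i, l). (inv\<^bsub>GL m\<^esub> R) $$ (i, l)) ` ({..<m} \<times> {..<m}) \<Longrightarrow> vanishes_below j' x"
    using common_pole_bound by blast
  show ?thesis
  proof (rule bounded_imp_finitely_generated[OF stable_hull(1)[OF M v]])
    fix w i assume "w \<in> stable_hull m M v" and i: "i < m"
    then have w: "w \<in> L" using sub by blast
    then have wm: "w \<in> carrier_vec m" by (simp add: L_def)
    have "w = inv\<^bsub>GL m\<^esub> R *\<^sub>v (R *\<^sub>v w)"
      using Ri Rm wm by (simp add: assoc_mult_mat_vec[of _ m m _ m, symmetric])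
    moreover have "vanishes_below (j' + j) ((inv\<^bsub>GL m\<^esub> R *\<^sub>v (R *\<^sub>v w)) $ i)"
      using i Ri(1) Rm wm w j'
      by (subst mult_mat_vec_entry[of _ m m])
        (auto simp: L_def intro!: vanishes_below_sum vanishes_below_mult simp del: index_mult_mat_vec)
    ultimately show "vanishes_below (j' + j) (w $ i)" by simp
  qed
qed

section \<open>Regular connections are Fuchsian\<close>

lemma integral_tensor: "B \<in> lie_algebra_tensor n G power_series \<Longrightarrow> integral_mat n B"
  by (auto simp: lie_algebra_tensor_def integral_mat_def power_series_iff mult.commute[of _ "fls_const _"]
      intro!: vanishes_below_sum vanishes_below_scale)

lemma integral_lie_rep:
  fixes B :: "'k::field fls mat"
  assumes P: "\<forall>i<m. \<forall>j<m. P i j \<in> entry_polys n" and B: "integral_mat n B"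
  shows "integral_mat m (lie_rep fls_const n m P N B)"
proof -
  interpret c: comm_ring_hom "fls_const :: 'k \<Rightarrow> 'k fls" by (rule comm_ring_hom_fls_const)
  obtain C where "\<And>Y. lie_rep fls_const n m P N Y =
      mat m m (\<lambda>(i, j). \<Sum>a<n. \<Sum>b<n. fls_const (C i j a b) * Y $$ (a, b))"
    by (rule c.lie_rep_coefficients[OF P, where N = N]) blast
  then show ?thesis using B
    by (auto simp: integral_mat_def intro!: vanishes_below_sum vanishes_below_scale)
qed

theorem regular_imp_Fuchsian:
  fixes G :: "'k::field mat set"
  assumes G: "linear_algebraic_group n G" and reg: "regular_connection n G A"
  shows "Fuchsian_connection n G A"
proof -
  have sub: "subgroup G (GL n)" using G by (simp add: linear_algebraic_group_def)
  have one: "1\<^sub>m n \<in> G" using subgroup.one_closed[OF sub] by simp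
  have A: "A \<in> connections n G" using reg by (simp add: regular_connection_def)
  from reg obtain B g where B: "B \<in> lie_algebra_tensor n G power_series"
    and g: "g \<in> points fls_const n G" and Bg: "B = gauge n g A"
    by (auto simp: regular_connection_def gauge_equivalent_def)
  note A' = lie_algebra_tensor_points[OF one A[unfolded connections_def]]
  note B' = lie_algebra_tensor_points[OF one B]
  have g': "g \<in> carrier (GL n)" using g by (rule points_GL)
  have gm: "g \<in> carrier_mat n n" using g' by (rule GL_carrier_mat)
  note gi = GL_inv_mat[OF g']
  have eq: "B * g = g * A + map_mat zd g"
    using A'(1) gm gi
    by (simp add: Bg gauge_def add_mult_distrib_mat[of _ n n] assoc_mult_mat[of _ n n _ n _ n])
  show ?thesis
    unfolding Fuchsian_connection_def
  proof (intro conjI allI impI A)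
    fix m P N assume r: "rational_representation n G m P N"
    interpret group_representation n G m P N by (rule group_representation.intro[OF sub r])
    let ?R = "rep_eval fls_const m P N g"
    have "lie_rep fls_const n m P N B * ?R = ?R * lie_rep fls_const n m P N A + map_mat zd ?R"
      by (rule lie_rep_gauge[OF A' B' g eq])
    moreover have "integral_mat m (lie_rep fls_const n m P N B)"
      using P by (intro integral_lie_rep[OF _ integral_tensor[OF B]]) blast
    ultimately show "Fuchsian_D_module (module_vec TYPE('k fls) m)
        (connection_action (\<lambda>d. lie_rep fls_const n m P N (connection_at A d)))"
      unfolding Fuchsian_D_module_iff[OF A r]
      by (intro ballI stable_hull_finitely_generated[OF rep_eval_GL[OF comm_ring_hom_fls_const g]]
          lie_rep_carrier)
  qed
qed

section \<open>Logarithmic bases\<close>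

text \<open>The columns of \<open>Q\<close> are a basis of an \<open>\<O>\<close>-lattice that is stable under \<open>nabla A\<close>, and
  \<open>C\<close> is the matrix of \<open>nabla A\<close> in this basis.\<close>

definition logarithmic_basis :: "nat \<Rightarrow> 'k::field fls mat \<Rightarrow> 'k fls mat \<Rightarrow> 'k fls mat \<Rightarrow> bool" where
  "logarithmic_basis n A Q C \<longleftrightarrow>
    Q \<in> carrier (GL n) \<and> integral_mat n C \<and> map_mat zd Q = A * Q + Q * C"

definition standard_rep :: "nat \<Rightarrow> nat \<Rightarrow> 'k::field entry_poly" where
  "standard_rep i j = Poly_Mapping.single (Poly_Mapping.single (i, j) 1) 1"

lemma standard_rep_eval:
  assumes "comm_ring_hom \<phi>" "g \<in> carrier_mat n n"
  shows "rep_eval \<phi> n standard_rep 0 g = g"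
proof -
  interpret \<phi>: comm_ring_hom \<phi> by fact
  show ?thesis
    by (rule eq_matI) (use assms in \<open>auto simp: rep_eval_def standard_rep_def entry_eval_def\<close>)
qed

lemma standard_rep_rational:
  assumes "G \<subseteq> carrier (GL n)"
  shows "rational_representation n G n standard_rep 0"
proof -
  have "comm_ring_hom (id :: 'a \<Rightarrow> 'a)" by standard simp_all
  then have "rep_eval id n standard_rep 0 g = g" if "g \<in> carrier (GL n)" for g :: "'a mat"
    using standard_rep_eval GL_carrier_mat that by blast
  moreover have "x * y \<in> carrier (GL n)" if "x \<in> G" "y \<in> G" for x y
    using that assms GL_mult_closed by blast
  moreover have "standard_rep i j \<in> entry_polys n" if "i < n" "j < n" for i j
    using that by (auto simp: standard_rep_def intro!: entry_polys_single)
  ultimately show ?thesis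
    using assms by (auto simp: rational_representation_def hom_def subset_iff)
qed

lemma standard_lie_rep:
  fixes A :: "'k::field fls mat"
  assumes "A \<in> carrier_mat n n"
  shows "lie_rep fls_const n n standard_rep 0 A = A"
  unfolding lie_rep_def
  using standard_rep_eval[OF comm_ring_hom_comp[OF comm_ring_hom_dual_const comm_ring_hom_fls_const],
      of "one_plus_eps n A" n] one_plus_eps_parts[OF assms] by simp

lemma nabla_sum:
  assumes M: "M \<in> carrier_mat m m" and W: "\<And>i. i \<in> I \<Longrightarrow> W i \<in> carrier_vec m"
  shows "nabla M (vec m (\<lambda>l. \<Sum>i\<in>I. W i $ l)) = vec m (\<lambda>l. \<Sum>i\<in>I. nabla M (W i) $ l)"
proof (rule eq_vecI)
  fix l assume "l < dim_vec (vec m (\<lambda>l. \<Sum>i\<in>I. nabla M (W i) $ l))"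
  then have l: "l < m" by simp
  have "(M *\<^sub>v vec m (\<lambda>l. \<Sum>i\<in>I. W i $ l)) $ l = (\<Sum>k<m. \<Sum>i\<in>I. M $$ (l, k) * W i $ k)"
    using M l by (subst mult_mat_vec_entry[of _ m m]) (auto simp: sum_distrib_left)
  also have "\<dots> = (\<Sum>i\<in>I. (M *\<^sub>v W i) $ l)"
    using M l W by (subst sum.swap) (simp add: mult_mat_vec_entry[of _ m m] del: index_mult_mat_vec)
  finally have "(M *\<^sub>v vec m (\<lambda>l. \<Sum>i\<in>I. W i $ l)) $ l = (\<Sum>i\<in>I. (M *\<^sub>v W i) $ l)" .
  moreover have "map_vec zd (W i) $ l = zd (W i $ l)" if "i \<in> I" for i
    using W[OF that] l by simp
  ultimately show "nabla M (vec m (\<lambda>l. \<Sum>i\<in>I. W i $ l)) $ l = vec m (\<lambda>l. \<Sum>i\<in>I. nabla M (W i) $ l) $ l"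
    using M l W by (simp add: nabla_def zd_sum sum_subtractf carrier_vecD del: index_mult_mat_vec)
qed (use M in \<open>simp add: nabla_def\<close>)

text \<open>The sum \<open>L\<close> of the modules \<open>E(e\<^sub>i)\<close> is stable, has bounded poles and contains a basis of
  \<open>K\<^sup>n\<close>, so its triangular generators form an invertible matrix.\<close>

theorem Fuchsian_imp_logarithmic_basis:
  fixes A :: "'k::field fls mat"
  assumes G: "G \<subseteq> carrier (GL n)" and F: "Fuchsian_connection n G A"
  obtains Q C where "logarithmic_basis n A Q C"
proof -
  have A: "A \<in> connections n G" using F by (simp add: Fuchsian_connection_def)
  have Am: "A \<in> carrier_mat n n" by (rule connection_carrier[OF A])
  note std = standard_rep_rational[OF G]
  let ?E = "\<lambda>i. stable_hull n A (unit_vec n i)"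
  have "finitely_generated_power_series (module_vec TYPE('k fls) n) (?E i)" for i
    using F Fuchsian_D_module_iff[OF A std] std
    by (simp add: Fuchsian_connection_def standard_lie_rep[OF Am])
  then have "\<exists>j. \<forall>v \<in> ?E i. \<forall>l<n. vanishes_below j (v $ l)" for i
    using finitely_generated_imp_bounded by metis
  then obtain J where J: "\<And>i v l. v \<in> ?E i \<Longrightarrow> l < n \<Longrightarrow> vanishes_below (J i) (v $ l)" by metis
  \<comment> \<open>Inserting \<open>0\<close> keeps the set nonempty for \<open>n = 0\<close>.\<close>
  define j where "j = Min (insert 0 (J ` {..<n}))"
  have j: "j \<le> J i" if "i < n" for i using that by (simp add: j_def)
  note E = stable_hull[OF Am unit_vec_carrier]
  have Ecar: "v \<in> carrier_vec n" if "v \<in> ?E i" for v i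
    using that E(1)[of i] by (auto simp: power_series_module_def)
  define L where "L = {vec n (\<lambda>l. \<Sum>i<n. W i $ l) | W. \<forall>i<n. W i \<in> ?E i}"
  have Lmod: "power_series_module n L"
    unfolding power_series_module_def
  proof (intro conjI ballI allI impI)
    show "L \<subseteq> carrier_vec n" by (auto simp: L_def)
    show "0\<^sub>v n \<in> L" unfolding L_def using E(1)
      by (intro CollectI exI[of _ "\<lambda>_. 0\<^sub>v n"]) (auto simp: power_series_module_def)
  next
    fix v w assume "v \<in> L" "w \<in> L"
    then obtain V W where V: "\<forall>i<n. V i \<in> ?E i" "v = vec n (\<lambda>l. \<Sum>i<n. V i $ l)"
      and W: "\<forall>i<n. W i \<in> ?E i" "w = vec n (\<lambda>l. \<Sum>i<n. W i $ l)" by (auto simp: L_def)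
    show "v + w \<in> L" unfolding L_def
    proof (intro CollectI exI[of _ "\<lambda>i. V i + W i"] conjI allI impI)
      show "v + w = vec n (\<lambda>l. \<Sum>i<n. (V i + W i) $ l)"
        using V W Ecar by (intro eq_vecI) (auto simp: sum.distrib[symmetric] intro!: sum.cong dest!: Ecar)
      show "V i + W i \<in> ?E i" if "i < n" for i
        using V W that E(1)[of i] by (auto simp: power_series_module_def)
    qed
  next
    fix c :: "'k fls" and v assume c: "vanishes_below 0 c" and "v \<in> L"
    then obtain V where V: "\<forall>i<n. V i \<in> ?E i" "v = vec n (\<lambda>l. \<Sum>i<n. V i $ l)"
      by (auto simp: L_def)
    show "c \<cdot>\<^sub>v v \<in> L" unfolding L_def
    proof (intro CollectI exI[of _ "\<lambda>i. c \<cdot>\<^sub>v V i"] conjI allI impI)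
      show "c \<cdot>\<^sub>v v = vec n (\<lambda>l. \<Sum>i<n. (c \<cdot>\<^sub>v V i) $ l)"
        using V Ecar by (intro eq_vecI) (auto simp: sum_distrib_left intro!: sum.cong dest!: Ecar)
      show "c \<cdot>\<^sub>v V i \<in> ?E i" if "i < n" for i
        using V c that E(1)[of i] by (auto simp: power_series_module_def)
    qed
  qed
  have Lstable: "nabla A w \<in> L" if w: "w \<in> L" for w
  proof -
    obtain W where W: "\<forall>i<n. W i \<in> ?E i" "w = vec n (\<lambda>l. \<Sum>i<n. W i $ l)"
      using w by (auto simp: L_def)
    have "nabla A w = vec n (\<lambda>l. \<Sum>i<n. nabla A (W i) $ l)"
      unfolding W(2) by (rule nabla_sum[OF Am]) (use W(1) Ecar in auto)
    then show ?thesis using W(1) E(3) by (auto simp: L_def)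
  qed
  have Lbound: "vanishes_below j (v $ l)" if "v \<in> L" "l < n" for v l
  proof -
    obtain W where W: "\<forall>i<n. W i \<in> ?E i" "v = vec n (\<lambda>l. \<Sum>i<n. W i $ l)"
      using \<open>v \<in> L\<close> unfolding L_def by blast
    have "vanishes_below j (W i $ l)" if "i < n" for i
      using vanishes_below_mono[OF J j] W(1) that \<open>l < n\<close> by blast
    then show ?thesis using that W(2) by (auto intro!: vanishes_below_sum)
  qed
  have Lunit: "unit_vec n i \<in> L" if i: "i < n" for i
    unfolding L_def
  proof (intro CollectI exI[of _ "\<lambda>k. if k = i then unit_vec n i else 0\<^sub>v n"] conjI allI impI)
    show "(unit_vec n i :: 'k fls vec) = vec n (\<lambda>l. \<Sum>k<n. (if k = i then unit_vec n i else 0\<^sub>v n) $ l)"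
    proof (rule eq_vecI)
      fix l assume "l < dim_vec (vec n (\<lambda>l. \<Sum>k<n. (if k = i then (unit_vec n i :: 'k fls vec) else 0\<^sub>v n) $ l))"
      then have l: "l < n" by simp
      have "(\<Sum>k<n. (if k = i then unit_vec n i else 0\<^sub>v n) $ l) =
          (\<Sum>k<n. if k = i then (unit_vec n i :: 'k fls vec) $ l else 0)"
        by (rule sum.cong) (use l in auto)
      then show "(unit_vec n i :: 'k fls vec) $ l =
          vec n (\<lambda>l. \<Sum>k<n. (if k = i then unit_vec n i else 0\<^sub>v n) $ l) $ l"
        using i l by simp
    qed simp
    show "(if k = i then unit_vec n i else 0\<^sub>v n) \<in> ?E k" if "k < n" for k
      using E(1,2)[of k] by (auto simp: power_series_module_def)
  qed
  obtain Q where Q: "Q \<in> carrier_mat n n" "\<And>i. i < n \<Longrightarrow> col Q i \<in> L"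
    "\<And>l i. l < i \<Longrightarrow> i < n \<Longrightarrow> Q $$ (l, i) = 0"
    "\<And>v. v \<in> L \<Longrightarrow> \<exists>c \<in> carrier_vec n. (\<forall>i<n. vanishes_below 0 (c $ i)) \<and> v = Q *\<^sub>v c"
    using triangular_generators[OF Lmod Lbound] by metis
  have "\<exists>D. \<forall>i<n. D i \<in> carrier_vec n \<and> unit_vec n i = Q *\<^sub>v D i"
    using Q(4)[OF Lunit] by metis
  then obtain D where D: "\<And>i. i < n \<Longrightarrow> D i \<in> carrier_vec n" "\<And>i. i < n \<Longrightarrow> unit_vec n i = Q *\<^sub>v D i"
    by blast
  have QGL: "Q \<in> carrier (GL n)"
  proof (rule GL_I_right[OF Q(1)])
    show "Q * mat_of_cols n (map D [0..<n]) = 1\<^sub>m n"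
    proof (rule mat_col_eqI)
      fix i assume "i < dim_col (1\<^sub>m n :: 'k fls mat)"
      then show "col (Q * mat_of_cols n (map D [0..<n])) i = col (1\<^sub>m n) i"
        using Q(1) D[of i] col_mult2[OF Q(1), of "mat_of_cols n (map D [0..<n])" n i]
          mat_of_cols_carrier(1)[of n "map D [0..<n]"] by simp
    qed (use Q(1) in auto)
  qed (auto intro!: carrier_matI)
  have "\<exists>c. \<forall>i<n. c i \<in> carrier_vec n \<and> (\<forall>l<n. vanishes_below 0 (c i $ l)) \<and>
      nabla A (col Q i) = Q *\<^sub>v c i"
    using Q(4)[OF Lstable[OF Q(2)]] by metis
  then obtain c where c: "\<And>i. i < n \<Longrightarrow> c i \<in> carrier_vec n"
    "\<And>i l. i < n \<Longrightarrow> l < n \<Longrightarrow> vanishes_below 0 (c i $ l)"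
    "\<And>i. i < n \<Longrightarrow> nabla A (col Q i) = Q *\<^sub>v c i" by metis
  define C where "C = mat_of_cols n (map c [0..<n])"
  have Cm: "C \<in> carrier_mat n n" by (auto simp: C_def intro!: carrier_matI)
  have colC: "col C i = c i" if "i < n" for i using that c(1) by (simp add: C_def)
  have "map_mat zd Q = A * Q + Q * C"
  proof (rule eq_matI)
    fix l i assume "l < dim_row (A * Q + Q * C)" "i < dim_col (A * Q + Q * C)"
    then have li: "l < n" "i < n" using Q(1) Cm Am by auto
    have "nabla A (col Q i) $ l = (Q *\<^sub>v col C i) $ l" using c(3) colC li by simp
    then show "map_mat zd Q $$ (l, i) = (A * Q + Q * C) $$ (l, i)"
      using li Q(1) Cm Am by (simp add: nabla_def diff_eq_eq)
  qed (use Q(1) Cm Am in auto)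
  moreover have "integral_mat n C"
    using c(1,2) Cm by (auto simp: integral_mat_def C_def mat_of_cols_index)
  ultimately show ?thesis using that QGL by (auto simp: logarithmic_basis_def)
qed

text \<open>Differentiating \<open>Q\<^sup>-\<^sup>1 Q = 1\<close> gives \<open>\<theta>(Q\<^sup>-\<^sup>1) Q = - Q\<^sup>-\<^sup>1 \<theta>Q = - Q\<^sup>-\<^sup>1 A Q - C\<close>.\<close>

lemma logarithmic_basis_gauge:
  assumes A: "A \<in> carrier_mat n n" and B: "logarithmic_basis n A Q C"
  shows "gauge n (inv\<^bsub>GL n\<^esub> Q) A = - C"
proof -
  have Q: "Q \<in> carrier (GL n)" and C: "C \<in> carrier_mat n n"
    and eq: "map_mat zd Q = A * Q + Q * C"
    using B by (auto simp: logarithmic_basis_def integral_mat_def)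
  have Qm: "Q \<in> carrier_mat n n" using Q by (rule GL_carrier_mat)
  let ?g = "inv\<^bsub>GL n\<^esub> Q"
  note gi = GL_inv_mat[OF Q]
  have inv: "inv\<^bsub>GL n\<^esub> ?g = Q" by (rule group.inv_inv[OF group_GL Q])
  have s1: "map_mat zd (?g * Q) = map_mat zd ?g * Q + ?g * map_mat zd Q"
    by (rule zd_mat_mult[OF gi(1) Qm])
  have s2: "map_mat zd (?g * Q) = 0\<^sub>m n n"
    unfolding gi(2) by (rule eq_matI) (auto simp: zd_0 zd_1)
  have s3: "?g * map_mat zd Q = ?g * A * Q + C"
    using A gi Qm C
    by (simp add: eq mult_add_distrib_mat[of ?g n n "A * Q" n "Q * C"]
        assoc_mult_mat[of ?g n n A n Q n] assoc_mult_mat[of ?g n n Q n C n, symmetric])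
  have sum0: "map_mat zd ?g * Q + (?g * A * Q + C) = 0\<^sub>m n n"
    using s1[unfolded s2 s3] by (rule sym)
  have zero: "(map_mat zd ?g * Q) $$ (i, j) + ((?g * A * Q) $$ (i, j) + C $$ (i, j)) = 0"
    if "i < n" "j < n" for i j
    using arg_cong[OF sum0, of "\<lambda>M. M $$ (i, j)"] that A gi(1) Qm C
    by (simp del: index_mult_mat(1))
  have ent: "(?g * A * Q) $$ (i, j) + (map_mat zd ?g * Q) $$ (i, j) = - C $$ (i, j)"
    if "i < n" "j < n" for i j
    by (rule eq_neg_iff_add_eq_0[THEN iffD2]) (use zero[OF that] in \<open>simp only: ac_simps\<close>)
  show ?thesis
    unfolding gauge_def inv
  proof (rule eq_matI)
    fix i j assume "i < dim_row (- C)" "j < dim_col (- C)"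
    then have "i < n" "j < n" using C by auto
    then show "(?g * A * Q + map_mat zd ?g * Q) $$ (i, j) = (- C) $$ (i, j)"
      using ent[of i j] gi(1) Qm C by (simp del: index_mult_mat(1))
  qed (use gi(1) Qm C in auto)
qed

text \<open>\<open>X i j\<close> plays the role of the matrix unit \<open>E\<^sub>i\<^sub>j\<close>: it is that unit for \<open>GL\<^sub>n\<close> and a traceless
  correction of it for \<open>SL\<^sub>n\<close>.\<close>

lemma lie_algebra_tensorI:
  assumes X: "\<And>i j. i < n \<Longrightarrow> j < n \<Longrightarrow> X i j \<in> lie_algebra n G"
    and S: "\<And>i j. i < n \<Longrightarrow> j < n \<Longrightarrow> B $$ (i, j) \<in> S" and Bm: "B \<in> carrier_mat n n"
    and B: "\<And>a b. a < n \<Longrightarrow> b < n \<Longrightarrow>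
      B $$ (a, b) = (\<Sum>i<n. \<Sum>j<n. B $$ (i, j) * fls_const (X i j $$ (a, b)))"
  shows "B \<in> lie_algebra_tensor n G S"
proof -
  obtain h where h: "bij_betw h {0..<card ({..<n} \<times> {..<n})} ({..<n} \<times> {..<n})"
    using ex_bij_betw_nat_finite[of "{..<n} \<times> {..<n}"] by auto
  define r where "r = card ({..<n} \<times> {..<n})"
  have h: "bij_betw h {..<r} ({..<n} \<times> {..<n})" using h by (simp add: r_def atLeast0LessThan)
  have hl: "fst (h l) < n" "snd (h l) < n" if "l < r" for l
    using bij_betwE[OF h] that by (auto simp: mem_Times_iff)
  have "B = mat n n (\<lambda>ab. \<Sum>l<r. B $$ h l * fls_const (X (fst (h l)) (snd (h l)) $$ ab))"
  proof (rule eq_matI)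
    fix a b assume "a < dim_row (mat n n (\<lambda>ab. \<Sum>l<r. B $$ h l * fls_const (X (fst (h l)) (snd (h l)) $$ ab)))"
      "b < dim_col (mat n n (\<lambda>ab. \<Sum>l<r. B $$ h l * fls_const (X (fst (h l)) (snd (h l)) $$ ab)))"
    then have ab: "a < n" "b < n" by simp_all
    have "(\<Sum>l<r. B $$ h l * fls_const (X (fst (h l)) (snd (h l)) $$ (a, b))) =
        (\<Sum>ij \<in> {..<n} \<times> {..<n}. B $$ ij * fls_const (X (fst ij) (snd ij) $$ (a, b)))"
      by (rule sum.reindex_bij_betw[OF h])
    also have "\<dots> = B $$ (a, b)"
      unfolding B[OF ab] by (simp add: sum.cartesian_product split_beta)
    finally show "B $$ (a, b) = mat n n (\<lambda>ab. \<Sum>l<r. B $$ h l * fls_const (X (fst (h l)) (snd (h l)) $$ ab)) $$ (a, b)"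
      using ab by simp
  qed (use Bm in auto)
  moreover have "\<forall>l<r. B $$ h l \<in> S \<and> X (fst (h l)) (snd (h l)) \<in> lie_algebra n G"
  proof (intro allI impI)
    fix l assume "l < r"
    from hl[OF this] show "B $$ h l \<in> S \<and> X (fst (h l)) (snd (h l)) \<in> lie_algebra n G"
      using S[of "fst (h l)" "snd (h l)"] X[of "fst (h l)" "snd (h l)"] by simp
  qed
  ultimately show ?thesis
    unfolding lie_algebra_tensor_def
    by (intro CollectI exI[of _ r] exI[of _ "\<lambda>l. B $$ h l"]
        exI[of _ "\<lambda>l. X (fst (h l)) (snd (h l))"] conjI)
qed

definition unit_mat :: "nat \<Rightarrow> nat \<Rightarrow> nat \<Rightarrow> 'k::field mat" where
  "unit_mat n i j = mat n n (\<lambda>ab. if ab = (i, j) then 1 else 0)"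

lemma unit_mat_expansion:
  fixes B :: "'k::field fls mat"
  assumes "a < n" "b < n"
  shows "(\<Sum>i<n. \<Sum>j<n. B $$ (i, j) * fls_const (unit_mat n i j $$ (a, b))) = B $$ (a, b)"
proof -
  have "(\<Sum>i<n. \<Sum>j<n. B $$ (i, j) * fls_const (unit_mat n i j $$ (a, b))) =
      (\<Sum>i<n. \<Sum>j<n. if i = a then (if j = b then B $$ (a, b) else 0) else 0)"
    using assms by (intro sum.cong refl) (auto simp: unit_mat_def)
  also have "\<dots> = (\<Sum>i<n. if i = a then B $$ (a, b) else 0)"
    by (intro sum.cong refl) (use assms in auto)
  finally show ?thesis using assms by simp
qed

theorem Fuchsian_imp_regular_GL:
  fixes A :: "'k::field_char_0 fls mat"
  assumes F: "Fuchsian_connection n (carrier (GL n)) A"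
  shows "regular_connection n (carrier (GL n)) A"
proof -
  have A: "A \<in> connections n (carrier (GL n))" using F by (simp add: Fuchsian_connection_def)
  obtain Q C where B: "logarithmic_basis n A Q C"
    using Fuchsian_imp_logarithmic_basis[OF order_refl F] .
  then have Q: "Q \<in> carrier (GL n)" and C: "integral_mat n C" by (auto simp: logarithmic_basis_def)
  have "- C \<in> lie_algebra_tensor n (carrier (GL n)) power_series"
  proof (rule lie_algebra_tensorI)
    show "unit_mat n i j \<in> lie_algebra n (carrier (GL n) :: 'k mat set)" for i j
      by (simp add: lie_algebra_general_linear unit_mat_def)
    show "(- C) $$ (i, j) \<in> power_series" if "i < n" "j < n" for i j
      using C that by (auto simp: integral_mat_def power_series_iff intro!: vanishes_below_uminus)
    show "- C \<in> carrier_mat n n" using C by (simp add: integral_mat_def)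
    show "(- C) $$ (a, b) = (\<Sum>i<n. \<Sum>j<n. (- C) $$ (i, j) * fls_const (unit_mat n i j $$ (a, b)))"
      if "a < n" "b < n" for a b
      using that by (rule unit_mat_expansion[symmetric])
  qed
  moreover have "inv\<^bsub>GL n\<^esub> Q \<in> points fls_const n (carrier (GL n))"
    unfolding points_general_linear[OF comm_ring_hom_fls_const] by (rule GL_inv_closed[OF Q])
  ultimately show ?thesis
    using A logarithmic_basis_gauge[OF connection_carrier[OF A] B, symmetric]
    unfolding regular_connection_def gauge_equivalent_def by blast
qed

section \<open>Normalising the determinant\<close>

text \<open>Take determinants in \<open>Q + \<epsilon> \<theta>Q = (1 + \<epsilon>A) Q (1 + \<epsilon>C)\<close>.\<close>

lemma logarithmic_basis_det:
  fixes A :: "'k::field fls mat"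
  assumes A: "A \<in> carrier_mat n n" and B: "logarithmic_basis n A Q C"
  shows "zd (det Q) = ((\<Sum>i<n. A $$ (i, i)) + (\<Sum>i<n. C $$ (i, i))) * det Q"
proof -
  note hom_det = comm_ring_hom.hom_det[OF comm_ring_hom_taylor, of Q]
    comm_ring_hom.hom_det[OF comm_ring_hom_dual_const, of Q]
  have Qm: "Q \<in> carrier_mat n n" and C: "C \<in> carrier_mat n n"
    and eq: "map_mat zd Q = A * Q + Q * C"
    using B GL_carrier_mat by (auto simp: logarithmic_basis_def integral_mat_def)
  have parts: "map_mat dual_re (map_mat taylor Q) = Q" "map_mat dual_eps (map_mat taylor Q) = map_mat zd Q"
    "map_mat dual_re (map_mat (\<lambda>c. dual_const c) Q) = Q"
    "map_mat dual_eps (map_mat (\<lambda>c. dual_const c) Q) = 0\<^sub>m n n"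
    using Qm by (auto intro!: eq_matI simp: taylor_def)
  let ?q = "map_mat (\<lambda>c. dual_const c) Q"
  have AQ: "A * Q \<in> carrier_mat n n" using A Qm by simp
  have Aq: "one_plus_eps n A * ?q \<in> carrier_mat n n"
    by (rule mult_carrier_mat[of _ n n]) (use A Qm in \<open>simp_all add: one_plus_eps_parts\<close>)
  have 1: "map_mat dual_re (one_plus_eps n A * ?q) = Q" "map_mat dual_eps (one_plus_eps n A * ?q) = A * Q"
    using Qm A by (subst mult_mat_dual[of _ n]; simp add: one_plus_eps_parts parts left_add_zero_mat[OF AQ])+
  have "map_mat taylor Q = one_plus_eps n A * ?q * one_plus_eps n C"
  proof (rule mat_dual_eqI)
    show "map_mat dual_re (map_mat taylor Q) = map_mat dual_re (one_plus_eps n A * ?q * one_plus_eps n C)"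
      using Qm A C Aq by (subst mult_mat_dual[of _ n]) (simp_all add: one_plus_eps_parts parts 1)
    show "map_mat dual_eps (map_mat taylor Q) = map_mat dual_eps (one_plus_eps n A * ?q * one_plus_eps n C)"
      using Qm A C Aq eq
      by (subst mult_mat_dual[of _ n])
        (simp_all add: one_plus_eps_parts parts 1 comm_add_mat[of "A * Q" n n])
  qed
  then have "taylor (det Q) = det (one_plus_eps n A) * dual_const (det Q) * det (one_plus_eps n C)"
    unfolding hom_det[symmetric] using Qm A C Aq
    by (simp add: det_mult[of _ n] one_plus_eps_parts)
  then show ?thesis
    by (simp add: det_one_plus_eps A C taylor_def times_dual_def algebra_simps)
qed

text \<open>The \<open>p\<close>-th basis vector is replaced by the combination of the basis with coordinate vector \<open>w\<close>,
  that is, \<open>Q\<close> by \<open>Q T\<close>, where \<open>T\<close> is the identity matrix with \<open>p\<close>-th column \<open>w\<close>. The new lattice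
  contains the old one because \<open>T\<^sup>-\<^sup>1\<close>, whose \<open>p\<close>-th column has the entries \<open>1 / w p\<close> and
  \<open>- w i / w p\<close>, is over \<open>\<O>\<close>. The last hypothesis puts the image of the new vector into the new
  lattice; the vectors \<open>\<mu> w\<close> and \<open>r\<close> are its parts outside and inside the old lattice.\<close>

lemma logarithmic_basis_replace_vector:
  fixes A :: "'k::field fls mat"
  assumes A: "A \<in> carrier_mat n n" and B: "logarithmic_basis n A Q C" and p: "p < n"
    and wp: "w p \<noteq> 0" "vanishes_below 0 (1 / w p)" "\<And>i. i < n \<Longrightarrow> vanishes_below 0 (w i / w p)"
    and r: "\<And>i. i < n \<Longrightarrow> vanishes_below 0 (r i)" and mu: "vanishes_below 0 \<mu>"
    and w: "\<And>i. i < n \<Longrightarrow> (\<Sum>l<n. C $$ (i, l) * w l) + zd (w i) = \<mu> * w i + r i"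
  obtains Q' C' where "logarithmic_basis n A Q' C'" "det Q' = det Q * w p"
proof -
  have Q: "Q \<in> carrier (GL n)" and Qm: "Q \<in> carrier_mat n n" and C: "integral_mat n C"
    and Cm: "C \<in> carrier_mat n n" and eq: "map_mat zd Q = A * Q + Q * C"
    using B GL_carrier_mat by (auto simp: logarithmic_basis_def integral_mat_def)
  define T where "T = mat n n (\<lambda>(i, j). if j = p then w i else if i = j then 1 else 0)"
  \<comment> \<open>This is \<open>T\<^sup>-\<^sup>1 (C T + \<theta>T)\<close>.\<close>
  define C' where "C' = mat n n (\<lambda>(i, j).
    if j = p then (if i = p then \<mu> + r p * (1 / w p) else r i - w i / w p * r p)
    else (if i = p then 1 / w p * C $$ (p, j) else C $$ (i, j) - w i / w p * C $$ (p, j)))"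
  have T: "T \<in> carrier_mat n n" and C': "C' \<in> carrier_mat n n" by (simp_all add: T_def C'_def)
  have detT: "det T = w p"
  proof -
    have "T = replace_col (1\<^sub>m n) (1\<^sub>m n *\<^sub>v vec n w) p"
      by (rule eq_matI) (auto simp: T_def replace_col_def)
    then show ?thesis
      using cramer_lemma_mat[of "1\<^sub>m n" n "vec n w" p] p by simp
  qed
  have int: "integral_mat n C'"
    using C r mu wp p unfolding integral_mat_def
    by (auto simp: C'_def integral_mat_def mult.commute[of "r p"]
        intro!: vanishes_below_add vanishes_below_diff vanishes_below_scale simp del: times_divide_eq_left times_divide_eq_right)
  have TC': "T * C' = C * T + map_mat zd T"
  proof (rule eq_matI)
    fix i j assume "i < dim_row (C * T + map_mat zd T)" "j < dim_col (C * T + map_mat zd T)"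
    then have ij: "i < n" "j < n" using T by simp_all
    have "(T * C') $$ (i, j) = (\<Sum>l<n. T $$ (i, l) * C' $$ (l, j))"
      by (rule mult_mat_entry[OF T C' ij])
    also have "\<dots> = (\<Sum>l<n. (if l = p then w i * C' $$ (p, j) else 0) +
        (if l = i then (if i = p then 0 else C' $$ (i, j)) else 0))"
      by (rule sum.cong) (use ij in \<open>auto simp: T_def\<close>)
    also have "\<dots> = w i * C' $$ (p, j) + (if i = p then 0 else C' $$ (i, j))"
      using ij p by (simp add: sum.distrib)
    also have "\<dots> = (if j = p then \<mu> * w i + r i else C $$ (i, j))"
      using ij p wp(1) by (auto simp: C'_def field_simps)
    also have "\<dots> = (\<Sum>l<n. C $$ (i, l) * T $$ (l, j)) + zd (T $$ (i, j))"
    proof (cases "j = p")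
      case True
      then show ?thesis using w[OF ij(1)] ij by (simp add: T_def)
    next
      case False
      have "(\<Sum>l<n. C $$ (i, l) * T $$ (l, j)) = (\<Sum>l<n. if l = j then C $$ (i, j) else 0)"
        by (rule sum.cong) (use ij False in \<open>auto simp: T_def\<close>)
      then show ?thesis using ij False by (simp add: T_def zd_0 zd_1)
    qed
    also have "\<dots> = (C * T + map_mat zd T) $$ (i, j)"
      using ij T Cm by (simp add: mult_mat_entry[OF Cm T] del: index_mult_mat(1))
    finally show "(T * C') $$ (i, j) = (C * T + map_mat zd T) $$ (i, j)" .
  qed (use T C' Cm in auto)
  have TGL: "T \<in> carrier (GL n)"
    by (rule GL_I_det[OF T, where u = "1 / w p"]) (use wp in \<open>simp add: detT\<close>)
  have "map_mat zd (Q * T) = (A * Q + Q * C) * T + Q * map_mat zd T"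
    by (simp add: zd_mat_mult[OF Qm T] eq)
  also have "\<dots> = A * (Q * T) + Q * (C * T + map_mat zd T)"
    using A Qm Cm T
    by (simp add: add_mult_distrib_mat[of _ n n] mult_add_distrib_mat[of _ n n _ n]
        assoc_mult_mat[of _ n n _ n _ n] assoc_add_mat[of _ n n])
  also have "\<dots> = A * (Q * T) + (Q * T) * C'"
    using Qm T C' by (simp add: TC'[symmetric] assoc_mult_mat[of _ n n _ n _ n])
  finally have "logarithmic_basis n A (Q * T) C'"
    using int GL_mult_closed[OF Q TGL] by (simp add: logarithmic_basis_def)
  moreover have "det (Q * T) = det Q * w p" using det_mult[OF Qm T] by (simp add: detT)
  ultimately show ?thesis by (rule that)
qed

lemma logarithmic_basis_det_nonzero:
  fixes A :: "'k::field fls mat"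
  assumes "logarithmic_basis n A Q C"
  shows "det Q \<noteq> 0"
proof -
  have "det Q * unit_inverse (det Q) = 1"
    using assms GL_det_unit[of Q n] by (simp add: logarithmic_basis_def)
  then show ?thesis by auto
qed

text \<open>Multiplying the lattice by \<open>z\<^sup>k\<close> replaces \<open>C\<close> by \<open>C + k\<close>.\<close>

lemma logarithmic_basis_shrink:
  fixes A :: "'k::field fls mat"
  assumes A: "A \<in> carrier_mat n n" and B: "logarithmic_basis n A Q C"
  shows "\<exists>Q' C'. logarithmic_basis n A Q' C' \<and>
    fls_subdegree (det Q') = fls_subdegree (det Q) + int (k * n)"
proof (induction k)
  case 0
  show ?case using B by auto
next
  case (Suc k)
  then obtain Q' C' where B': "logarithmic_basis n A Q' C'"
    "fls_subdegree (det Q') = fls_subdegree (det Q) + int (k * n)" by blast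
  have Q: "Q' \<in> carrier (GL n)" and Qm: "Q' \<in> carrier_mat n n" and C: "integral_mat n C'"
    and Cm: "C' \<in> carrier_mat n n" and eq: "map_mat zd Q' = A * Q' + Q' * C'"
    using B'(1) GL_carrier_mat by (auto simp: logarithmic_basis_def integral_mat_def)
  have det: "det (fls_X \<cdot>\<^sub>m Q') = fls_X ^ n * det Q'" using Qm by (simp add: det_smult)
  have d0: "det Q' \<noteq> 0" by (rule logarithmic_basis_det_nonzero[OF B'(1)])
  have "logarithmic_basis n A (fls_X \<cdot>\<^sub>m Q') (C' + 1\<^sub>m n)"
    unfolding logarithmic_basis_def
  proof (intro conjI)
    show "fls_X \<cdot>\<^sub>m Q' \<in> carrier (GL n)"
      by (rule GL_I_det[where u = "1 / det (fls_X \<cdot>\<^sub>m Q')"]) (use Qm d0 in \<open>simp_all add: det\<close>)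
    show "integral_mat n (C' + 1\<^sub>m n)"
      using C by (auto simp: integral_mat_def intro!: vanishes_below_add)
    have X: "zd (fls_X * x) = fls_X * zd x + fls_X * x" for x :: "'k fls"
      by (simp add: zd_mult) (simp add: derivation_def)
    have "map_mat zd (fls_X \<cdot>\<^sub>m Q') = fls_X \<cdot>\<^sub>m (map_mat zd Q' + Q')"
      by (rule eq_matI) (use Qm in \<open>auto simp: X algebra_simps\<close>)
    also have "\<dots> = fls_X \<cdot>\<^sub>m (A * Q' + Q' * (C' + 1\<^sub>m n))"
      using A Qm Cm
      by (simp add: eq mult_add_distrib_mat[of _ n n] assoc_add_mat[of _ n n])
    also have "\<dots> = A * (fls_X \<cdot>\<^sub>m Q') + (fls_X \<cdot>\<^sub>m Q') * (C' + 1\<^sub>m n)"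
      using A Qm Cm
      by (simp add: add_smult_distrib_left_mat[of _ n n] mult_smult_distrib[of _ n n]
          mult_smult_assoc_mat[of Q' n n "C' + 1\<^sub>m n" n])
    finally show "map_mat zd (fls_X \<cdot>\<^sub>m Q') = A * (fls_X \<cdot>\<^sub>m Q') + (fls_X \<cdot>\<^sub>m Q') * (C' + 1\<^sub>m n)" .
  qed
  moreover have "fls_subdegree (det (fls_X \<cdot>\<^sub>m Q')) = fls_subdegree (det Q) + int (Suc k * n)"
    using d0 B'(2) Qm by (simp add: det algebra_simps)
  ultimately show ?case by blast
qed

lemma exists_eigenvector:
  fixes M :: "'k::alg_closed_field mat"
  assumes M: "M \<in> carrier_mat n n" and n: "n > 0"
  obtains u a where "u \<in> carrier_vec n" "u \<noteq> 0\<^sub>v n" "M *\<^sub>v u = a \<cdot>\<^sub>v u"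
proof -
  have "degree (char_poly M) > 0" using degree_monic_char_poly[OF M] n by simp
  then obtain a where "poly (char_poly M) a = 0" using alg_closed_imp_poly_has_root by blast
  then have "eigenvalue M a" using eigenvalue_root_char_poly[OF M] by simp
  then show ?thesis using that M by (auto simp: eigenvalue_def eigenvector_def)
qed

text \<open>Let \<open>u\<close> be an eigenvector of the residue \<open>C(0)\<close> for the eigenvalue \<open>a\<close>. Then \<open>C u - a u\<close> is
  divisible by \<open>z\<close>, so the vector with coordinates \<open>w = u / z\<close> is mapped to \<open>(a - 1) w\<close> plus an element
  of the old lattice, and \<open>w\<close> can replace a basis vector with \<open>u\<^sub>p \<noteq> 0\<close>.\<close>

lemma logarithmic_basis_enlarge_one:
  fixes A :: "'k::alg_closed_field fls mat"
  assumes A: "A \<in> carrier_mat n n" and B: "logarithmic_basis n A Q C" and n: "n > 0"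
  obtains Q' C' where "logarithmic_basis n A Q' C'"
    "fls_subdegree (det Q') = fls_subdegree (det Q) - 1"
proof -
  have C: "integral_mat n C" using B by (simp add: logarithmic_basis_def)
  define C0 where "C0 = mat n n (\<lambda>ij. fls_nth (C $$ ij) 0)"
  obtain u a where u: "u \<in> carrier_vec n" "u \<noteq> 0\<^sub>v n" "C0 *\<^sub>v u = a \<cdot>\<^sub>v u"
    using exists_eigenvector[of C0 n] n by (auto simp: C0_def)
  obtain p where p: "p < n" "u $ p \<noteq> 0"
    using u(1,2) by (metis carrier_vecD eq_vecI index_zero_vec)
  have eig: "(\<Sum>l<n. fls_nth (C $$ (i, l)) 0 * u $ l) = a * u $ i" if "i < n" for i
    using arg_cong[OF u(3), of "\<lambda>v. v $ i"] that u(1) mult_mat_vec_entry[of C0 n n u i]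
    by (simp add: C0_def)
  have XX: "fls_X_inv * fls_X = (1 :: 'k fls)" "(fls_X :: 'k fls) * fls_X_inv = 1"
    by (metis fls_X_nonzero fls_inverse_X left_inverse right_inverse)+
  define s where "s i = (\<Sum>l<n. C $$ (i, l) * fls_const (u $ l)) - fls_const a * fls_const (u $ i)" for i
  have s: "vanishes_below 1 (s i)" if i: "i < n" for i
    unfolding vanishes_below_def
  proof (intro allI impI)
    fix k :: int assume "k < 1"
    have "fls_nth (s i) k = (\<Sum>l<n. fls_nth (C $$ (i, l)) k * u $ l) - (if k = 0 then a * u $ i else 0)"
      by (simp add: s_def fls_nth_sum)
    then show "fls_nth (s i) k = 0"
      using eig[OF i] C i \<open>k < 1\<close> by (cases "k = 0") (auto simp: integral_mat_def vanishes_below_def)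
  qed
  have Xinv: "vanishes_below (-1) (fls_X_inv :: 'k fls)" by (simp add: vanishes_below_def)
  define w where "w i = fls_X_inv * fls_const (u $ i)" for i
  have w0: "w p \<noteq> 0" using p by (simp add: w_def)
  have "1 / w p = fls_X * fls_const (1 / u $ p)"
  proof -
    have "w p * (fls_X * fls_const (1 / u $ p)) = (fls_X_inv * fls_X) * (fls_const (u $ p) * fls_const (1 / u $ p))"
      by (simp only: w_def mult_ac)
    also have "\<dots> = 1" using p XX by simp
    finally show ?thesis using w0 by (simp add: divide_eq_eq mult.commute)
  qed
  then have i1: "vanishes_below 0 (1 / w p)" by (simp only: vanishes_below_scale vanishes_below_X vanishes_below_const)
  have "w i / w p = fls_const (u $ i / u $ p)" for i
  proof -
    have "w p * fls_const (u $ i / u $ p) = w i" using p by (simp add: w_def mult.assoc)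
    then show ?thesis using w0 by (simp add: divide_eq_eq mult.commute)
  qed
  then have i2: "vanishes_below 0 (w i / w p)" for i by simp
  have "zd (fls_X_inv :: 'k fls) = - fls_X_inv"
    by (simp add: derivation_def power2_eq_square mult.assoc[symmetric] XX)
  then have zw: "zd (w i) = - w i" for i by (simp add: w_def zd_mult zd_const)
  have eq: "(\<Sum>l<n. C $$ (i, l) * w l) + zd (w i) = (fls_const a - 1) * w i + fls_X_inv * s i" for i
  proof -
    have "(\<Sum>l<n. C $$ (i, l) * w l) = fls_X_inv * (\<Sum>l<n. C $$ (i, l) * fls_const (u $ l))"
      by (simp add: w_def sum_distrib_left mult_ac)
    also have "\<dots> = fls_X_inv * s i + fls_const a * w i"
      unfolding s_def w_def by (simp only: right_diff_distrib mult_ac) simp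
    finally show ?thesis by (simp add: zw algebra_simps)
  qed
  have i3: "vanishes_below 0 (fls_X_inv * s i)" if "i < n" for i
    using vanishes_below_mult[OF Xinv s[OF that]] by simp
  have i4: "vanishes_below 0 (fls_const a - 1)" by (simp add: vanishes_below_diff)
  obtain Q' C' where Q': "logarithmic_basis n A Q' C'" "det Q' = det Q * w p"
    by (rule logarithmic_basis_replace_vector[OF A B p(1) w0 i1 i2 i3 i4 eq])
  have "fls_subdegree (w p) = -1" using p by (simp add: w_def)
  then have "fls_subdegree (det Q') = fls_subdegree (det Q) - 1"
    using w0 logarithmic_basis_det_nonzero[OF B] by (simp add: Q'(2))
  then show ?thesis using that Q'(1) by blast
qed

lemma logarithmic_basis_enlarge:
  fixes A :: "'k::alg_closed_field fls mat"
  assumes A: "A \<in> carrier_mat n n" and B: "logarithmic_basis n A Q C" and n: "n > 0"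
  shows "\<exists>Q' C'. logarithmic_basis n A Q' C' \<and>
    fls_subdegree (det Q') = fls_subdegree (det Q) - int k"
proof (induction k)
  case 0
  show ?case using B by auto
next
  case (Suc k)
  then obtain Q' C' where B': "logarithmic_basis n A Q' C'"
    "fls_subdegree (det Q') = fls_subdegree (det Q) - int k" by blast
  obtain Q'' C'' where "logarithmic_basis n A Q'' C''"
    "fls_subdegree (det Q'') = fls_subdegree (det Q') - 1"
    using logarithmic_basis_enlarge_one[OF A B'(1) n] .
  then show ?case using B'(2) by (intro exI[of _ Q''] exI[of _ C'']) simp
qed

text \<open>The order \<open>a\<close> of \<open>det Q\<close> is first made nonnegative, which \<open>\<bar>a\<bar>\<close> multiplications by \<open>z\<close> achieve,
  and then lowered to \<open>0\<close> in steps of \<open>1\<close>. The remaining unit is absorbed in the first basis vector.\<close>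

lemma unimodular_logarithmic_basis:
  fixes A :: "'k::alg_closed_field fls mat"
  assumes A: "A \<in> carrier_mat n n" and B: "logarithmic_basis n A Q C"
  obtains Q' C' where "logarithmic_basis n A Q' C'" "det Q' = 1"
proof (cases "n = 0")
  case True
  have "Q \<in> carrier_mat n n" using B GL_carrier_mat by (auto simp: logarithmic_basis_def)
  then have "det Q = 1" using True det_dim_zero by blast
  then show ?thesis using that B by blast
next
  case False
  define a where "a = fls_subdegree (det Q)"
  obtain Q1 C1 where B1: "logarithmic_basis n A Q1 C1"
    "fls_subdegree (det Q1) = a + int (nat \<bar>a\<bar> * n)"
    using logarithmic_basis_shrink[OF A B] unfolding a_def by blast
  have "\<bar>a\<bar> * 1 \<le> \<bar>a\<bar> * int n" using False by (intro mult_left_mono) auto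
  then have "0 \<le> a + int (nat \<bar>a\<bar> * n)" by simp
  then obtain Q2 C2 where B2: "logarithmic_basis n A Q2 C2" "fls_subdegree (det Q2) = 0"
    using logarithmic_basis_enlarge[OF A B1(1), of "nat (a + int (nat \<bar>a\<bar> * n))"] False B1(2)
    by auto
  let ?d = "det Q2"
  have d0: "?d \<noteq> 0" by (rule logarithmic_basis_det_nonzero[OF B2(1)])
  have d: "vanishes_below 0 ?d" "vanishes_below 0 (1 / ?d)"
    using B2(2) d0 by (simp_all add: vanishes_below_iff divide_inverse)
  define w where "w i = (if i = 0 then 1 / ?d else 0)" for i :: nat
  define r where "r i = (\<Sum>l<n. C2 $$ (i, l) * w l) + zd (w i)" for i
  have w: "vanishes_below 0 (w i)" for i using d by (simp add: w_def)
  have "integral_mat n C2" using B2 by (simp add: logarithmic_basis_def)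
  then have r: "vanishes_below 0 (r i)" if "i < n" for i
    using that unfolding r_def integral_mat_def
    by (intro vanishes_below_add vanishes_below_sum vanishes_below_zd vanishes_below_scale w) auto
  have "1 / w 0 = ?d" "w i / w 0 = (if i = 0 then 1 else 0)" for i
    using d0 by (simp_all add: w_def)
  then have w1: "vanishes_below 0 (1 / w 0)" "vanishes_below 0 (w i / w 0)" for i
    using d by simp_all
  obtain Q' C' where "logarithmic_basis n A Q' C'" "det Q' = det Q2 * w 0"
    by (rule logarithmic_basis_replace_vector[OF A B2(1), of 0 w r 0])
      (use False d0 w1 r in \<open>auto simp: w_def r_def\<close>)
  then show ?thesis using that d0 by (simp add: w_def)
qed

lemma tensor_special_linear_trace:
  fixes A :: "'k::field_char_0 fls mat"
  assumes "A \<in> lie_algebra_tensor n (SL n) S"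
  shows "(\<Sum>i<n. A $$ (i, i)) = 0"
proof -
  interpret c: comm_ring_hom "fls_const :: 'k \<Rightarrow> 'k fls" by (rule comm_ring_hom_fls_const)
  obtain r :: nat and c X where A: "A = mat n n (\<lambda>ij. \<Sum>l<r. c l * fls_const (X l $$ ij))"
    and X: "\<And>l. l < r \<Longrightarrow> X l \<in> lie_algebra n (SL n)"
    using assms unfolding lie_algebra_tensor_def by blast
  have "(\<Sum>i<n. A $$ (i, i)) = (\<Sum>i<n. \<Sum>l<r. c l * fls_const (X l $$ (i, i)))"
    by (simp add: A)
  also have "\<dots> = (\<Sum>l<r. c l * fls_const (\<Sum>i<n. X l $$ (i, i)))"
    by (subst sum.swap) (simp only: c.hom_sum sum_distrib_left)
  also have "\<dots> = 0" using X by (simp add: lie_algebra_special_linear)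
  finally show ?thesis .
qed

theorem Fuchsian_imp_regular_SL:
  fixes A :: "'k::{alg_closed_field, field_char_0} fls mat"
  assumes F: "Fuchsian_connection n (SL n) A"
  shows "regular_connection n (SL n) A"
proof -
  have A: "A \<in> connections n (SL n)" using F by (simp add: Fuchsian_connection_def)
  have Am: "A \<in> carrier_mat n n" by (rule connection_carrier[OF A])
  obtain Q0 C0 where B0: "logarithmic_basis n A Q0 C0"
    using Fuchsian_imp_logarithmic_basis[OF SL_subset_GL F] .
  obtain Q C where B: "logarithmic_basis n A Q C" and det: "det Q = 1"
    by (rule unimodular_logarithmic_basis[OF Am B0])
  then have Q: "Q \<in> carrier (GL n)" and C: "integral_mat n C" by (auto simp: logarithmic_basis_def)
  have Cm: "C \<in> carrier_mat n n" using C by (simp add: integral_mat_def)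
  have trC: "(\<Sum>i<n. C $$ (i, i)) = 0"
    using logarithmic_basis_det[OF Am B] tensor_special_linear_trace[OF A[unfolded connections_def]]
    by (simp add: det zd_1)
  \<comment> \<open>Since \<open>tr C = 0\<close>, the corrections by \<open>E\<^sub>0\<^sub>0\<close> cancel in the expansion of \<open>C\<close>.\<close>
  define X :: "nat \<Rightarrow> nat \<Rightarrow> 'k mat"
    where "X i j = unit_mat n i j - (if i = j then unit_mat n 0 0 else 0\<^sub>m n n)" for i j
  have "- C \<in> lie_algebra_tensor n (SL n) power_series"
  proof (rule lie_algebra_tensorI[of _ X])
    show "- C \<in> carrier_mat n n" using Cm by simp
    show "(- C) $$ (i, j) \<in> power_series" if "i < n" "j < n" for i j
      using C that by (auto simp: integral_mat_def power_series_iff intro!: vanishes_below_uminus)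
    show "X i j \<in> lie_algebra n (SL n)" if "i < n" "j < n" for i j
    proof -
      have tr: "(\<Sum>a<n. unit_mat n i j $$ (a, a)) = (if i = j then 1 else 0 :: 'k)" if "i < n" for i j
      proof -
        have "(\<Sum>a<n. unit_mat n i j $$ (a, a)) = (\<Sum>a<n. if a = i then (if i = j then 1 else 0 :: 'k) else 0)"
          by (rule sum.cong) (auto simp: unit_mat_def)
        then show ?thesis using that by simp
      qed
      have "(\<Sum>a<n. X i j $$ (a, a)) =
          (\<Sum>a<n. unit_mat n i j $$ (a, a)) - (if i = j then (\<Sum>a<n. unit_mat n 0 0 $$ (a, a)) else 0)"
        by (simp add: X_def unit_mat_def sum_subtractf)
      also have "\<dots> = 0" using tr[of i j] tr[of 0 0] that by simp
      finally have "(\<Sum>a<n. X i j $$ (a, a)) = 0" .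
      moreover have "X i j \<in> carrier_mat n n"
        by (auto simp: X_def unit_mat_def intro!: minus_carrier_mat)
      ultimately show ?thesis by (simp add: lie_algebra_special_linear)
    qed
    fix a b assume ab: "a < n" "b < n"
    have "(\<Sum>i<n. \<Sum>j<n. (- C) $$ (i, j) * fls_const (X i j $$ (a, b))) =
        (\<Sum>i<n. \<Sum>j<n. (- C) $$ (i, j) * fls_const (unit_mat n i j $$ (a, b)) -
          (if i = j then (- C) $$ (i, i) * fls_const (unit_mat n 0 0 $$ (a, b)) else 0))"
      using ab by (intro sum.cong refl)
        (auto simp: X_def unit_mat_def right_diff_distrib fls_minus_const[symmetric] simp del: fls_minus_const)
    also have "\<dots> = (- C) $$ (a, b) - (\<Sum>i<n. (- C) $$ (i, i)) * fls_const (unit_mat n 0 0 $$ (a, b))"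
      by (simp add: sum_subtractf unit_mat_expansion[OF ab] sum_distrib_right)
    also have "(\<Sum>i<n. (- C) $$ (i, i)) = 0"
      using trC Cm by (simp add: sum_negf)
    finally show "(- C) $$ (a, b) = (\<Sum>i<n. \<Sum>j<n. (- C) $$ (i, j) * fls_const (X i j $$ (a, b)))"
      by simp
  qed
  moreover have "inv\<^bsub>GL n\<^esub> Q \<in> points fls_const n (SL n)"
  proof -
    have "det (inv\<^bsub>GL n\<^esub> Q) = 1"
      using det_mult[of "inv\<^bsub>GL n\<^esub> Q" n Q] GL_inv_mat[OF Q] GL_carrier_mat[OF Q] det by simp
    then show ?thesis
      unfolding points_special_linear[OF comm_ring_hom_fls_const]
      using GL_inv_closed[OF Q] by (simp add: SL_def)
  qed
  ultimately show ?thesis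
    using A logarithmic_basis_gauge[OF Am B, symmetric]
    unfolding regular_connection_def gauge_equivalent_def by blast
qed

section \<open>Regular and Fuchsian connections\<close>

theorem proposition7p3:
  shows "(\<forall>n (G :: 'k::{alg_closed_field, field_char_0} mat set).
            linear_algebraic_group n G \<longrightarrow>
            (\<forall>A. regular_connection n G A \<longrightarrow> Fuchsian_connection n G A)) \<and>
         (\<forall>n (A :: 'k fls mat).
            Fuchsian_connection n (carrier (GL n)) A \<longrightarrow> regular_connection n (carrier (GL n)) A) \<and>
         (\<forall>n (A :: 'k fls mat).
            Fuchsian_connection n (SL n) A \<longrightarrow> regular_connection n (SL n) A)"
  using regular_imp_Fuchsian Fuchsian_imp_regular_GL Fuchsian_imp_regular_SL by blast

end
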